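(* Let $T$ be a $C_0$-semigroup on a complex Hilbert space $X$, with generator $A$. The following are equivalent: (i) $T$ satisfies lower bounds. (ii) There is a left-inverse semigroup for $T$ on $X$. (iii) There is a $C_0$-group extension $S$ of $T$ on a Hilbert space $Y \supseteq X$. (iv) There exist $Q \in \mathcal{B}(X)$ and an equivalent inner product on $X$ such that the $C_0$-semigroup generated by $A+Q$ is isometric in the equivalent norm. If $c>0$ and $\alpha\in\mathbb{R}$ are such that $\|T(t)x\| \ge ce^{-\alpha t} \|x\|$ for all $x \in X$ and $t>0$, and $\omega>\alpha$, then $Y$ and $S$ in (iii) may be chosen so that $\|S(t)\| \le \sqrt2\, \|T(t)\|$ and $\|S(-t)\| \le M e^{\omega t}$ for all $t>0$, for some constant $M$.
   Context: $\mathcal{B}(X)$ denotes the bounded linear operators on $X$. $T$ satisfies lower bounds if there is a function $t\mapsto c(t)\in(0,\infty)$ such that $\|T(t)x\|\ge c(t)\|x\|$ for all $x\in X$, $t\ge0$. A left-inverse semigroup for $T$ on $X$ is a $C_0$-semigroup $L$ on $X$ with $L(t)T(t)x=x$ for all $x\in X$, $t\ge0$. $Y\supseteq X$ means that $X$ is a closed subspace of $Y$ with the same norm (up to identification via a linear isometric embedding of $X$ into $Y$). A $C_0$-group $S$ on $Y\supseteq X$ is a $C_0$-group extension of $T$ on $Y$ if $X$ is invariant under $S(t)$ and $T(t)=S(t)|_X$ for all $t\ge0$. An equivalent inner product is one whose norm is equivalent to the original norm. *)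

theory Defs
  imports "HOL-Analysis.Analysis" "HOL-Library.Function_Algebras"
begin

section \<open>Complex Hilbert spaces as a type class\<close>

text \<open>
  A complex Hilbert space is a complete real inner product space with a compatible complex
  structure: the real inner product is the real part of the complex one, so the norm of the class
  \<^class>\<open>real_inner\<close> is the Hilbert space norm. Inner products are linear in the first argument.
\<close>

class complex_hilbert_space = real_inner + complete_space +
  fixes scaleC :: "complex \<Rightarrow> 'a \<Rightarrow> 'a"
    and cinner :: "'a \<Rightarrow> 'a \<Rightarrow> complex"
  assumes scaleC_add_right: "scaleC c (x + y) = scaleC c x + scaleC c y"
    and scaleC_add_left: "scaleC (c + d) x = scaleC c x + scaleC d x"
    and scaleC_scaleC: "scaleC c (scaleC d x) = scaleC (c * d) x"
    and scaleC_of_real: "scaleC (complex_of_real r) x = r *\<^sub>R x"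
    and cinner_add_left: "cinner (x + y) z = cinner x z + cinner y z"
    and cinner_scaleC_left: "cinner (scaleC c x) y = c * cinner x y"
    and cinner_commute: "cinner y x = cnj (cinner x y)"
    and Re_cinner: "Re (cinner x y) = inner x y"

instance complex_hilbert_space \<subseteq> banach ..

definition bounded_clinear :: "('a::complex_hilbert_space \<Rightarrow> 'a) \<Rightarrow> bool" where
  "bounded_clinear f \<longleftrightarrow> bounded_linear f \<and> (\<forall>c x. f (scaleC c x) = scaleC c (f x))"

section \<open>Semigroups on a Hilbert space type\<close>

text \<open>Semigroups are functions on \<^typ>\<open>real\<close> of which only the values at \<open>t \<ge> 0\<close> matter.\<close>

definition C0_semigroup :: "(real \<Rightarrow> 'a::complex_hilbert_space \<Rightarrow> 'a) \<Rightarrow> bool" where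
  "C0_semigroup T \<longleftrightarrow>
     (\<forall>t\<ge>0. bounded_clinear (T t)) \<and>
     (\<forall>x. T 0 x = x) \<and>
     (\<forall>s\<ge>0. \<forall>t\<ge>0. \<forall>x. T (s + t) x = T s (T t x)) \<and>
     (\<forall>x. continuous_on {0..} (\<lambda>t. T t x))"

text \<open>Unbounded operators are represented by their graphs.\<close>

definition generator :: "(real \<Rightarrow> 'a::complex_hilbert_space \<Rightarrow> 'a) \<Rightarrow> ('a \<times> 'a) set" where
  "generator T = {(x, y). ((\<lambda>h. (1 / h) *\<^sub>R (T h x - x)) \<longlongrightarrow> y) (at_right 0)}"

definition plus_bounded :: "('a::complex_hilbert_space \<times> 'a) set \<Rightarrow> ('a \<Rightarrow> 'a) \<Rightarrow> ('a \<times> 'a) set" where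
  "plus_bounded A Q = {(x, y + Q x) |x y. (x, y) \<in> A}"

definition satisfies_lower_bounds :: "(real \<Rightarrow> 'a::complex_hilbert_space \<Rightarrow> 'a) \<Rightarrow> bool" where
  "satisfies_lower_bounds T \<longleftrightarrow>
     (\<exists>c :: real \<Rightarrow> real. \<forall>t\<ge>0. 0 < c t \<and> (\<forall>x. c t * norm x \<le> norm (T t x)))"

definition left_inverse_semigroup ::
  "(real \<Rightarrow> 'a::complex_hilbert_space \<Rightarrow> 'a) \<Rightarrow> (real \<Rightarrow> 'a \<Rightarrow> 'a) \<Rightarrow> bool" where
  "left_inverse_semigroup L T \<longleftrightarrow> C0_semigroup L \<and> (\<forall>t\<ge>0. \<forall>x. L t (T t x) = x)"

section \<open>Hilbert spaces on a carrier set\<close>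

text \<open>
  The extension space is existentially quantified, so it cannot be a type. It is a subspace \<open>Y\<close> of
  the vector space given by \<open>smul\<close> on a type, with an inner product \<open>ip\<close> for which it is complete.
\<close>

definition inner_product_on ::
  "(complex \<Rightarrow> 'b \<Rightarrow> 'b) \<Rightarrow> 'b set \<Rightarrow> ('b::ab_group_add \<Rightarrow> 'b \<Rightarrow> complex) \<Rightarrow> bool" where
  "inner_product_on smul Y ip \<longleftrightarrow>
     (\<forall>x\<in>Y. \<forall>y\<in>Y. \<forall>z\<in>Y. ip (x + y) z = ip x z + ip y z) \<and>
     (\<forall>c. \<forall>x\<in>Y. \<forall>y\<in>Y. ip (smul c x) y = c * ip x y) \<and>
     (\<forall>x\<in>Y. \<forall>y\<in>Y. ip y x = cnj (ip x y)) \<and>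
     (\<forall>x\<in>Y. x \<noteq> 0 \<longrightarrow> 0 < Re (ip x x))"

definition ip_norm :: "('b \<Rightarrow> 'b \<Rightarrow> complex) \<Rightarrow> 'b \<Rightarrow> real" where
  "ip_norm ip x = sqrt (Re (ip x x))"

definition hilbert_space_on ::
  "(complex \<Rightarrow> 'b \<Rightarrow> 'b) \<Rightarrow> 'b set \<Rightarrow> ('b::ab_group_add \<Rightarrow> 'b \<Rightarrow> complex) \<Rightarrow> bool" where
  "hilbert_space_on smul Y ip \<longleftrightarrow>
     vector_space smul \<and> module.subspace smul Y \<and> inner_product_on smul Y ip \<and>
     (\<forall>u :: nat \<Rightarrow> 'b. range u \<subseteq> Y \<longrightarrow>
        (\<forall>e>0. \<exists>N. \<forall>m\<ge>N. \<forall>n\<ge>N. ip_norm ip (u m - u n) < e) \<longrightarrow>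
        (\<exists>y\<in>Y. (\<lambda>n. ip_norm ip (u n - y)) \<longlonglongrightarrow> 0))"

definition bounded_operator_on ::
  "(complex \<Rightarrow> 'b \<Rightarrow> 'b) \<Rightarrow> 'b set \<Rightarrow> ('b::ab_group_add \<Rightarrow> 'b \<Rightarrow> complex) \<Rightarrow> ('b \<Rightarrow> 'b) \<Rightarrow> bool" where
  "bounded_operator_on smul Y ip f \<longleftrightarrow>
     f ` Y \<subseteq> Y \<and>
     (\<forall>x\<in>Y. \<forall>y\<in>Y. f (x + y) = f x + f y) \<and>
     (\<forall>c. \<forall>x\<in>Y. f (smul c x) = smul c (f x)) \<and>
     (\<exists>K. \<forall>x\<in>Y. ip_norm ip (f x) \<le> K * ip_norm ip x)"

text \<open>As for \<^const>\<open>onorm\<close>, the quotient at \<open>0\<close> is \<open>0\<close>.\<close>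

definition op_norm_on :: "'b set \<Rightarrow> ('b \<Rightarrow> 'b \<Rightarrow> complex) \<Rightarrow> ('b \<Rightarrow> 'b) \<Rightarrow> real" where
  "op_norm_on Y ip f = (SUP y\<in>Y. ip_norm ip (f y) / ip_norm ip y)"

definition C0_group_on ::
  "(complex \<Rightarrow> 'b \<Rightarrow> 'b) \<Rightarrow> 'b set \<Rightarrow> ('b::ab_group_add \<Rightarrow> 'b \<Rightarrow> complex) \<Rightarrow>
   (real \<Rightarrow> 'b \<Rightarrow> 'b) \<Rightarrow> bool" where
  "C0_group_on smul Y ip S \<longleftrightarrow>
     (\<forall>t. bounded_operator_on smul Y ip (S t)) \<and>
     (\<forall>y\<in>Y. S 0 y = y) \<and>
     (\<forall>s t. \<forall>y\<in>Y. S (s + t) y = S s (S t y)) \<and>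
     (\<forall>t. \<forall>y\<in>Y. ((\<lambda>s. ip_norm ip (S s y - S t y)) \<longlongrightarrow> 0) (at t))"

definition isometric_embedding ::
  "(complex \<Rightarrow> 'b \<Rightarrow> 'b) \<Rightarrow> 'b set \<Rightarrow> ('b::ab_group_add \<Rightarrow> 'b \<Rightarrow> complex) \<Rightarrow>
   ('a::complex_hilbert_space \<Rightarrow> 'b) \<Rightarrow> bool" where
  "isometric_embedding smul Y ip J \<longleftrightarrow>
     range J \<subseteq> Y \<and>
     (\<forall>x y. J (x + y) = J x + J y) \<and>
     (\<forall>c x. J (scaleC c x) = smul c (J x)) \<and>
     (\<forall>x. ip_norm ip (J x) = norm x)"

text \<open>
  \<open>S\<close> is a group on the Hilbert space \<open>Y\<close>, which contains the original space via \<open>J\<close>. The last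
  condition says both that the range of \<open>J\<close> is invariant and that \<open>S\<close> restricts to \<open>T\<close> on it.
\<close>

definition C0_group_extension ::
  "(real \<Rightarrow> 'a::complex_hilbert_space \<Rightarrow> 'a) \<Rightarrow>
   (complex \<Rightarrow> 'b \<Rightarrow> 'b) \<Rightarrow> 'b set \<Rightarrow> ('b::ab_group_add \<Rightarrow> 'b \<Rightarrow> complex) \<Rightarrow>
   ('a \<Rightarrow> 'b) \<Rightarrow> (real \<Rightarrow> 'b \<Rightarrow> 'b) \<Rightarrow> bool" where
  "C0_group_extension T smul Y ip J S \<longleftrightarrow>
     hilbert_space_on smul Y ip \<and>
     isometric_embedding smul Y ip J \<and>
     C0_group_on smul Y ip S \<and>
     (\<forall>t\<ge>0. \<forall>x. S t (J x) = J (T t x))"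

text \<open>
  A type large enough for extension spaces. Given any group extension \<open>(Y, S)\<close>, the closed linear
  span of \<open>{S t (J x) | t x}\<close> is again one, with no larger operator norms, and
  \<open>y \<mapsto> (\<lambda>(t, x). ip y (S t (J x)))\<close> maps it linearly and injectively into this type. Hence
  existence of an extension on some Hilbert space is existence of one inside this type.
\<close>

type_synonym 'a extension_space = "real \<times> 'a \<Rightarrow> complex"

section \<open>Equivalent inner products\<close>

definition equivalent_inner_product ::
  "('a::complex_hilbert_space \<Rightarrow> 'a \<Rightarrow> complex) \<Rightarrow> bool" where
  "equivalent_inner_product ip \<longleftrightarrow>
     inner_product_on scaleC UNIV ip \<and>
     (\<exists>m>0. \<exists>M>0. \<forall>x. m * norm x \<le> ip_norm ip x \<and> ip_norm ip x \<le> M * norm x)"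

end

(*
  (i) => (iv), (ii).  The form b(x,y) = int_0^1 <T(t)x, T(t)y> dt is an equivalent real inner product
  because of the lower bounds, and 2 b(Ax,x) = |T(1)x|^2 - |x|^2 is a bounded form.  Hence
  2 b(Ax,x) = -2 b(Qx,x) for a bounded b-symmetric Q; so A + Q generates a b-isometric semigroup,
  and if H is generated by A + 2Q then b(T(t)x, H(t)y) is constant in t, which makes the b-adjoints
  L(t) of H(t) left inverses of T(t).  Strong continuity of L is free: L(t)x - x = L(t)(x - T(t)x).

  (iv) => (i).  With b the new inner product, (d/dt) b(T(t)x,T(t)x) = -2 b(Q T(t)x, T(t)x), which is
  at least -2k b(T(t)x,T(t)x).

  (i) => (iii), quantitatively.  Fix a large time tau, put E = T(tau), beta = exp(omega tau), and let
  F be the left inverse of E that vanishes on the complement of the range of E, so that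
  q = |F|/beta is small.  A group extension must satisfy S(-n tau)x = S(-(n+1) tau)Ex.  So let
  sequences f in l2(X) stand for the sums of beta^(-n) S(-n tau) f(n) and divide out the relations
  E h(n) - h(n+1)/beta, h(0) = 0.  There is a projection P along them, of norm at most
  1/(1-q) <= sqrt 2, onto the sequences with f(n) orthogonal to the range of E for n >= 1.  The
  pointwise action of T(t) and beta times the right shift respect the relations and induce S(t) and
  S(-tau); in particular |S(t)| <= |P| |T(t)|.
*)

theory Submission
  imports Defs
begin

text \<open>For the given inner product Re <Ax, x> need not be bounded, and this is what blocks a
  direct choice of Q in (iv). Averaging over a unit of time turns it into a boundary term that only
  involves T(0) and T(1). The operators Q, L(t) and F all come from a real Lax-Milgram lemma;
  complex linearity is read off from invariance of the forms under the imaginary unit. Since A is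
  unbounded, orbits are differentiated on its domain only, and each identity is then extended by
  density. For the extension the obstacle is the factor c: it may be small, and inverting T over
  many short steps would collect powers of 1/c. One long step absorbs it, because q <=
  exp(-(\<omega> - \<alpha>) \<tau>) / c, which is where \<omega> > \<alpha> enters; q <= 1 - 1/sqrt
  2 is exactly what makes 1/(1-q) <= sqrt 2. The quotient by the relations is not formed: the range
  of P, a closed subspace of l2(X), stands for it and inherits its inner product. X sits at index 0,
  where P fixes it, so the embedding is isometric.\<close>

section \<open>Complex scalars through real scalars and the imaginary unit\<close>

lemma bounded_clinearD:
  assumes "bounded_clinear f"
  shows "bounded_linear f" "f (scaleC c x) = scaleC c (f x)"
  using assms by (auto simp: bounded_clinear_def)

lemma scaleC_eq: "scaleC c x = Re c *\<^sub>R x + Im c *\<^sub>R scaleC \<i> x"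
  for x :: "'a::complex_hilbert_space"
proof -
  have "c = complex_of_real (Re c) + complex_of_real (Im c) * \<i>"
    by (simp add: complex_eq_iff)
  then have "scaleC c x = scaleC (complex_of_real (Re c) + complex_of_real (Im c) * \<i>) x"
    by simp
  then show ?thesis
    by (simp only: scaleC_add_left scaleC_scaleC[symmetric] scaleC_of_real)
qed

lemma inner_scaleC_i: "inner (scaleC \<i> x) (scaleC \<i> y) = inner x y"
  for x y :: "'a::complex_hilbert_space"
proof -
  have "cinner (scaleC \<i> x) (scaleC \<i> y) = \<i> * cnj (\<i> * cinner y x)"
    by (metis cinner_commute cinner_scaleC_left)
  then have "cinner (scaleC \<i> x) (scaleC \<i> y) = cinner x y"
    by (simp add: cinner_commute[of y x])
  then show ?thesis by (metis Re_cinner)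
qed

lemma norm_scaleC_i: "norm (scaleC \<i> x) = norm x" for x :: "'a::complex_hilbert_space"
  by (simp add: norm_eq_sqrt_inner inner_scaleC_i)

lemma scaleC_minus_right: "scaleC c (- x) = - scaleC c x" for x :: "'a::complex_hilbert_space"
  by (metis add.right_inverse add_cancel_right_left minus_unique scaleC_add_right)

lemma scaleC_diff_right: "scaleC c (x - y) = scaleC c x - scaleC c y"
  for x y :: "'a::complex_hilbert_space"
  using scaleC_add_right[of c x "- y"] by (simp add: scaleC_minus_right)

lemma scaleC_zero_right[simp]: "scaleC c 0 = (0 :: 'a::complex_hilbert_space)"
  using scaleC_add_right[of c "0::'a" 0] by simp

lemma scaleC_scaleR: "scaleC c (r *\<^sub>R x) = r *\<^sub>R scaleC c x" for x :: "'a::complex_hilbert_space"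
  by (simp add: scaleC_of_real[symmetric] scaleC_scaleC mult.commute)

lemma scaleC_i_i: "scaleC \<i> (scaleC \<i> x) = - x" for x :: "'a::complex_hilbert_space"
  using scaleC_of_real[of "-1" x] by (simp add: scaleC_scaleC)

lemma bounded_clinear_scaleC_i: "bounded_clinear (scaleC \<i> :: 'a::complex_hilbert_space \<Rightarrow> 'a)"
proof -
  have "bounded_linear (scaleC \<i> :: 'a \<Rightarrow> 'a)"
    by (intro bounded_linear_intro[of _ 1]) (auto simp: scaleC_add_right scaleC_scaleR norm_scaleC_i)
  then show ?thesis
    by (auto simp: bounded_clinear_def scaleC_scaleC mult.commute)
qed

text \<open>By \<open>scaleC_eq\<close> every complex scalar acts through real scalars and the
  imaginary unit. The operators below are built from real forms, fixed points and integral
  equations, and become complex linear this way.\<close>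

lemma bounded_clinearI:
  assumes "bounded_linear f" "\<And>x. f (scaleC \<i> x) = scaleC \<i> (f x)"
  shows "bounded_clinear f"
proof -
  interpret f: bounded_linear f by fact
  show ?thesis unfolding bounded_clinear_def
    by (metis assms f.add f.scaleR scaleC_eq)
qed

lemma bounded_clinear_id: "bounded_clinear (\<lambda>x. x)"
  by (simp add: bounded_clinear_def)

lemma bounded_clinear_compose:
  "bounded_clinear f \<Longrightarrow> bounded_clinear g \<Longrightarrow> bounded_clinear (\<lambda>x. f (g x))"
  by (auto simp: bounded_clinear_def intro: bounded_linear_compose)

section \<open>The uniform boundedness principle\<close>

text \<open>By Baire one of the closed sets \<open>C n\<close> contains a ball, and linearity
  spreads the bound on that ball to the whole space.\<close>

theorem uniform_boundedness:
  fixes F :: "'i \<Rightarrow> 'a::banach \<Rightarrow> 'b::real_normed_vector"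
  assumes lin: "\<And>i. i \<in> I \<Longrightarrow> bounded_linear (F i)"
    and bdd: "\<And>x. \<exists>K. \<forall>i\<in>I. norm (F i x) \<le> K"
  obtains K where "0 < K" "\<And>i x. i \<in> I \<Longrightarrow> norm (F i x) \<le> K * norm x"
proof -
  define C where "C n = {x. \<forall>i\<in>I. norm (F i x) \<le> real n}" for n
  have closed: "closed (C n)" for n
  proof -
    have "C n = (\<Inter>i\<in>I. {x. norm (F i x) \<le> real n})" by (auto simp: C_def)
    moreover have "closed {x. norm (F i x) \<le> real n}" if "i \<in> I" for i
      by (intro closed_Collect_le continuous_on_norm continuous_on_const
          linear_continuous_on lin[OF that])
    ultimately show ?thesis by auto
  qed
  have UN: "\<Union>(range C) = UNIV"
  proof -
    have "\<exists>n. x \<in> C n" for x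
    proof -
      obtain K where "\<forall>i\<in>I. norm (F i x) \<le> K" using bdd by blast
      moreover obtain n where "K \<le> real n" using real_arch_simple by blast
      ultimately show ?thesis by (auto simp: C_def intro: order_trans)
    qed
    then show ?thesis by auto
  qed
  have "\<exists>n. interior (C n) \<noteq> {}"
  proof (rule ccontr)
    assume "\<not> ?thesis"
    then have "euclidean interior_of \<Union>(range C) = {}"
      by (intro Baire_category_alt) (auto simp: completely_metrizable_space_euclidean closed)
    then show False using UN by simp
  qed
  then obtain n x0 e where e: "e > 0" "cball x0 e \<subseteq> C n"
    by (meson all_not_in_conv mem_interior_cball)
  have bound: "norm (F i x) \<le> 2 * real n / e * norm x" if i: "i \<in> I" for i x
  proof (cases "x = 0")
    case True
    then show ?thesis using linear_simps(3)[OF lin[OF i]] by simp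
  next
    case False
    interpret Fi: bounded_linear "F i" by (rule lin[OF i])
    let ?z = "(e / norm x) *\<^sub>R x"
    have "x0 + ?z \<in> C n" "x0 \<in> C n" using e False by (auto simp: subset_iff dist_norm)
    then have "norm (F i (x0 + ?z)) \<le> n" "norm (F i x0) \<le> n" using i by (auto simp: C_def)
    then have "norm (F i (x0 + ?z) - F i x0) \<le> 2 * real n"
      using norm_triangle_ineq4[of "F i (x0 + ?z)" "F i x0"] by linarith
    then have "norm (F i ?z) \<le> 2 * real n" by (simp add: Fi.add)
    then show ?thesis using False e by (simp add: Fi.scaleR field_simps)
  qed
  \<comment> \<open>The added 1 keeps the constant positive when \<open>n\<close> is 0.\<close>
  have "norm (F i x) \<le> (2 * real n / e + 1) * norm x" if "i \<in> I" for i x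
    using bound[OF that, of x] norm_ge_zero[of x] unfolding distrib_right by linarith
  moreover have "0 < 2 * real n / e + 1" using e by (intro add_nonneg_pos) auto
  ultimately show ?thesis by (rule that[rotated])
qed

section \<open>Minimisation of quadratic functionals\<close>

lemma quadratic_nonneg_imp_zero:
  fixes a p :: real
  assumes "\<And>t. 0 \<le> t\<^sup>2 * a + 2 * t * p"
  shows "p = 0"
proof (rule ccontr)
  assume p: "p \<noteq> 0"
  \<comment> \<open>A step against the sign of \<open>p\<close>, so short that the quadratic term
    cannot use up the linear gain.\<close>
  define t where "t = - p / (\<bar>a\<bar> + 1)"
  have "t\<^sup>2 * a + 2 * t * p = p\<^sup>2 / k * (a / k - 2)" if "k \<noteq> 0" "t = - p / k" for k
    using that(1) unfolding that(2) by (simp add: field_simps power2_eq_square)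
  then have "t\<^sup>2 * a + 2 * t * p = p\<^sup>2 / (\<bar>a\<bar> + 1) * (a / (\<bar>a\<bar> + 1) - 2)"
    by (simp add: t_def)
  also have "\<dots> < 0"
  proof (rule mult_pos_neg)
    show "0 < p\<^sup>2 / (\<bar>a\<bar> + 1)" using p by simp
    have "a / (\<bar>a\<bar> + 1) \<le> 1" using divide_le_eq_1_pos[of "\<bar>a\<bar> + 1" a] by linarith
    then show "a / (\<bar>a\<bar> + 1) - 2 < 0" by linarith
  qed
  finally show False using assms[of t] by simp
qed

text \<open>The solution is the minimiser of \<open>b y y - 2 * f y\<close> on \<open>K\<close>:
  minimising sequences are Cauchy by the parallelogram law, and the vanishing first variation at the
  limit is the claimed equation.\<close>

theorem symmetric_Lax_Milgram:
  fixes b :: "'a::banach \<Rightarrow> 'a \<Rightarrow> real"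
  assumes b: "bounded_bilinear b"
    and sym: "\<And>x y. b x y = b y x"
    and m: "0 < m" "\<And>x. m * (norm x)\<^sup>2 \<le> b x x"
    and f: "bounded_linear f"
    and K: "subspace K" "closed K"
  obtains z where "z \<in> K" "\<And>y. y \<in> K \<Longrightarrow> b z y = f y"
proof -
  interpret b: bounded_bilinear b by (rule b)
  interpret f: bounded_linear f by (rule f)
  define J where "J y = b y y - 2 * f y" for y
  obtain C where C: "\<And>x. norm (f x) \<le> norm x * C" using f.bounded by blast
  have below: "- (C\<^sup>2 / m) \<le> J y" for y
  proof -
    have "0 \<le> (m * norm y - C)\<^sup>2 / m" using m by simp
    also have "(m * norm y - C)\<^sup>2 / m = m * (norm y)\<^sup>2 - 2 * (norm y * C) + C\<^sup>2 / m"
      using m by (simp add: field_simps power2_eq_square)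
    also have "\<dots> \<le> J y + C\<^sup>2 / m"
      using m(2)[of y] C[of y] by (auto simp: J_def)
    finally show ?thesis by simp
  qed
  define d where "d = Inf (J ` K)"
  have bdd: "bdd_below (J ` K)" using below by (auto intro!: bdd_belowI[of _ "- (C\<^sup>2 / m)"])
  have d: "d \<le> J y" if "y \<in> K" for y
    unfolding d_def using bdd that by (auto intro: cInf_lower)
  have "\<exists>y\<in>K. J y < d + 1 / real (Suc n)" for n
  proof -
    have "\<exists>v\<in>J ` K. v < d + 1 / real (Suc n)"
      by (rule cInf_lessD) (use subspace_0[OF K(1)] in \<open>auto simp: d_def\<close>)
    then show ?thesis by auto
  qed
  then obtain u where u: "\<And>n. u n \<in> K" "\<And>n. J (u n) < d + 1 / real (Suc n)" by metis
  \<comment> \<open>The midpoint of \<open>x\<close> and \<open>y\<close> lies in \<open>K\<close>,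
    so \<open>J\<close> is at least \<open>d\<close> there; the parallelogram identity and
    coercivity turn this into a bound on the distance.\<close>
  have par: "m / 2 * (norm (x - y))\<^sup>2 \<le> (J x - d) + (J y - d)" if "x \<in> K" "y \<in> K" for x y
  proof -
    have "(1/2) *\<^sub>R (x + y) \<in> K"
      using that K(1) by (intro subspace_scale subspace_add)
    then have "d \<le> J ((1/2) *\<^sub>R (x + y))" by (rule d)
    moreover have "J x + J y = 2 * J ((1/2) *\<^sub>R (x + y)) + 1/2 * b (x - y) (x - y)"
      unfolding J_def
      by (simp add: b.add_left b.add_right b.diff_left b.diff_right b.scaleR_left b.scaleR_right
          f.add f.scaleR sym[of y x] field_simps)
    ultimately show ?thesis using m(2)[of "x - y"] by linarith
  qed
  have "Cauchy u"
  proof (rule metric_CauchyI)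
    fix e :: real assume e: "0 < e"
    obtain N where N: "1 / real (Suc N) < m / 4 * e\<^sup>2"
      using m(1) e by (meson nat_approx_posE mult_pos_pos zero_less_power divide_pos_pos zero_less_numeral)
    have "dist (u i) (u j) < e" if "i \<ge> N" "j \<ge> N" for i j
    proof -
      have "1 / real (Suc i) \<le> 1 / real (Suc N)" "1 / real (Suc j) \<le> 1 / real (Suc N)"
        using that by (auto simp: frac_le)
      then have "m / 2 * (norm (u i - u j))\<^sup>2 < m / 2 * e\<^sup>2"
        using par[OF u(1) u(1), of i j] u(2)[of i] u(2)[of j] N by linarith
      then have "(norm (u i - u j))\<^sup>2 < e\<^sup>2" using m by simp
      then show ?thesis using e by (simp add: dist_norm power_less_imp_less_base)
    qed
    then show "\<exists>M. \<forall>i\<ge>M. \<forall>j\<ge>M. dist (u i) (u j) < e" by blast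
  qed
  then obtain z where z: "u \<longlonglongrightarrow> z" using Cauchy_convergent_iff convergent_def by blast
  have zK: "z \<in> K" using K(2) u(1) z closed_sequentially by blast
  have "(\<lambda>n. J (u n)) \<longlonglongrightarrow> J z"
    unfolding J_def by (intro tendsto_intros b.tendsto f.tendsto z)
  moreover have "(\<lambda>n. d + 1 / real (Suc n)) \<longlonglongrightarrow> d + 0"
    by (intro tendsto_add tendsto_const LIMSEQ_inverse_real_of_nat[unfolded inverse_eq_divide])
  ultimately have "J z \<le> d" using u(2) by (intro LIMSEQ_le) (auto simp: less_imp_le)
  have "b z y = f y" if y: "y \<in> K" for y
  proof -
    have "0 \<le> t\<^sup>2 * b y y + 2 * t * (b z y - f y)" for t
    proof -
      have "z + t *\<^sub>R y \<in> K" using zK y K(1) by (intro subspace_add subspace_scale)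
      then have "J z \<le> J (z + t *\<^sub>R y)" using d \<open>J z \<le> d\<close> by force
      then show ?thesis unfolding J_def
        by (simp add: b.add_left b.add_right b.scaleR_left b.scaleR_right f.add f.scaleR
            sym[of y z] field_simps power2_eq_square)
    qed
    then show ?thesis using quadratic_nonneg_imp_zero by fastforce
  qed
  with zK show ?thesis by (rule that)
qed

section \<open>Orbits of semigroups\<close>

context
  fixes T :: "real \<Rightarrow> 'a::complex_hilbert_space \<Rightarrow> 'a"
  assumes T: "C0_semigroup T"
begin

lemma C0_clinear: "0 \<le> t \<Longrightarrow> bounded_clinear (T t)"
  using T by (simp add: C0_semigroup_def)

lemma C0_linear: "0 \<le> t \<Longrightarrow> bounded_linear (T t)"
  by (simp add: C0_clinear bounded_clinearD)

lemma C0_zero: "T 0 x = x"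
  using T by (simp add: C0_semigroup_def)

lemma C0_add: "0 \<le> s \<Longrightarrow> 0 \<le> t \<Longrightarrow> T (s + t) x = T s (T t x)"
  using T by (simp add: C0_semigroup_def)

lemma C0_commute: "0 \<le> s \<Longrightarrow> 0 \<le> t \<Longrightarrow> T s (T t x) = T t (T s x)"
  by (metis C0_add add.commute)

lemma C0_continuous: "continuous_on {0..} (\<lambda>t. T t x)"
  using T by (simp add: C0_semigroup_def)

text \<open>Orbits over a compact time interval are compact, hence bounded for each vector; the
  uniform boundedness principle makes the bound uniform.\<close>

lemma C0_locally_bounded:
  obtains K where "0 < K" "\<And>t x. 0 \<le> t \<Longrightarrow> t \<le> R \<Longrightarrow> norm (T t x) \<le> K * norm x"
proof -
  have "\<exists>K. \<forall>t\<in>{0..R}. norm (T t x) \<le> K" for x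
  proof -
    have "compact ((\<lambda>t. T t x) ` {0..R})"
      by (intro compact_continuous_image continuous_on_subset[OF C0_continuous]) auto
    then show ?thesis by (meson bounded_iff compact_imp_bounded imageI)
  qed
  then show ?thesis
    using uniform_boundedness[of "{0..R}" T] C0_linear that by (metis atLeastAtMost_iff)
qed

text \<open>Strong continuity concerns one fixed vector. The local norm bound upgrades it to joint
  continuity in time and vector, which the integrands below require.\<close>

lemma C0_continuous_compose:
  fixes f :: "'p::topological_space \<Rightarrow> real"
  assumes f: "continuous_on A f" and g: "continuous_on A g" and pos: "\<And>p. p \<in> A \<Longrightarrow> 0 \<le> f p"
  shows "continuous_on A (\<lambda>p. T (f p) (g p))"
  unfolding continuous_on_def
proof
  fix q assume q: "q \<in> A"
  obtain K where K: "0 < K" "\<And>t x. 0 \<le> t \<Longrightarrow> t \<le> f q + 1 \<Longrightarrow> norm (T t x) \<le> K * norm x"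
    using C0_locally_bounded by blast
  have ft: "(f \<longlongrightarrow> f q) (at q within A)" and gt: "(g \<longlongrightarrow> g q) (at q within A)"
    using f g q by (auto simp: continuous_on_def)
  have 1: "((\<lambda>p. T (f p) (g q)) \<longlongrightarrow> T (f q) (g q)) (at q within A)"
  proof -
    have "continuous_on A (\<lambda>p. T (f p) (g q))"
      by (rule continuous_on_compose2[OF C0_continuous f]) (use pos in auto)
    then show ?thesis using q by (simp add: continuous_on_def)
  qed
  have 2: "((\<lambda>p. T (f p) (g p) - T (f p) (g q)) \<longlongrightarrow> 0) (at q within A)"
  proof (rule Lim_null_comparison)
    have "\<forall>\<^sub>F p in at q within A. f p < f q + 1"
      using ft by (rule order_tendstoD) simp
    moreover have "\<forall>\<^sub>F p in at q within A. p \<in> A" by (simp add: eventually_at_filter)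
    ultimately show "\<forall>\<^sub>F p in at q within A. norm (T (f p) (g p) - T (f p) (g q)) \<le> K * norm (g p - g q)"
    proof eventually_elim
      case (elim p)
      interpret bounded_linear "T (f p)" by (rule C0_linear[OF pos[OF elim(2)]])
      show ?case using K(2)[of "f p" "g p - g q"] elim pos by (simp add: diff)
    qed
    show "((\<lambda>p. K * norm (g p - g q)) \<longlongrightarrow> 0) (at q within A)"
      using gt by (intro tendsto_mult_right_zero tendsto_norm_zero) (simp add: LIM_zero)
  qed
  show "((\<lambda>p. T (f p) (g p)) \<longlongrightarrow> T (f q) (g q)) (at q within A)"
    using tendsto_add[OF 1 2] by simp
qed

text \<open>At \<open>t > 0\<close> this is a two-sided derivative, while the generator is a limit
  from the right at 0. On either side the increment is \<open>T (min s t)\<close>, the earlier of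
  the two times, applied to a forward quotient at 0.\<close>

lemma C0_derivative:
  assumes xy: "(x, y) \<in> generator T" and t: "0 \<le> t"
  shows "((\<lambda>t. T t x) has_vector_derivative T t y) (at t within {0..})"
proof -
  define D where "D h = (if h \<le> 0 then y else (1 / h) *\<^sub>R (T h x - x))" for h :: real
  have D0: "(D \<longlongrightarrow> y) (at_right 0)"
  proof -
    have "((\<lambda>h. (1 / h) *\<^sub>R (T h x - x)) \<longlongrightarrow> y) (at_right 0)"
      using xy by (simp add: generator_def)
    then show ?thesis
      by (rule Lim_transform_eventually) (auto simp: eventually_at_filter D_def)
  qed
  have Dlim: "((\<lambda>s. D \<bar>s - t\<bar>) \<longlongrightarrow> y) (at t within {0..})"
  proof -
    have "filterlim (\<lambda>s. \<bar>s - t\<bar>) (at_right 0) (at t within {0..})"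
      unfolding filterlim_at
      by (auto simp: eventually_at_filter intro!: tendsto_eq_intros)
    then show ?thesis using D0 filterlim_compose by blast
  qed
  have diff: "T s x - T t x = (s - t) *\<^sub>R T (min s t) (D \<bar>s - t\<bar>)" if "0 \<le> s" for s
  proof -
    have *: "T v x - T u x = (v - u) *\<^sub>R T u (D (v - u))" if "0 \<le> u" "u < v" for u v
    proof -
      interpret bounded_linear "T u" by (rule C0_linear[OF that(1)])
      have "T v x = T u (T (v - u) x)" using C0_add[of u "v - u" x] that by simp
      then show ?thesis using that by (simp add: D_def diff scaleR)
    qed
    consider "s < t" | "s = t" | "t < s" by linarith
    then show ?thesis
    proof cases
      case 1
      have "T s x - T t x = - ((t - s) *\<^sub>R T s (D (t - s)))"
        unfolding *[OF that 1, symmetric] by simp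
      then show ?thesis using 1 by (simp flip: scaleR_minus_left)
    next
      case 3
      then show ?thesis using *[of t s] t by simp
    qed simp
  qed
  have lim: "((\<lambda>s. T (min s t) (D \<bar>s - t\<bar>)) \<longlongrightarrow> T t y) (at t within {0..})"
  proof -
    obtain K where K: "0 < K" "\<And>r x. 0 \<le> r \<Longrightarrow> r \<le> t \<Longrightarrow> norm (T r x) \<le> K * norm x"
      using C0_locally_bounded by blast
    have 1: "((\<lambda>s. T (min s t) y) \<longlongrightarrow> T t y) (at t within {0..})"
    proof -
      have "continuous_on {0..} (\<lambda>s. T (min s t) y)"
        by (intro C0_continuous_compose continuous_intros) (use t in auto)
      then show ?thesis using t by (force simp: continuous_on_def)
    qed
    have 2: "((\<lambda>s. T (min s t) (D \<bar>s - t\<bar>) - T (min s t) y) \<longlongrightarrow> 0) (at t within {0..})"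
    proof (rule Lim_null_comparison)
      have "\<forall>\<^sub>F s in at t within {0..}. s \<in> {0..}" by (simp add: eventually_at_filter)
      then show "\<forall>\<^sub>F s in at t within {0..}.
          norm (T (min s t) (D \<bar>s - t\<bar>) - T (min s t) y) \<le> K * norm (D \<bar>s - t\<bar> - y)"
      proof eventually_elim
        case (elim s)
        interpret bounded_linear "T (min s t)" by (rule C0_linear) (use elim t in auto)
        show ?case using K(2)[of "min s t" "D \<bar>s - t\<bar> - y"] elim t by (simp add: diff)
      qed
      show "((\<lambda>s. K * norm (D \<bar>s - t\<bar> - y)) \<longlongrightarrow> 0) (at t within {0..})"
        using Dlim by (intro tendsto_mult_right_zero tendsto_norm_zero) (simp add: LIM_zero)
    qed
    show ?thesis using tendsto_add[OF 1 2] by simp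
  qed
  show ?thesis
    unfolding has_vector_derivative_def has_derivative_within
  proof (intro conjI)
    show "bounded_linear (\<lambda>s. s *\<^sub>R T t y)" by (rule bounded_linear_scaleR_left)
    have "((\<lambda>s. norm (T (min s t) (D \<bar>s - t\<bar>) - T t y)) \<longlongrightarrow> 0) (at t within {0..})"
      using lim by (intro tendsto_norm_zero) (simp add: LIM_zero)
    moreover have "\<forall>\<^sub>F s in at t within {0..}.
        norm ((1 / norm (s - t)) *\<^sub>R (T s x - (T t x + (s - t) *\<^sub>R T t y)))
        \<le> norm (T (min s t) (D \<bar>s - t\<bar>) - T t y)"
      unfolding eventually_at_filter
    proof (intro eventuallyI impI)
      fix s assume s: "s \<noteq> t" "s \<in> {0..}"
      have "T s x - (T t x + (s - t) *\<^sub>R T t y) = (s - t) *\<^sub>R (T (min s t) (D \<bar>s - t\<bar>) - T t y)"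
        using diff[of s] s by (simp add: algebra_simps)
      then show "norm ((1 / norm (s - t)) *\<^sub>R (T s x - (T t x + (s - t) *\<^sub>R T t y)))
          \<le> norm (T (min s t) (D \<bar>s - t\<bar>) - T t y)"
        using s by simp
    qed
    ultimately show "((\<lambda>s. (1 / norm (s - t)) *\<^sub>R (T s x - (T t x + (s - t) *\<^sub>R T t y)))
        \<longlongrightarrow> 0) (at t within {0..})"
      by (rule Lim_null_comparison[rotated])
  qed
qed

lemma C0_generator_invariant:
  assumes xy: "(x, y) \<in> generator T" and t: "0 \<le> t"
  shows "(T t x, T t y) \<in> generator T"
proof -
  interpret bounded_linear "T t" by (rule C0_linear[OF t])
  have "((\<lambda>h. T t ((1 / h) *\<^sub>R (T h x - x))) \<longlongrightarrow> T t y) (at_right 0)"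
    using xy by (intro tendsto) (simp add: generator_def)
  then show ?thesis
    unfolding generator_def mem_Collect_eq prod.case
    by (rule Lim_transform_eventually)
      (use t in \<open>auto simp: eventually_at_filter scaleR diff C0_commute[of t]\<close>)
qed

text \<open>Averages of an orbit over short times lie in the domain: \<open>T h\<close> shifts the
  interval of integration, so the difference quotient of the integral reduces to its two
  ends.\<close>

lemma C0_generator_dense:
  assumes e: "0 < e"
  obtains u v where "(u, v) \<in> generator T" "norm (u - x) < e"
proof -
  define P where "P t = integral {0..t} (\<lambda>s. T s x)" for t
  have cont: "continuous_on {a..b} (\<lambda>s. T s x)" if "0 \<le> a" for a b
    using that by (intro continuous_on_subset[OF C0_continuous]) auto
  have P: "(P has_vector_derivative T t x) (at_right t)" if "0 \<le> t" for t
  proof -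
    have "(P has_vector_derivative T t x) (at t within {0..t+1})"
      unfolding P_def using that cont by (intro integral_has_vector_derivative) auto
    then have "(P has_vector_derivative T t x) (at t within {t..<t+1})"
      using that by (elim has_vector_derivative_within_subset) auto
    moreover have "at_right t = at t within {t..<t+1}"
      by (rule at_within_nhd[of _ "{..<t+1}"]) auto
    ultimately show ?thesis by simp
  qed
  have Plim: "((\<lambda>h. (1 / h) *\<^sub>R (P (t + h) - P t)) \<longlongrightarrow> T t x) (at_right 0)" if "0 \<le> t" for t
  proof -
    have "((\<lambda>s. (1 / norm (s - t)) *\<^sub>R (P s - (P t + (s - t) *\<^sub>R T t x))) \<longlongrightarrow> 0) (at_right t)"
      using P[OF that] by (simp add: has_vector_derivative_def has_derivative_within)
    then have "((\<lambda>h. (1 / norm h) *\<^sub>R (P (t + h) - (P t + h *\<^sub>R T t x))) \<longlongrightarrow> 0) (at_right 0)"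
      by (simp add: filterlim_at_right_to_0[of _ _ t] add.commute)
    then have "((\<lambda>h. (1 / h) *\<^sub>R (P (t + h) - P t) - T t x) \<longlongrightarrow> 0) (at_right 0)"
      by (rule Lim_transform_eventually)
        (auto simp: eventually_at_filter algebra_simps)
    then show ?thesis by (simp add: LIM_zero_cancel)
  qed
  have P0: "P 0 = 0" by (simp add: P_def)
  have gen: "(P r, T r x - x) \<in> generator T" if r: "0 \<le> r" for r
  proof -
    have "T h (P r) = P (r + h) - P h" if h: "0 \<le> h" for h
    proof -
      have int: "(\<lambda>s. T s x) integrable_on {a..b}" if "0 \<le> a" for a b
        using cont[OF that] by (rule integrable_continuous_real)
      have "T h (P r) = integral {0..r} (\<lambda>s. T h (T s x))"
        unfolding P_def using integral_linear[OF int C0_linear[OF h], of 0 r] by (simp add: o_def)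
      also have "\<dots> = integral {0..r} (\<lambda>s. T (s + h) x)"
        by (rule Henstock_Kurzweil_Integration.integral_cong) (use h in \<open>auto simp: C0_commute[of h] C0_add\<close>)
      also have "\<dots> = integral {h..r + h} (\<lambda>s. T s x)"
        using integral_shift_real_ivl[of h h "r + h" "\<lambda>s. T s x"] by simp
      also have "\<dots> = P (r + h) - P h"
        using Henstock_Kurzweil_Integration.integral_combine[OF h _ int, of "r + h"] r
        by (simp add: P_def algebra_simps)
      finally show ?thesis .
    qed
    then have *: "\<forall>\<^sub>F h in at_right 0.
      (1 / h) *\<^sub>R (P (r + h) - P r) - (1 / h) *\<^sub>R (P (0 + h) - P 0) = (1 / h) *\<^sub>R (T h (P r) - P r)"
      unfolding eventually_at_filter
      by (intro eventuallyI) (simp add: P0 flip: scaleR_diff_right)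
    show ?thesis
      unfolding generator_def mem_Collect_eq prod.case
      using Lim_transform_eventually[OF tendsto_diff[OF Plim[OF r] Plim[of 0]] *]
      by (simp add: C0_zero)
  qed
  have "\<forall>\<^sub>F h in at_right 0. dist ((1 / h) *\<^sub>R (P (0 + h) - P 0)) (T 0 x) < e"
    using Plim[of 0] e by (simp add: tendsto_iff)
  moreover have "\<forall>\<^sub>F h in at_right (0::real). 0 < h" by (simp add: eventually_at_filter)
  ultimately have "\<forall>\<^sub>F h in at_right 0. 0 < h \<and> norm ((1 / h) *\<^sub>R P h - x) < e"
    by eventually_elim (simp add: P0 C0_zero dist_norm)
  then obtain r where r: "0 < r" "norm ((1 / r) *\<^sub>R P r - x) < e"
    using eventually_happens'[of "at_right (0::real)"] by auto
  have "((1 / r) *\<^sub>R P r, (1 / r) *\<^sub>R (T r x - x)) \<in> generator T"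
  proof -
    have g: "((\<lambda>h. (1 / h) *\<^sub>R (T h (P r) - P r)) \<longlongrightarrow> T r x - x) (at_right 0)"
      using gen[of r] r by (simp add: generator_def)
    have *: "\<forall>\<^sub>F h in at_right 0. (1 / r) *\<^sub>R ((1 / h) *\<^sub>R (T h (P r) - P r)) =
        (1 / h) *\<^sub>R (T h ((1 / r) *\<^sub>R P r) - (1 / r) *\<^sub>R P r)"
      unfolding eventually_at_filter
    proof (intro eventuallyI impI)
      fix h :: real assume "h \<noteq> 0" "h \<in> {0<..}"
      then interpret bounded_linear "T h" by (intro C0_linear) auto
      show "(1 / r) *\<^sub>R ((1 / h) *\<^sub>R (T h (P r) - P r)) =
        (1 / h) *\<^sub>R (T h ((1 / r) *\<^sub>R P r) - (1 / r) *\<^sub>R P r)"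
        by (simp only: scaleR scaleR_diff_right scaleR_scaleR mult.commute)
    qed
    show ?thesis
      unfolding generator_def mem_Collect_eq prod.case
      by (rule Lim_transform_eventually[OF tendsto_scaleR[OF tendsto_const g] *])
  qed
  then show ?thesis using r that by blast
qed

end

section \<open>Bounded perturbations\<close>

text \<open>The estimates below are uniform on compact time intervals only, so continuity is proved
  there first.\<close>

lemma continuous_on_atLeast_of_Icc:
  fixes f :: "real \<Rightarrow> 'a::topological_space"
  assumes "\<And>R. continuous_on {0..R} f"
  shows "continuous_on {0..} f"
  unfolding continuous_on_def
proof
  fix x :: real assume x: "x \<in> {0..}"
  have "(f \<longlongrightarrow> f x) (at x within {0..x+1})"
    using assms[of "x+1"] x by (auto simp: continuous_on_def)
  moreover have "at x within {0..x+1} = at x within {0..}"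
    by (rule at_within_nhd[of _ "{..<x+1}"]) auto
  ultimately show "(f \<longlongrightarrow> f x) (at x within {0..})" by simp
qed

lemma Henstock_integral_bounded_linear:
  fixes f :: "real \<Rightarrow> 'a::banach" and h :: "'a \<Rightarrow> 'b::banach"
  assumes "continuous_on {a..b} f" "bounded_linear h"
  shows "integral {a..b} (\<lambda>s. h (f s)) = h (integral {a..b} f)"
  using integral_linear[OF integrable_continuous_real[OF assms(1)] assms(2)] by (simp add: o_def)

text \<open>The integral term of the variation of constants formula. The equation
  \<open>u t = T t x + duhamel T Q u t\<close> is the mild form of u' = (A + Q) u, u(0) = x, and
  makes sense for every vector \<open>x\<close>.\<close>

definition duhamel ::
  "(real \<Rightarrow> 'a::banach \<Rightarrow> 'a) \<Rightarrow> ('a \<Rightarrow> 'a) \<Rightarrow> (real \<Rightarrow> 'a) \<Rightarrow> real \<Rightarrow> 'a" where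
  "duhamel T Q u t = integral {0..t} (\<lambda>s. T (t - s) (Q (u s)))"

context
  fixes T :: "real \<Rightarrow> 'a::complex_hilbert_space \<Rightarrow> 'a" and Q :: "'a \<Rightarrow> 'a"
  assumes T: "C0_semigroup T" and Q: "bounded_clinear Q"
begin

interpretation Q: bounded_linear Q
  using Q by (rule bounded_clinearD)

lemma duhamel_integrand_continuous:
  assumes "continuous_on {a..b} u" "b \<le> t"
  shows "continuous_on {a..b} (\<lambda>s. T (t - s) (Q (u s)))"
  by (intro C0_continuous_compose[OF T] continuous_intros Q.continuous_on assms(1))
    (use assms in auto)

lemma duhamel_continuous_Icc:
  assumes u: "continuous_on {0..R} u"
  shows "continuous_on {0..R} (duhamel T Q u)"
proof -
  have Qu: "continuous_on {0..R} (\<lambda>s. Q (u s))" by (intro Q.continuous_on u)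
  \<comment> \<open>Both the upper limit and the integrand depend on \<open>t\<close>. Cutting the
    time argument off at 0 fixes the interval to \<open>{0..R}\<close>; on the added piece the
    semigroup factor is the identity, so the excess is an ordinary indefinite integral.\<close>
  have eq: "duhamel T Q u t = integral {0..R} (\<lambda>s. T (max 0 (t - s)) (Q (u s))) - integral {t..R} (\<lambda>s. Q (u s))"
    if t: "t \<in> {0..R}" for t
  proof -
    have "continuous_on {0..R} (\<lambda>s. T (max 0 (t - s)) (Q (u s)))"
      by (intro C0_continuous_compose[OF T] continuous_intros Qu) auto
    then have "integral {0..R} (\<lambda>s. T (max 0 (t - s)) (Q (u s))) =
      integral {0..t} (\<lambda>s. T (max 0 (t - s)) (Q (u s))) + integral {t..R} (\<lambda>s. T (max 0 (t - s)) (Q (u s)))"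
      using t by (intro Henstock_Kurzweil_Integration.integral_combine[symmetric] integrable_continuous_real) auto
    moreover have "integral {0..t} (\<lambda>s. T (max 0 (t - s)) (Q (u s))) = duhamel T Q u t"
      unfolding duhamel_def by (rule Henstock_Kurzweil_Integration.integral_cong) auto
    moreover have "integral {t..R} (\<lambda>s. T (max 0 (t - s)) (Q (u s))) = integral {t..R} (\<lambda>s. Q (u s))"
      by (rule Henstock_Kurzweil_Integration.integral_cong) (auto simp: C0_zero[OF T] max_def)
    ultimately show ?thesis by simp
  qed
  have "continuous_on {0..R} (\<lambda>t. integral {0..R} (\<lambda>s. T (max 0 (t - s)) (Q (u s))))"
  proof -
    have "continuous_on ({0..R} \<times> {0..R}) (\<lambda>p. T (max 0 (fst p - snd p)) (Q (u (snd p))))"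
      by (intro C0_continuous_compose[OF T] continuous_intros continuous_on_compose2[OF Qu]) auto
    then have "continuous_on {0..R} (\<lambda>t. integral (cbox 0 R) (\<lambda>s. T (max 0 (t - s)) (Q (u s))))"
      by (intro integral_continuous_on_param) (simp add: case_prod_unfold)
    then show ?thesis by simp
  qed
  moreover have "continuous_on {0..R} (\<lambda>t. integral {t..R} (\<lambda>s. Q (u s)))"
    by (intro indefinite_integral_continuous_1' integrable_continuous_real Qu)
  ultimately have "continuous_on {0..R} (\<lambda>t. integral {0..R} (\<lambda>s. T (max 0 (t - s)) (Q (u s)))
      - integral {t..R} (\<lambda>s. Q (u s)))"
    by (rule continuous_on_diff)
  then show ?thesis by (rule continuous_on_eq) (simp add: eq)
qed

lemma duhamel_add:
  assumes "continuous_on {0..t} u" "continuous_on {0..t} v"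
  shows "duhamel T Q (\<lambda>s. u s + v s) t = duhamel T Q u t + duhamel T Q v t"
proof -
  have "duhamel T Q (\<lambda>s. u s + v s) t = integral {0..t} (\<lambda>s. T (t - s) (Q (u s)) + T (t - s) (Q (v s)))"
    unfolding duhamel_def
    by (rule Henstock_Kurzweil_Integration.integral_cong)
      (simp add: Q.add linear_simps[OF C0_linear[OF T]])
  also have "\<dots> = duhamel T Q u t + duhamel T Q v t"
    unfolding duhamel_def
    by (intro Henstock_Kurzweil_Integration.integral_add integrable_continuous_real
        duhamel_integrand_continuous assms order_refl)
  finally show ?thesis .
qed

text \<open>Serves negation here and, in the perturbation theorem, real scalars and the imaginary
  unit: each of these maps commutes with \<open>T\<close> and \<open>Q\<close>.\<close>

lemma duhamel_commute:
  assumes u: "continuous_on {0..t} u" and B: "bounded_linear B"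
    and BT: "\<And>s x. 0 \<le> s \<Longrightarrow> T s (B x) = B (T s x)" and BQ: "\<And>x. Q (B x) = B (Q x)"
  shows "duhamel T Q (\<lambda>s. B (u s)) t = B (duhamel T Q u t)"
proof -
  have "duhamel T Q (\<lambda>s. B (u s)) t = integral {0..t} (\<lambda>s. B (T (t - s) (Q (u s))))"
    unfolding duhamel_def
    by (rule Henstock_Kurzweil_Integration.integral_cong) (simp add: BT BQ)
  then show ?thesis
    unfolding duhamel_def
    by (simp add: Henstock_integral_bounded_linear[OF duhamel_integrand_continuous[OF u] B])
qed

lemma duhamel_minus:
  assumes "continuous_on {0..t} u"
  shows "duhamel T Q (\<lambda>s. - u s) t = - duhamel T Q u t"
  by (rule duhamel_commute[OF assms bounded_linear_minus[OF bounded_linear_ident]])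
    (auto simp: linear_simps[OF bounded_clinearD(1)[OF Q]] linear_simps[OF C0_linear[OF T]])

lemma duhamel_diff:
  assumes "continuous_on {0..t} u" "continuous_on {0..t} v"
  shows "duhamel T Q (\<lambda>s. u s - v s) t = duhamel T Q u t - duhamel T Q v t"
  using duhamel_add[OF assms(1), of "\<lambda>s. - v s"] assms(2)
  by (simp add: duhamel_minus continuous_on_minus)

text \<open>A bound by one term of the exponential series integrates to a bound by the next term.
  Uniqueness and convergence of the iteration both rest on this.\<close>

lemma duhamel_bound:
  assumes u: "continuous_on {0..R} u" and t: "0 \<le> t" "t \<le> R"
    and L: "\<And>r x. 0 \<le> r \<Longrightarrow> r \<le> R \<Longrightarrow> norm (T r (Q x)) \<le> L * norm x" "0 \<le> L"
    and C: "\<And>s. 0 \<le> s \<Longrightarrow> s \<le> R \<Longrightarrow> norm (u s) \<le> C * ((L * s) ^ n / fact n)"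
  shows "norm (duhamel T Q u t) \<le> C * ((L * t) ^ Suc n / fact (Suc n))"
proof -
  have "((\<lambda>s. L * (C * ((L * s) ^ n / fact n))) has_integral
      C * ((L * t) ^ Suc n / fact (Suc n)) - C * ((L * 0) ^ Suc n / fact (Suc n))) {0..t}"
  proof (rule fundamental_theorem_of_calculus[OF t(1)])
    fix s
    have "((\<lambda>s. C * ((L * s) ^ Suc n / fact (Suc n))) has_real_derivative
        C * ((1 + real n) * (L * (L * s) ^ n) / fact (Suc n))) (at s within {0..t})"
      by (intro DERIV_cmult DERIV_cdivide DERIV_power_Suc DERIV_cmult_Id)
    also have "C * ((1 + real n) * (L * (L * s) ^ n) / fact (Suc n)) = L * (C * ((L * s) ^ n / fact n))"
      by (simp add: divide_simps del: of_nat_Suc)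
    finally show "((\<lambda>s. C * ((L * s) ^ Suc n / fact (Suc n))) has_vector_derivative
        L * (C * ((L * s) ^ n / fact n))) (at s within {0..t})"
      by (simp add: has_real_derivative_iff_has_vector_derivative)
  qed
  then have I: "((\<lambda>s. L * (C * ((L * s) ^ n / fact n))) has_integral C * ((L * t) ^ Suc n / fact (Suc n))) {0..t}"
    by simp
  have "norm (duhamel T Q u t) \<le> integral {0..t} (\<lambda>s. L * (C * ((L * s) ^ n / fact n)))"
    unfolding duhamel_def
  proof (rule Henstock_Kurzweil_Integration.integral_norm_bound_integral)
    show "(\<lambda>s. T (t - s) (Q (u s))) integrable_on {0..t}"
      using t by (intro integrable_continuous_real duhamel_integrand_continuous
          continuous_on_subset[OF u]) auto
    show "(\<lambda>s. L * (C * ((L * s) ^ n / fact n))) integrable_on {0..t}"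
      using I by blast
    fix s assume s: "s \<in> {0..t}"
    have "norm (T (t - s) (Q (u s))) \<le> L * norm (u s)" using s t by (intro L) auto
    also have "\<dots> \<le> L * (C * ((L * s) ^ n / fact n))"
      using s t L by (intro mult_left_mono C) auto
    finally show "norm (T (t - s) (Q (u s))) \<le> L * (C * ((L * s) ^ n / fact n))" .
  qed
  then show ?thesis unfolding integral_unique[OF I] .
qed

lemma TQ_bound:
  obtains L where "0 \<le> L" "\<And>r x. 0 \<le> r \<Longrightarrow> r \<le> R \<Longrightarrow> norm (T r (Q x)) \<le> L * norm x"
proof -
  obtain K where K: "0 < K" "\<And>t x. 0 \<le> t \<Longrightarrow> t \<le> R \<Longrightarrow> norm (T t x) \<le> K * norm x"
    using C0_locally_bounded[OF T] by blast
  obtain q where q: "0 \<le> q" "\<And>x. norm (Q x) \<le> norm x * q" using Q.nonneg_bounded by blast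
  have "norm (T r (Q x)) \<le> (K * q) * norm x" if "0 \<le> r" "r \<le> R" for r x
  proof -
    have "norm (T r (Q x)) \<le> K * norm (Q x)" by (rule K(2)[OF that])
    also have "\<dots> \<le> K * (norm x * q)" using K q by simp
    finally show ?thesis by (simp add: mult_ac)
  qed
  then show ?thesis using that[of "K * q"] K q by simp
qed

text \<open>Inserting the equation into itself \<open>n\<close> times gives the bound
  \<open>C * ((L * t) ^ n / fact n)\<close> for every \<open>n\<close>.\<close>

lemma duhamel_unique:
  assumes w: "continuous_on {0..} w" and eq: "\<And>t. 0 \<le> t \<Longrightarrow> w t = duhamel T Q w t" and t: "0 \<le> t"
  shows "w t = 0"
proof -
  have w': "continuous_on {0..t} w" using w by (rule continuous_on_subset) auto
  obtain L where L: "0 \<le> L" "\<And>r x. 0 \<le> r \<Longrightarrow> r \<le> t \<Longrightarrow> norm (T r (Q x)) \<le> L * norm x"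
    using TQ_bound by blast
  obtain C where C: "\<And>s. s \<in> {0..t} \<Longrightarrow> norm (w s) \<le> C"
  proof -
    have "compact (w ` {0..t})" by (intro compact_continuous_image w') auto
    then show ?thesis using that by (meson bounded_iff compact_imp_bounded imageI)
  qed
  have "\<forall>s. 0 \<le> s \<longrightarrow> s \<le> t \<longrightarrow> norm (w s) \<le> C * ((L * s) ^ n / fact n)" for n
  proof (induction n)
    case 0
    then show ?case using C by simp
  next
    case (Suc n)
    then show ?case using duhamel_bound[OF w' _ _ L(2,1), of _ C n] eq by metis
  qed
  then have b: "norm (w t) \<le> C * ((L * t) ^ n / fact n)" for n using t by blast
  have "(\<lambda>n. C * ((L * t) ^ n / fact n)) \<longlonglongrightarrow> C * 0"
    using sums_summable[OF exp_converges[of "L * t"]]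
    by (intro tendsto_mult tendsto_const summable_LIMSEQ_zero) (simp add: field_simps)
  then have "norm (w t) \<le> C * 0" by (rule LIMSEQ_le_const) (use b in auto)
  then show ?thesis by simp
qed

text \<open>The Dyson-Phillips series: iterates of the Duhamel operator on \<open>g\<close>, summed.
  The growth bound leaves \<open>R\<close>, \<open>L\<close> and \<open>C\<close> free, because
  later \<open>C\<close> is taken proportional to the norm of the initial vector; this is what
  bounds the perturbed operators.\<close>

lemma duhamel_exists:
  assumes g: "continuous_on {0..} g"
  obtains u where "continuous_on {0..} u" "\<And>t. 0 \<le> t \<Longrightarrow> u t = g t + duhamel T Q u t"
    "\<And>R L C t. \<lbrakk>0 \<le> L; \<And>r x. 0 \<le> r \<Longrightarrow> r \<le> R \<Longrightarrow> norm (T r (Q x)) \<le> L * norm x;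
      \<And>s. 0 \<le> s \<Longrightarrow> s \<le> R \<Longrightarrow> norm (g s) \<le> C; 0 \<le> t; t \<le> R\<rbrakk> \<Longrightarrow> norm (u t) \<le> C * exp (L * t)"
proof -
  define v where "v n = (duhamel T Q ^^ n) g" for n
  have v0: "v 0 = g" and vS: "v (Suc n) = duhamel T Q (v n)" for n by (auto simp: v_def)
  have vc: "continuous_on {0..R} (v n)" for n R
  proof (induction n)
    case 0
    then show ?case unfolding v0 using g by (rule continuous_on_subset) auto
  qed (simp add: vS duhamel_continuous_Icc)
  have vb: "norm (v n t) \<le> C * ((L * t) ^ n / fact n)"
    if L: "0 \<le> L" "\<And>r x. 0 \<le> r \<Longrightarrow> r \<le> R \<Longrightarrow> norm (T r (Q x)) \<le> L * norm x"
      and C: "\<And>s. 0 \<le> s \<Longrightarrow> s \<le> R \<Longrightarrow> norm (g s) \<le> C" and t: "0 \<le> t" "t \<le> R" for R L C t n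
    using t
  proof (induction n arbitrary: t)
    case 0
    then show ?case using C by (simp add: v0)
  next
    case (Suc n)
    then show ?case unfolding vS by (intro duhamel_bound[OF vc _ _ L(2,1)]) auto
  qed
  have gb: "\<exists>C. \<forall>s\<in>{0..R}. norm (g s) \<le> C" for R
  proof -
    have "compact (g ` {0..R})"
      by (intro compact_continuous_image continuous_on_subset[OF g]) auto
    then show ?thesis by (meson bounded_iff compact_imp_bounded imageI)
  qed
  define u where "u t = (\<Sum>n. v n t)" for t
  have sums: "(\<lambda>n. C * ((L * t) ^ n / fact n)) sums (C * exp (L * t))" for C L t :: real
    using exp_converges[of "L * t"] by (intro sums_mult) (simp add: field_simps)
  have unif: "uniform_limit {0..R} (\<lambda>N t. \<Sum>n<N. v n t) u sequentially" for R
  proof -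
    obtain L where L: "0 \<le> L" "\<And>r x. 0 \<le> r \<Longrightarrow> r \<le> R \<Longrightarrow> norm (T r (Q x)) \<le> L * norm x"
      using TQ_bound by blast
    obtain C where C: "\<And>s. s \<in> {0..R} \<Longrightarrow> norm (g s) \<le> C" using gb by blast
    have "uniform_limit {0..R} (\<lambda>N t. \<Sum>n<N. v n t) (\<lambda>t. suminf (\<lambda>n. v n t)) sequentially"
    proof (rule Weierstrass_m_test)
      fix n t assume t: "t \<in> {0..R}"
      have "norm (v n t) \<le> C * ((L * t) ^ n / fact n)" using t by (intro vb[OF L]) (auto intro: C)
      also have "\<dots> \<le> C * ((L * R) ^ n / fact n)"
        using t L(1) norm_ge_zero[of "g t"] C[OF t]
        by (intro mult_left_mono divide_right_mono power_mono) (auto simp del: norm_ge_zero)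
      finally show "norm (v n t) \<le> C * ((L * R) ^ n / fact n)" .
    qed (use sums sums_summable in blast)
    then show ?thesis by (simp add: u_def[abs_def])
  qed
  have uc: "continuous_on {0..R} u" for R
    by (rule uniform_limit_theorem[OF _ unif])
      (auto intro!: always_eventually continuous_on_sum vc)
  have eq: "u t = g t + duhamel T Q u t" if t: "0 \<le> t" for t
  proof -
    obtain L where L: "0 \<le> L" "\<And>r x. 0 \<le> r \<Longrightarrow> r \<le> t \<Longrightarrow> norm (T r (Q x)) \<le> L * norm x"
      using TQ_bound by blast
    define S where "S N s = (\<Sum>n<N. v n s)" for N s
    have Sc: "continuous_on {0..t} (S N)" for N
      unfolding S_def[abs_def] by (intro continuous_on_sum vc)
    \<comment> \<open>The Duhamel operator shifts the partial sums by one index, and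
      \<open>g\<close> is the term that gets lost.\<close>
    have DS: "duhamel T Q (S N) t = S (Suc N) t - g t" for N
    proof (induction N)
      case 0
      have "duhamel T Q (\<lambda>s. 0) t = 0"
        using duhamel_diff[of t "\<lambda>_. 0" "\<lambda>_. 0"] by simp
      then show ?case by (simp add: S_def[abs_def] v0)
    next
      case (Suc N)
      have "duhamel T Q (S (Suc N)) t = duhamel T Q (\<lambda>s. S N s + v N s) t"
        by (simp add: S_def[abs_def])
      also have "\<dots> = duhamel T Q (S N) t + v (Suc N) t"
        by (simp add: duhamel_add Sc vc vS)
      finally show ?case by (simp add: Suc) (simp add: S_def)
    qed
    have lim: "(\<lambda>N. S N t) \<longlonglongrightarrow> u t"
      using tendsto_uniform_limitI[OF unif, of t t] t by (simp add: S_def)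
    have "(\<lambda>N. duhamel T Q (S N) t) \<longlonglongrightarrow> duhamel T Q u t"
    proof (rule LIMSEQ_I)
      fix e :: real assume e: "0 < e"
      have Lt: "0 < L * t + 1" using L t by (simp add: add_nonneg_pos)
      \<comment> \<open>\<open>L * t\<close> may be 0, hence the summand 1 in the divisor.\<close>
      define d where "d = e / 2 / (L * t + 1)"
      have d: "0 < d" using e Lt by (simp add: d_def)
      have dk: "d * (L * t + 1) = e / 2" 
        unfolding d_def by (rule nonzero_eq_divide_eq[THEN iffD1, OF _ refl]) (rule less_imp_neq[OF Lt, symmetric])
      obtain N0 where N0: "\<And>N s. N \<ge> N0 \<Longrightarrow> s \<in> {0..t} \<Longrightarrow> dist (S N s) (u s) < d"
        using uniform_limitD[OF unif d, of t] unfolding eventually_sequentially S_def by metis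
      have "norm (duhamel T Q (S N) t - duhamel T Q u t) < e" if N: "N \<ge> N0" for N
      proof -
        have "duhamel T Q (S N) t - duhamel T Q u t = duhamel T Q (\<lambda>s. S N s + - u s) t"
          by (simp add: duhamel_diff Sc uc)
        also have "norm \<dots> \<le> d * ((L * t) ^ Suc 0 / fact (Suc 0))"
        proof (rule duhamel_bound[OF _ t order_refl L(2,1)])
          show "continuous_on {0..t} (\<lambda>s. S N s + - u s)"
            by (intro continuous_intros Sc uc)
          fix s assume "0 \<le> s" "s \<le> t"
          then show "norm (S N s + - u s) \<le> d * ((L * s) ^ 0 / fact 0)"
            using N0[OF N, of s] by (simp add: dist_norm)
        qed
        also have "\<dots> < e"
        proof -
          have "d * (L * t) \<le> d * (L * t + 1)" using d by simp
          also have "\<dots> = e / 2" by (rule dk)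
          also have "\<dots> < e" using e by simp
          finally show ?thesis by simp
        qed
        finally show ?thesis .
      qed
      then show "\<exists>N0. \<forall>N\<ge>N0. norm (duhamel T Q (S N) t - duhamel T Q u t) < e" by blast
    qed
    moreover have "(\<lambda>N. S (Suc N) t - g t) \<longlonglongrightarrow> u t - g t"
      by (rule tendsto_diff[OF LIMSEQ_Suc[OF lim] tendsto_const])
    ultimately have "duhamel T Q u t = u t - g t" unfolding DS by (rule LIMSEQ_unique)
    then show ?thesis by simp
  qed
  show ?thesis
  proof (rule that)
    show "continuous_on {0..} u" by (rule continuous_on_atLeast_of_Icc[OF uc])
    show "u t = g t + duhamel T Q u t" if "0 \<le> t" for t by (rule eq[OF that])
    fix R L C t
    assume "0 \<le> L" "\<And>r x. 0 \<le> r \<Longrightarrow> r \<le> R \<Longrightarrow> norm (T r (Q x)) \<le> L * norm x"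
      "\<And>s. 0 \<le> s \<Longrightarrow> s \<le> R \<Longrightarrow> norm (g s) \<le> C" "0 \<le> t" "t \<le> R"
    then have b: "norm (v n t) \<le> C * ((L * t) ^ n / fact n)" for n by (rule vb)
    have "norm (u t) \<le> (\<Sum>n. C * ((L * t) ^ n / fact n))"
      unfolding u_def using sums_summable[OF sums] b by (intro norm_suminf_le) auto
    then show "norm (u t) \<le> C * exp (L * t)" using sums sums_unique by metis
  qed
qed

text \<open>Linearity in the initial vector and the semigroup law each say that two functions solve
  the same integral equation, so uniqueness proves them. The difference quotients of
  \<open>V\<close> and \<open>T\<close> differ by the Duhamel term over \<open>h\<close>, which
  tends to \<open>Q x\<close> for every \<open>x\<close>; hence the two domains coincide.\<close>

theorem bounded_perturbation:
  obtains V where "C0_semigroup V" "generator V = plus_bounded (generator T) Q"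
proof -
  \<comment> \<open>Object-level quantifiers gather all properties in one predicate, so that a
    single choice provides each solution together with its growth bound.\<close>
  define P where "P x u \<longleftrightarrow> continuous_on {0..} u \<and> (\<forall>t\<ge>0. u t = T t x + duhamel T Q u t) \<and>
    (\<forall>R L C. 0 \<le> L \<longrightarrow> (\<forall>r x. 0 \<le> r \<longrightarrow> r \<le> R \<longrightarrow> norm (T r (Q x)) \<le> L * norm x) \<longrightarrow>
      (\<forall>s. 0 \<le> s \<longrightarrow> s \<le> R \<longrightarrow> norm (T s x) \<le> C) \<longrightarrow>
      (\<forall>t. 0 \<le> t \<longrightarrow> t \<le> R \<longrightarrow> norm (u t) \<le> C * exp (L * t)))" for x u
  have "\<exists>u. P x u" for x
    unfolding P_def by (rule duhamel_exists[OF C0_continuous[OF T, of x]]) blast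
  then obtain U where "P x (U x)" for x by metis
  then have U: "\<And>x. continuous_on {0..} (U x)"
    "\<And>x t. 0 \<le> t \<Longrightarrow> U x t = T t x + duhamel T Q (U x) t"
    "\<And>x R L C t. 0 \<le> L \<Longrightarrow> (\<forall>r x. 0 \<le> r \<longrightarrow> r \<le> R \<longrightarrow> norm (T r (Q x)) \<le> L * norm x) \<Longrightarrow>
      (\<forall>s. 0 \<le> s \<longrightarrow> s \<le> R \<longrightarrow> norm (T s x) \<le> C) \<Longrightarrow> 0 \<le> t \<Longrightarrow> t \<le> R \<Longrightarrow> norm (U x t) \<le> C * exp (L * t)"
    unfolding P_def by blast+
  have Uc: "continuous_on {a..b} (U x)" if "0 \<le> a" for a b x
    by (rule continuous_on_subset[OF U(1)]) (use that in auto)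
  have uniq: "w t = U x t" if w: "continuous_on {0..} w"
    and eq: "\<And>t. 0 \<le> t \<Longrightarrow> w t = T t x + duhamel T Q w t" and t: "0 \<le> t" for w x t
  proof -
    have wc: "continuous_on {0..t} w" for t by (rule continuous_on_subset[OF w]) auto
    have "w t + - U x t = 0"
    proof (rule duhamel_unique[OF _ _ t])
      show "continuous_on {0..} (\<lambda>t. w t + - U x t)" by (intro continuous_intros w U(1))
      fix t :: real assume t: "0 \<le> t"
      show "w t + - U x t = duhamel T Q (\<lambda>t. w t + - U x t) t"
        using eq[OF t] U(2)[OF t, of x]
        by (simp add: duhamel_diff wc Uc)
    qed
    then show ?thesis by simp
  qed
  have add: "U (x + y) t = U x t + U y t" if t: "0 \<le> t" for x y t
  proof (rule uniq[symmetric, OF _ _ t])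
    show "continuous_on {0..} (\<lambda>t. U x t + U y t)" by (intro continuous_intros U(1))
    fix t :: real assume t: "0 \<le> t"
    show "U x t + U y t = T t (x + y) + duhamel T Q (\<lambda>t. U x t + U y t) t"
      using U(2)[OF t, of x] U(2)[OF t, of y]
      by (simp add: duhamel_add Uc linear_simps[OF C0_linear[OF T t]])
  qed
  have commute: "U (B x) t = B (U x t)" if B: "bounded_linear B"
    and BT: "\<And>s x. 0 \<le> s \<Longrightarrow> T s (B x) = B (T s x)" and BQ: "\<And>x. Q (B x) = B (Q x)" and t: "0 \<le> t"
    for B x t
  proof (rule uniq[symmetric, OF _ _ t])
    show "continuous_on {0..} (\<lambda>t. B (U x t))" by (intro bounded_linear.continuous_on[OF B] U(1))
    fix t :: real assume t: "0 \<le> t"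
    show "B (U x t) = T t (B x) + duhamel T Q (\<lambda>t. B (U x t)) t"
      using U(2)[OF t, of x] by (simp add: duhamel_commute[OF _ B BT BQ] Uc BT t linear_simps[OF B])
  qed
  define V where "V t x = U x t" for t x
  have lin: "bounded_clinear (V t)" if t: "0 \<le> t" for t
  proof (rule bounded_clinearI)
    obtain L where L: "0 \<le> L" "\<And>r x. 0 \<le> r \<Longrightarrow> r \<le> t \<Longrightarrow> norm (T r (Q x)) \<le> L * norm x"
      using TQ_bound by blast
    obtain K where K: "0 < K" "\<And>s x. 0 \<le> s \<Longrightarrow> s \<le> t \<Longrightarrow> norm (T s x) \<le> K * norm x"
      using C0_locally_bounded[OF T] by blast
    show "bounded_linear (V t)"
    proof (rule bounded_linear_intro[of _ "K * exp (L * t)"])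
      show "V t (x + y) = V t x + V t y" for x y by (simp add: V_def add t)
      show "V t (r *\<^sub>R x) = r *\<^sub>R V t x" for r x
        unfolding V_def
        by (rule commute[OF bounded_linear_scaleR_right _ _ t])
          (auto simp: linear_simps[OF C0_linear[OF T]] Q.scaleR)
      show "norm (V t x) \<le> norm x * (K * exp (L * t))" for x
        using U(3)[of L t x "K * norm x" t] L K t by (simp add: V_def mult_ac)
    qed
    show "V t (scaleC \<i> x) = scaleC \<i> (V t x)" for x
      unfolding V_def
      by (rule commute[OF bounded_clinearD(1)[OF bounded_clinear_scaleC_i] _ _ t])
        (auto simp: bounded_clinearD(2)[OF C0_clinear[OF T]] bounded_clinearD(2)[OF Q])
  qed
  have V0: "V 0 x = x" for x using U(2)[of 0 x] by (simp add: V_def duhamel_def C0_zero[OF T])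
  \<comment> \<open>The shifted orbit solves the equation with initial vector \<open>U x t\<close>:
    split the integral at \<open>t\<close>, and \<open>T s\<close> comes out of the first
    part.\<close>
  have semi: "V (s + t) x = V s (V t x)" if s: "0 \<le> s" and t: "0 \<le> t" for s t x
    unfolding V_def
  proof (rule uniq[of "\<lambda>s. U x (s + t)", OF _ _ s])
    show "continuous_on {0..} (\<lambda>s. U x (s + t))"
      by (rule continuous_on_compose2[OF U(1)]) (use t in \<open>auto intro!: continuous_intros\<close>)
    fix s :: real assume s: "0 \<le> s"
    have c: "continuous_on {0..s + t} (\<lambda>r. T (s + t - r) (Q (U x r)))"
      by (intro duhamel_integrand_continuous Uc) auto
    have "U x (s + t) = T (s + t) x + duhamel T Q (U x) (s + t)"
      by (rule U(2)) (use s t in simp)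
    also have "duhamel T Q (U x) (s + t) = integral {0..t} (\<lambda>r. T (s + t - r) (Q (U x r))) +
        integral {t..s + t} (\<lambda>r. T (s + t - r) (Q (U x r)))"
      unfolding duhamel_def using s t
      by (intro Henstock_Kurzweil_Integration.integral_combine[symmetric] integrable_continuous_real c) auto
    also have "integral {0..t} (\<lambda>r. T (s + t - r) (Q (U x r))) = T s (duhamel T Q (U x) t)"
    proof -
      have "integral {0..t} (\<lambda>r. T (s + t - r) (Q (U x r))) = integral {0..t} (\<lambda>r. T s (T (t - r) (Q (U x r))))"
      proof (rule Henstock_Kurzweil_Integration.integral_cong)
        fix r assume "r \<in> {0..t}"
        then show "T (s + t - r) (Q (U x r)) = T s (T (t - r) (Q (U x r)))"
          using C0_add[OF T s, of "t - r"] by (simp add: algebra_simps)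
      qed
      then show ?thesis
        unfolding duhamel_def
        by (simp add: Henstock_integral_bounded_linear[OF duhamel_integrand_continuous[OF Uc] C0_linear[OF T s]])
    qed
    also have "integral {t..s + t} (\<lambda>r. T (s + t - r) (Q (U x r))) = duhamel T Q (\<lambda>s. U x (s + t)) s"
      unfolding duhamel_def
      using integral_shift_real_ivl[of t t "s + t" "\<lambda>r. T (s + t - r) (Q (U x r))"] by simp
    finally show "U x (s + t) = T s (U x t) + duhamel T Q (\<lambda>s. U x (s + t)) s"
      using U(2)[OF t, of x] by (simp add: C0_add[OF T s t] linear_simps[OF C0_linear[OF T s]])
  qed
  have V: "C0_semigroup V"
    unfolding C0_semigroup_def using lin V0 semi U(1) by (auto simp: V_def)
  have lim: "((\<lambda>h. (1 / h) *\<^sub>R duhamel T Q (U x) h) \<longlongrightarrow> Q x) (at_right 0)" for x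
    unfolding tendsto_iff
  proof (intro allI impI)
    fix e :: real assume e: "0 < e"
    \<comment> \<open>Continuity on the triangle \<open>0 \<le> s \<le> h\<close>, used at its
      corner: there the integrand is close to \<open>Q x\<close>, and so is its average over
      \<open>{0..h}\<close>.\<close>
    have "continuous_on {(h, s). 0 \<le> s \<and> s \<le> h} (\<lambda>p. T (fst p - snd p) (Q (U x (snd p))))"
      by (intro C0_continuous_compose[OF T] continuous_intros Q.continuous_on
          continuous_on_compose2[OF U(1)]) auto
    then obtain d where d: "0 < d" "\<And>h s. 0 \<le> s \<Longrightarrow> s \<le> h \<Longrightarrow> dist (h, s) (0, 0) < d \<Longrightarrow>
        dist (T (h - s) (Q (U x s))) (T 0 (Q (U x 0))) < e / 2"
    proof -
      assume c: "continuous_on {(h, s). 0 \<le> s \<and> s \<le> h} (\<lambda>p. T (fst p - snd p) (Q (U x (snd p))))"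
        and goal: "\<And>d. 0 < d \<Longrightarrow> (\<And>h s. 0 \<le> s \<Longrightarrow> s \<le> h \<Longrightarrow> dist (h, s) (0, 0) < d \<Longrightarrow>
          dist (T (h - s) (Q (U x s))) (T 0 (Q (U x 0))) < e / 2) \<Longrightarrow> thesis"
      obtain d where "0 < d" "\<forall>p\<in>{(h, s). 0 \<le> s \<and> s \<le> h}. dist p (0::real, 0::real) < d \<longrightarrow>
          dist (T (fst p - snd p) (Q (U x (snd p)))) (T (0 - 0) (Q (U x 0))) < e / 2"
        using c[unfolded continuous_on_iff, rule_format, of "(0, 0)" "e / 2"] e by auto
      then show thesis by (intro goal) auto
    qed
    have *: "dist ((1 / h) *\<^sub>R duhamel T Q (U x) h) (Q x) < e" if h: "0 < h" "h < d / 2" for h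
    proof -
      have c: "continuous_on {0..h} (\<lambda>s. T (h - s) (Q (U x s)))"
        by (intro duhamel_integrand_continuous Uc) auto
      have "norm (integral {0..h} (\<lambda>s. T (h - s) (Q (U x s)) - Q x)) \<le> e / 2 * (h - 0)"
      proof (rule integral_bound)
        fix s assume s: "s \<in> {0..h}"
        have "dist (h, s) (0, 0) \<le> \<bar>h\<bar> + \<bar>s\<bar>"
          using sqrt_sum_squares_le_sum_abs[of h s] by (simp add: dist_prod_def)
        then have "dist (h, s) (0, 0) < d" using s h by auto
        then show "norm (T (h - s) (Q (U x s)) - Q x) \<le> e / 2"
          using d(2)[of s h] s V0[of x] by (simp add: dist_norm C0_zero[OF T] V_def)
      qed (use h in \<open>auto intro!: continuous_intros c\<close>)
      also have "integral {0..h} (\<lambda>s. T (h - s) (Q (U x s)) - Q x) = duhamel T Q (U x) h - h *\<^sub>R Q x"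
        unfolding duhamel_def using h
        by (subst Henstock_Kurzweil_Integration.integral_diff) (auto intro!: integrable_continuous_real c)
      also have "duhamel T Q (U x) h - h *\<^sub>R Q x = h *\<^sub>R ((1 / h) *\<^sub>R duhamel T Q (U x) h - Q x)"
        using h by (simp add: algebra_simps)
      finally have "h * dist ((1 / h) *\<^sub>R duhamel T Q (U x) h) (Q x) \<le> h * (e / 2)"
        using h by (simp add: dist_norm mult.commute)
      then show ?thesis using h e by simp
    qed
    show "\<forall>\<^sub>F h in at_right 0. dist ((1 / h) *\<^sub>R duhamel T Q (U x) h) (Q x) < e"
      unfolding eventually_at_right_field using * d(1) by (intro exI[of _ "d / 2"]) auto
  qed
  have gen: "(x, y) \<in> generator V \<longleftrightarrow> (x, y - Q x) \<in> generator T" for x y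
  proof -
    have eq: "\<forall>\<^sub>F h in at_right 0. (1 / h) *\<^sub>R (V h x - x) = (1 / h) *\<^sub>R (T h x - x) + (1 / h) *\<^sub>R duhamel T Q (U x) h"
      unfolding eventually_at_filter
      by (intro eventuallyI) (simp add: V_def U(2) flip: scaleR_add_right)
    show ?thesis
    proof
      assume "(x, y) \<in> generator V"
      then have "((\<lambda>h. (1 / h) *\<^sub>R (V h x - x)) \<longlongrightarrow> y) (at_right 0)" by (simp add: generator_def)
      from tendsto_diff[OF this lim[of x]]
      have "((\<lambda>h. (1 / h) *\<^sub>R (T h x - x)) \<longlongrightarrow> y - Q x) (at_right 0)"
        by (rule Lim_transform_eventually) (use eq in \<open>auto elim: eventually_mono\<close>)
      then show "(x, y - Q x) \<in> generator T" by (simp add: generator_def)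
    next
      assume "(x, y - Q x) \<in> generator T"
      then have "((\<lambda>h. (1 / h) *\<^sub>R (T h x - x)) \<longlongrightarrow> y - Q x) (at_right 0)"
        by (simp add: generator_def)
      from tendsto_add[OF this lim[of x]]
      have "((\<lambda>h. (1 / h) *\<^sub>R (V h x - x)) \<longlongrightarrow> y - Q x + Q x) (at_right 0)"
        by (rule Lim_transform_eventually) (use eq in \<open>auto elim: eventually_mono\<close>)
      then show "(x, y) \<in> generator V" by (simp add: generator_def)
    qed
  qed
  have "generator V = plus_bounded (generator T) Q"
  proof (intro set_eqI iffI)
    fix p assume "p \<in> generator V"
    then have "(fst p, snd p - Q (fst p)) \<in> generator T" using gen[of "fst p" "snd p"] by simp
    then show "p \<in> plus_bounded (generator T) Q"
      unfolding plus_bounded_def by (force simp: prod_eq_iff)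
  next
    fix p assume "p \<in> plus_bounded (generator T) Q"
    then show "p \<in> generator V" using gen by (auto simp: plus_bounded_def)
  qed
  with V show ?thesis by (rule that)
qed

end

section \<open>Lower bounds, left inverses and isometric perturbations\<close>

text \<open>Lets a statement that is closed in \<open>x\<close> be checked on the domain, where
  orbits can be differentiated.\<close>

lemma C0_generator_dense_induct:
  assumes "C0_semigroup T" "closed {x. P x}" "\<And>x y. (x, y) \<in> generator T \<Longrightarrow> P x"
  shows "P x"
proof -
  have "x \<in> closure {x. P x}"
    unfolding closure_approachable
    using C0_generator_dense[OF assms(1)] assms(3) by (metis dist_norm mem_Collect_eq)
  then show ?thesis using assms(2) by simp
qed

lemma zero_vector_derivative_constant:
  fixes f :: "real \<Rightarrow> 'a::real_normed_vector"
  assumes "\<And>t. 0 \<le> t \<Longrightarrow> (f has_vector_derivative 0) (at t within {0..})" "0 \<le> t"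
  shows "f t = f 0"
proof -
  have "\<exists>c. \<forall>t\<in>{0..}. f t = c"
    by (rule has_derivative_zero_constant) (use assms(1) in \<open>auto simp: has_vector_derivative_def\<close>)
  then show ?thesis using assms(2) by force
qed

section \<open>Operators represented by bounded forms\<close>

lemma bounded_bilinear_half_diff:
  fixes f g :: "'a::real_normed_vector \<Rightarrow> 'b::real_normed_vector \<Rightarrow> real"
  assumes "bounded_bilinear f" "bounded_bilinear g"
  shows "bounded_bilinear (\<lambda>x y. (f x y - g x y) / 2)"
proof -
  interpret f: bounded_bilinear f by fact
  interpret g: bounded_bilinear g by fact
  obtain C D where C: "\<And>x y. norm (f x y) \<le> norm x * norm y * C"
    and D: "\<And>x y. norm (g x y) \<le> norm x * norm y * D"
    using f.bounded g.bounded by blast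
  show ?thesis
  proof
    have "norm ((f x y - g x y) / 2) \<le> norm x * norm y * ((C + D) / 2)" for x y
      using C[of x y] D[of x y] abs_triangle_ineq4[of "f x y" "g x y"] by (simp add: distrib_left)
    then show "\<exists>K. \<forall>x y. norm ((f x y - g x y) / 2) \<le> norm x * norm y * K" by blast
  qed (auto simp: f.add_left f.add_right g.add_left g.add_right f.scaleR_left f.scaleR_right
      g.scaleR_left g.scaleR_right field_simps)
qed

text \<open>Lax-Milgram for each functional \<open>g x\<close>, with coercivity of \<open>b\<close>
  giving uniqueness, linearity and boundedness. \<open>g\<close> may be non-symmetric, so the lemma
  yields perturbing operators, adjoints and left inverses alike.\<close>

lemma form_operator:
  fixes b g :: "'a::complex_hilbert_space \<Rightarrow> 'a \<Rightarrow> real"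
  assumes b: "bounded_bilinear b" and sym: "\<And>x y. b x y = b y x"
    and m: "0 < m" "\<And>x. m * (norm x)\<^sup>2 \<le> b x x"
    and bi: "\<And>x y. b (scaleC \<i> x) (scaleC \<i> y) = b x y"
    and g: "bounded_bilinear g" and gi: "\<And>x y. g (scaleC \<i> x) (scaleC \<i> y) = g x y"
  obtains Q where "bounded_clinear Q" "\<And>x y. b (Q x) y = g x y"
proof -
  interpret b: bounded_bilinear b by fact
  interpret g: bounded_bilinear g by fact
  have "\<exists>z. \<forall>y. b z y = g x y" for x
    by (rule symmetric_Lax_Milgram[OF b sym m g.bounded_linear_right[of x], of UNIV]) auto
  then obtain Q where Q: "\<And>x y. b (Q x) y = g x y" by metis
  have eqI: "z = z'" if "\<And>y. b z y = b z' y" for z z'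
  proof -
    have "m * (norm (z - z'))\<^sup>2 \<le> 0"
      using m(2)[of "z - z'"] that[of "z - z'"] by (simp add: b.diff_left)
    then show ?thesis using m(1) by (simp add: mult_le_0_iff)
  qed
  obtain C where C: "0 \<le> C" "\<And>x y. norm (g x y) \<le> norm x * norm y * C"
    using g.nonneg_bounded by blast
  have "bounded_linear Q"
  proof (rule bounded_linear_intro[of _ "C / m"])
    show "Q (x + y) = Q x + Q y" for x y
      by (rule eqI) (simp add: Q b.add_left g.add_left)
    show "Q (r *\<^sub>R x) = r *\<^sub>R Q x" for r x
      by (rule eqI) (simp add: Q b.scaleR_left g.scaleR_left)
    show "norm (Q x) \<le> norm x * (C / m)" for x
    proof (cases "Q x = 0")
      case True
      then show ?thesis using C(1) m(1) by simp
    next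
      case False
      have "norm (Q x) * (m * norm (Q x)) \<le> norm (Q x) * (norm x * C)"
        using m(2)[of "Q x"] C(2)[of x "Q x"] by (simp add: Q power2_eq_square mult_ac)
      then have "m * norm (Q x) \<le> norm x * C" using False by simp
      then show ?thesis using m(1) by (simp add: field_simps)
    qed
  qed
  moreover have "Q (scaleC \<i> x) = scaleC \<i> (Q x)" for x
  proof (rule eqI)
    fix y :: 'a
    \<comment> \<open>Once the second argument is a multiple of the imaginary unit, the invariance
      of both forms applies.\<close>
    have y: "y = scaleC \<i> (- scaleC \<i> y)" by (simp add: scaleC_minus_right scaleC_i_i)
    show "b (Q (scaleC \<i> x)) y = b (scaleC \<i> (Q x)) y"
      by (subst (1 2) y) (simp only: Q gi bi)
  qed
  ultimately show ?thesis using that Q bounded_clinearI by blast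
qed

section \<open>Lower bounds and how the other conditions imply them\<close>

lemma exponential_lower_bound:
  assumes T: "C0_semigroup T" and lb: "satisfies_lower_bounds T"
  obtains c \<alpha> where "0 < c" "\<And>t x. 0 \<le> t \<Longrightarrow> c * exp (- \<alpha> * t) * norm x \<le> norm (T t x)"
proof -
  obtain k where k: "0 < k" "\<And>x. k * norm x \<le> norm (T 1 x)"
    using lb unfolding satisfies_lower_bounds_def by (metis zero_le_one)
  \<comment> \<open>With \<open>a \<le> 1\<close> the powers of \<open>a\<close> decrease, so
    rounding a time up by less than one unit costs at most one factor \<open>a\<close>.\<close>
  define a where "a = min k 1"
  have a: "0 < a" "a \<le> 1" using k by (auto simp: a_def)
  have "a * norm x \<le> k * norm x" for x :: 'a by (intro mult_right_mono) (auto simp: a_def)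
  then have a1: "a * norm x \<le> norm (T 1 x)" for x using k(2) order_trans by blast
  obtain K where K: "0 < K" "\<And>t x. 0 \<le> t \<Longrightarrow> t \<le> 1 \<Longrightarrow> norm (T t x) \<le> K * norm x"
    using C0_locally_bounded[OF T] by blast
  have pow: "a ^ n * norm x \<le> norm (T (real n) x)" for n x
  proof (induction n)
    case 0
    then show ?case by (simp add: C0_zero[OF T])
  next
    case (Suc n)
    have "a ^ Suc n * norm x \<le> a * norm (T (real n) x)"
      using Suc a by simp
    also have "\<dots> \<le> norm (T 1 (T (real n) x))" by (rule a1)
    also have "T 1 (T (real n) x) = T (real (Suc n)) x"
      using C0_add[OF T, of 1 "real n"] by simp
    finally show ?case .
  qed
  have "a / K * exp (- (- ln a) * t) * norm x \<le> norm (T t x)" if t: "0 \<le> t" for t x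
  proof -
    \<comment> \<open>Rounding up, not down: then \<open>T n x = T (n - t) (T t x)\<close>, and the
      bound at the integer time passes to \<open>T t x\<close> at the price of
      \<open>K\<close>.\<close>
    define n where "n = nat \<lceil>t\<rceil>"
    have n: "t \<le> real n" "real n \<le> t + 1" using t by (auto simp: n_def)
    have "a * exp (- (- ln a) * t) = exp ((t + 1) * ln a)"
      using a by (simp add: exp_add distrib_right mult.commute[of t] mult.commute[of _ a])
    also have "\<dots> \<le> exp (real n * ln a)"
      using n a by (simp add: mult_right_mono_neg)
    also have "\<dots> = a ^ n" using a by (simp add: exp_of_nat_mult)
    finally have "a * exp (- (- ln a) * t) * norm x \<le> norm (T (real n) x)"
      using pow[of n x] by (meson mult_right_mono norm_ge_zero order_trans)
    also have "T (real n) x = T (real n - t) (T t x)"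
      using C0_add[OF T, of "real n - t" t] n t by simp
    also have "norm \<dots> \<le> K * norm (T t x)" by (rule K(2)) (use n in auto)
    finally show ?thesis using K(1) by (simp add: field_simps)
  qed
  moreover have "0 < a / K" using a K by simp
  ultimately show ?thesis using that by blast
qed

lemma left_inverse_lower_bounds:
  assumes "left_inverse_semigroup L T"
  shows "satisfies_lower_bounds T"
proof -
  have "\<exists>c>0. \<forall>x. c * norm x \<le> norm (T t x)" if t: "0 \<le> t" for t
  proof -
    have L: "bounded_linear (L t)" "\<And>x. L t (T t x) = x"
      using assms t C0_linear by (auto simp: left_inverse_semigroup_def)
    obtain K where K: "0 < K" "\<And>x. norm (L t x) \<le> norm x * K"
      using bounded_linear.pos_bounded[OF L(1)] by blast
    have "1 / K * norm x \<le> norm (T t x)" for x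
      using K(2)[of "T t x"] K(1) L(2)[of x] by (simp add: field_simps)
    then show ?thesis using K(1) by (intro exI[of _ "1 / K"]) simp
  qed
  then show ?thesis unfolding satisfies_lower_bounds_def by metis
qed

text \<open>\<open>S (- t)\<close> is a bounded left inverse of \<open>T t\<close> on the embedded
  copy. The carrier type is arbitrary, so extensions outside \<open>extension_space\<close> are
  covered as well.\<close>

lemma C0_group_extension_lower_bounds:
  assumes "C0_group_extension T smul Y ip J S"
  shows "satisfies_lower_bounds T"
proof -
  have J: "J x \<in> Y" "ip_norm ip (J x) = norm x" for x
    using assms by (auto simp: C0_group_extension_def isometric_embedding_def)
  have S: "bounded_operator_on smul Y ip (S t)" "\<And>y. y \<in> Y \<Longrightarrow> S 0 y = y"
    "\<And>s t y. y \<in> Y \<Longrightarrow> S (s + t) y = S s (S t y)"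
    "\<And>t x. 0 \<le> t \<Longrightarrow> S t (J x) = J (T t x)" for t
    using assms by (auto simp: C0_group_extension_def C0_group_on_def)
  have "\<exists>c>0. \<forall>x. c * norm x \<le> norm (T t x)" if t: "0 \<le> t" for t
  proof -
    obtain K where K: "\<And>y. y \<in> Y \<Longrightarrow> ip_norm ip (S (- t) y) \<le> K * ip_norm ip y"
      using S(1)[of "- t"] unfolding bounded_operator_on_def by blast
    \<comment> \<open>\<open>K\<close> comes without a sign, and the bound is divided by it.\<close>
    define k where "k = max K 1"
    have "1 / k * norm x \<le> norm (T t x)" for x
    proof -
      have "J x = S (- t) (J (T t x))"
        using S(2)[OF J(1), of x] S(3)[OF J(1), of "- t" t x] S(4)[OF t, of x] by simp
      then have "norm x = ip_norm ip (S (- t) (J (T t x)))" by (metis J(2))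
      also have "\<dots> \<le> K * norm (T t x)" using K[OF J(1)] J(2) by simp
      also have "\<dots> \<le> k * norm (T t x)" by (intro mult_right_mono) (auto simp: k_def)
      finally show ?thesis by (simp add: field_simps k_def)
    qed
    then show ?thesis by (intro exI[of _ "1 / k"]) (simp add: k_def)
  qed
  then show ?thesis unfolding satisfies_lower_bounds_def by metis
qed

lemma isometric_perturbation_lower_bounds:
  assumes T: "C0_semigroup T" and Q: "bounded_clinear Q" and ip: "equivalent_inner_product ip"
    and V: "C0_semigroup V" and gen: "generator V = plus_bounded (generator T) Q"
    and iso: "\<And>t x. 0 \<le> t \<Longrightarrow> ip_norm ip (V t x) = ip_norm ip x"
  shows "satisfies_lower_bounds T"
proof -
  obtain m M where m: "0 < m" "\<And>x. m * norm x \<le> ip_norm ip x"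
    and M: "0 < M" "\<And>x. ip_norm ip x \<le> M * norm x"
    using ip by (auto simp: equivalent_inner_product_def)
  have "inner_product_on scaleC UNIV ip" using ip by (simp add: equivalent_inner_product_def)
  note * = this[unfolded inner_product_on_def]
  have ipo: "\<And>x y z. ip (x + y) z = ip x z + ip y z" "\<And>c x y. ip (scaleC c x) y = c * ip x y"
    "\<And>x y. ip y x = cnj (ip x y)" "\<And>x. x \<noteq> 0 \<Longrightarrow> 0 < Re (ip x x)"
    using *[THEN conjunct1] *[THEN conjunct2, THEN conjunct1]
      *[THEN conjunct2, THEN conjunct2, THEN conjunct1]
      *[THEN conjunct2, THEN conjunct2, THEN conjunct2] by fast+
  define b where "b x y = Re (ip x y)" for x y
  have sym: "b x y = b y x" for x y
  proof -
    have "ip x y = cnj (ip y x)" by (rule ipo)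
    then show ?thesis by (simp add: b_def)
  qed
  have addl: "b (x + y) z = b x z + b y z" for x y z
    by (simp add: ipo(1) b_def)
  have scl: "b (r *\<^sub>R x) y = r * b x y" for r x y
  proof -
    have "ip (scaleC (complex_of_real r) x) y = complex_of_real r * ip x y"
      by (rule ipo)
    then show ?thesis by (simp add: b_def scaleC_of_real)
  qed
  have addr: "b z (x + y) = b z x + b z y" and scr: "b y (r *\<^sub>R x) = r * b y x" for x y z r
    by (simp_all only: sym[of z "x + y"] sym[of z x] sym[of z y] sym[of y "r *\<^sub>R x"] sym[of y x] addl scl)
  have b0: "b 0 x = 0" "b x 0 = 0" for x using scl[of 0 0 x] scr[of x 0 0] by auto
  have pos: "0 \<le> b x x" for x
    using ipo(4)[of x] by (cases "x = 0") (auto simp: b_def less_imp_le b0[unfolded b_def])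
  have nrm: "b x x = (ip_norm ip x)\<^sup>2" for x using pos[of x] by (simp add: ip_norm_def b_def)
  have lower: "m\<^sup>2 * (norm x)\<^sup>2 \<le> b x x" for x
    unfolding nrm using m by (simp flip: power_mult_distrib add: power_mono)
  have upper: "b x x \<le> M\<^sup>2 * (norm x)\<^sup>2" for x
    unfolding nrm power_mult_distrib[symmetric] using M
    by (intro power_mono) (auto simp: ip_norm_def pos[unfolded b_def])
  \<comment> \<open>A substitute for the Cauchy-Schwarz inequality: positivity of \<open>b\<close>
    at \<open>x + y\<close> and at \<open>x - y\<close> controls the mixed term on unit vectors, and
    scaling does the rest.\<close>
  have unit: "\<bar>b x y\<bar> \<le> M\<^sup>2" if "norm x = 1" "norm y = 1" for x y
  proof -
    have "0 \<le> b (x + y) (x + y)" "0 \<le> b (x + (-1) *\<^sub>R y) (x + (-1) *\<^sub>R y)" by (rule pos)+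
    then show ?thesis
      using upper[of x] upper[of y] that
      by (simp only: addl addr scl scr sym[of y x]) (simp add: abs_le_iff)
  qed
  have bound: "norm (b x y) \<le> norm x * norm y * M\<^sup>2" for x y
  proof (cases "x = 0 \<or> y = 0")
    case True
    then show ?thesis by (auto simp: b0)
  next
    case False
    then have "\<bar>b ((1 / norm x) *\<^sub>R x) ((1 / norm y) *\<^sub>R y)\<bar> \<le> M\<^sup>2" by (intro unit) auto
    then show ?thesis using False by (simp add: scl scr abs_mult field_simps)
  qed
  have bb: "bounded_bilinear b"
    by standard (use bound in \<open>auto simp: addl addr scl scr intro!: exI[of _ "M\<^sup>2"]\<close>)
  interpret b: bounded_bilinear b by (rule bb)
  interpret Q: bounded_linear Q using Q by (rule bounded_clinearD)
  have zero: "b y x = - b (Q x) x" if xy: "(x, y) \<in> generator T" for x y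
  proof -
    have "(x, y + Q x) \<in> generator V" using xy gen by (auto simp: plus_bounded_def)
    then have lim: "((\<lambda>h. (1 / h) *\<^sub>R (V h x - x)) \<longlongrightarrow> y + Q x) (at_right 0)"
      by (simp add: generator_def)
    have "((\<lambda>h. V h x) \<longlongrightarrow> V 0 x) (at 0 within {0..})"
      using C0_continuous[OF V, of x] by (auto simp: continuous_on_def)
    then have "((\<lambda>h. V h x) \<longlongrightarrow> x) (at_right 0)"
      by (auto simp: C0_zero[OF V] intro: tendsto_within_subset)
    \<comment> \<open>Pairing the difference quotient with the sum \<open>V h x + x\<close> produces
      a difference of squared norms over \<open>h\<close>, which is 0 because \<open>V\<close> is
      isometric.\<close>
    then have "((\<lambda>h. b ((1 / h) *\<^sub>R (V h x - x)) (V h x + x)) \<longlongrightarrow> b (y + Q x) (x + x)) (at_right 0)"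
      by (intro b.tendsto lim tendsto_add tendsto_const)
    moreover have "\<forall>\<^sub>F h in at_right 0. b ((1 / h) *\<^sub>R (V h x - x)) (V h x + x) = 0"
      unfolding eventually_at_filter
      using iso by (intro eventuallyI)
        (simp add: b.scaleR_left b.diff_left b.add_right sym[of x] nrm diff_divide_distrib)
    ultimately have "((\<lambda>h. 0) \<longlongrightarrow> b (y + Q x) (x + x)) (at_right (0::real))"
      by (rule Lim_transform_eventually)
    then have "b (y + Q x) (x + x) = 0" by (simp add: tendsto_const_iff)
    then show ?thesis by (simp add: b.add_left b.add_right)
  qed
  obtain q where q: "0 \<le> q" "\<And>x. norm (Q x) \<le> norm x * q" using Q.nonneg_bounded by blast
  \<comment> \<open>\<open>q\<close> bounds \<open>Q\<close>, the form contributes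
    \<open>M\<^sup>2\<close>, and \<open>m\<^sup>2\<close> passes from the original norm back to
    \<open>b\<close>.\<close>
  define k where "k = q * M\<^sup>2 / m\<^sup>2"
  have k: "\<bar>b (Q x) x\<bar> \<le> k * b x x" for x
  proof -
    have "\<bar>b (Q x) x\<bar> \<le> norm (Q x) * norm x * M\<^sup>2" using bound by simp
    also have "\<dots> \<le> (norm x * q) * norm x * M\<^sup>2" by (intro mult_right_mono q) auto
    also have "\<dots> = k * (m\<^sup>2 * (norm x)\<^sup>2)" using m by (simp add: k_def power2_eq_square field_simps)
    also have "\<dots> \<le> k * b x x" using q by (intro mult_left_mono lower) (simp add: k_def)
    finally show ?thesis .
  qed
  have main: "b x x \<le> exp (2 * k * t) * b (T t x) (T t x)" if t: "0 \<le> t" for t x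
  proof (rule C0_generator_dense_induct[OF T, where P = "\<lambda>x. b x x \<le> exp (2 * k * t) * b (T t x) (T t x)"])
    have "continuous_on UNIV (T t)" by (rule linear_continuous_on[OF C0_linear[OF T t]])
    then show "closed {x. b x x \<le> exp (2 * k * t) * b (T t x) (T t x)}"
      by (intro closed_Collect_le continuous_intros b.continuous_on) auto
    fix x y assume xy: "(x, y) \<in> generator T"
    \<comment> \<open>The exponential weight outweighs the fastest decay of
      \<open>b (T s x) (T s x)\<close> that \<open>Q\<close> permits, so \<open>\<phi>\<close> is
      nondecreasing.\<close>
    define \<phi> where "\<phi> s = exp (2 * k * s) * b (T s x) (T s x)" for s
    have "\<phi> 0 \<le> \<phi> t"
    proof (rule DERIV_nonneg_imp_increasing_open[OF t])
      show "continuous_on {0..t} \<phi>"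
        unfolding \<phi>_def
        by (intro continuous_intros b.continuous_on continuous_on_subset[OF C0_continuous[OF T]]) auto
      fix s assume s: "0 < s" "s < t"
      have "((\<lambda>s. T s x) has_vector_derivative T s y) (at s within {0<..})"
        by (rule has_vector_derivative_within_subset[OF C0_derivative[OF T xy]]) (use s in auto)
      then have d: "((\<lambda>s. T s x) has_vector_derivative T s y) (at s)"
        by (subst (asm) has_vector_derivative_within_open) (use s in auto)
      have deriv: "(\<phi> has_vector_derivative exp (2 * k * s) * (b (T s x) (T s y) + b (T s y) (T s x))
          + (2 * k * exp (2 * k * s)) * b (T s x) (T s x)) (at s)"
        unfolding \<phi>_def
        by (intro bounded_bilinear.has_vector_derivative[OF bounded_bilinear_mult] b.has_vector_derivative d)
          (auto intro!: derivative_eq_intros simp flip: has_real_derivative_iff_has_vector_derivative)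
      have "b (T s y) (T s x) = - b (Q (T s x)) (T s x)"
        using s by (intro zero C0_generator_invariant[OF T xy]) simp
      moreover have "0 \<le> exp (2 * k * s) * (2 * (k * b (T s x) (T s x) - b (Q (T s x)) (T s x)))"
        using k[of "T s x"] by (intro mult_nonneg_nonneg) auto
      ultimately have "0 \<le> exp (2 * k * s) * (b (T s x) (T s y) + b (T s y) (T s x))
          + (2 * k * exp (2 * k * s)) * b (T s x) (T s x)"
        by (simp add: sym[of "T s x" "T s y"] algebra_simps)
      with deriv show "\<exists>y. (\<phi> has_real_derivative y) (at s) \<and> 0 \<le> y"
        unfolding has_real_derivative_iff_has_vector_derivative by blast
    qed
    then show "b x x \<le> exp (2 * k * t) * b (T t x) (T t x)" by (simp add: \<phi>_def C0_zero[OF T])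
  qed
  have "m / (M * exp (k * t)) * norm x \<le> norm (T t x)" if t: "0 \<le> t" for t x
  proof -
    have "(m * norm x)\<^sup>2 \<le> exp (2 * k * t) * (M\<^sup>2 * (norm (T t x))\<^sup>2)"
    proof -
      have "(m * norm x)\<^sup>2 \<le> b x x" using lower[of x] by (simp add: power_mult_distrib)
      also have "\<dots> \<le> exp (2 * k * t) * b (T t x) (T t x)" by (rule main[OF t])
      also have "\<dots> \<le> exp (2 * k * t) * (M\<^sup>2 * (norm (T t x))\<^sup>2)"
        by (intro mult_left_mono upper) simp
      finally show ?thesis .
    qed
    also have "\<dots> = (exp (k * t) * M * norm (T t x))\<^sup>2"
      by (simp only: power_mult_distrib exp_double[of "k * t", symmetric] mult.assoc)
    finally have "m * norm x \<le> exp (k * t) * M * norm (T t x)"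
      by (rule power2_le_imp_le) (use M in simp)
    then show ?thesis using M by (simp add: field_simps)
  qed
  moreover have "0 < m / (M * exp (k * t))" for t using m M by simp
  ultimately show ?thesis unfolding satisfies_lower_bounds_def
    by (intro exI[of _ "\<lambda>t. m / (M * exp (k * t))"] allI impI conjI)
qed

section \<open>The inner product averaged along orbits\<close>

context
  fixes T :: "real \<Rightarrow> 'a::complex_hilbert_space \<Rightarrow> 'a"
  assumes T: "C0_semigroup T" and lb: "satisfies_lower_bounds T"
begin

definition energy :: "'a \<Rightarrow> 'a \<Rightarrow> real" where
  "energy x y = integral {0..1} (\<lambda>t. inner (T t x) (T t y))"

lemma inner_orbits_continuous: "continuous_on {0..1} (\<lambda>t. inner (T t x) (T t y))"
  by (intro continuous_intros continuous_on_subset[OF C0_continuous[OF T]]) auto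

lemma energy_commute: "energy x y = energy y x"
  by (simp add: energy_def inner_commute)

lemma energy_bounded_bilinear: "bounded_bilinear energy"
proof -
  obtain K where K: "0 < K" "\<And>t x. 0 \<le> t \<Longrightarrow> t \<le> 1 \<Longrightarrow> norm (T t x) \<le> K * norm x"
    using C0_locally_bounded[OF T] by blast
  have add: "energy (x + y) z = energy x z + energy y z" for x y z
  proof -
    have "energy (x + y) z = integral {0..1} (\<lambda>t. inner (T t x) (T t z) + inner (T t y) (T t z))"
      unfolding energy_def
      by (rule Henstock_Kurzweil_Integration.integral_cong)
        (simp add: linear_simps[OF C0_linear[OF T]] inner_add_left)
    then show ?thesis
      unfolding energy_def
      by (simp add: Henstock_Kurzweil_Integration.integral_add integrable_continuous_real
          inner_orbits_continuous)
  qed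
  have scale: "energy (r *\<^sub>R x) y = r *\<^sub>R energy x y" for r x y
  proof -
    have "energy (r *\<^sub>R x) y = integral {0..1} (\<lambda>t. r *\<^sub>R inner (T t x) (T t y))"
      unfolding energy_def
      by (rule Henstock_Kurzweil_Integration.integral_cong)
        (simp add: linear_simps[OF C0_linear[OF T]])
    then show ?thesis unfolding energy_def by simp
  qed
  have bound: "norm (energy x y) \<le> norm x * norm y * K\<^sup>2" for x y
  proof -
    have "norm (energy x y) \<le> (K * norm x) * (K * norm y) * (1 - 0)"
      unfolding energy_def
    proof (rule integral_bound)
      fix t :: real assume "t \<in> {0..1}"
      then have "norm (T t x) \<le> K * norm x" "norm (T t y) \<le> K * norm y" using K by auto
      then have "norm (T t x) * norm (T t y) \<le> (K * norm x) * (K * norm y)"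
        using K by (intro mult_mono) auto
      then show "norm (inner (T t x) (T t y)) \<le> (K * norm x) * (K * norm y)"
        using Cauchy_Schwarz_ineq2[of "T t x" "T t y"] by simp
    qed (auto intro: inner_orbits_continuous)
    then show ?thesis by (simp add: power2_eq_square mult_ac)
  qed
  show ?thesis
  proof
    show "energy a (b + b') = energy a b + energy a b'" for a b b'
      by (metis add energy_commute)
    show "energy a (r *\<^sub>R b) = r *\<^sub>R energy a b" for a b r
      by (metis scale energy_commute)
  qed (use add scale bound in blast)+
qed

lemma energy_scaleC_i: "energy (scaleC \<i> x) (scaleC \<i> y) = energy x y"
  unfolding energy_def
  by (rule Henstock_Kurzweil_Integration.integral_cong)
    (simp add: bounded_clinearD(2)[OF C0_clinear[OF T]] inner_scaleC_i)

lemma energy_coercive: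
  obtains m where "0 < m" "\<And>x. m * (norm x)\<^sup>2 \<le> energy x x"
proof -
  obtain c \<alpha> where c: "0 < c" "\<And>t x. 0 \<le> t \<Longrightarrow> c * exp (- \<alpha> * t) * norm x \<le> norm (T t x)"
    using exponential_lower_bound[OF T lb] by blast
  \<comment> \<open>Lies below \<open>c * exp (- \<alpha> * t)\<close> on the unit interval for
    either sign of \<open>\<alpha>\<close>.\<close>
  define d where "d = c * exp (- \<bar>\<alpha>\<bar>)"
  have d: "0 < d" using c by (simp add: d_def)
  have low: "(d * norm x)\<^sup>2 \<le> inner (T t x) (T t x)" if "t \<in> {0..1}" for t x
  proof -
    have "\<alpha> * t \<le> \<bar>\<alpha>\<bar> * 1" using that by (intro mult_mono) auto
    then have "d * norm x \<le> c * exp (- \<alpha> * t) * norm x"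
      using c unfolding d_def by (intro mult_right_mono mult_left_mono) auto
    then have "d * norm x \<le> norm (T t x)" using c(2)[of t x] that by simp
    then show ?thesis using d by (simp add: power2_norm_eq_inner[symmetric] power_mono)
  qed
  have "d\<^sup>2 * (norm x)\<^sup>2 \<le> energy x x" for x
  proof -
    have "integral {0..1::real} (\<lambda>t. (d * norm x)\<^sup>2) \<le> energy x x"
      unfolding energy_def
      by (intro integral_le integrable_continuous_real inner_orbits_continuous low continuous_intros)
    then show ?thesis by (simp add: power_mult_distrib)
  qed
  then show ?thesis using that[of "d\<^sup>2"] d by simp
qed

text \<open>The two energies on the left integrate the derivative of
  \<open>inner (T t x1) (T t x2)\<close>, so only the end points survive, and these are bounded in
  \<open>x1\<close> and \<open>x2\<close>. Two separate vectors are kept because the duality behind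
  the left inverse needs the polarised identity.\<close>

lemma energy_generator:
  assumes 1: "(x1, y1) \<in> generator T" and 2: "(x2, y2) \<in> generator T"
  shows "energy y1 x2 + energy x1 y2 = inner (T 1 x1) (T 1 x2) - inner x1 x2"
proof -
  interpret energy: bounded_bilinear energy by (rule energy_bounded_bilinear)
  have "((\<lambda>t. inner (T t x1) (T t y2) + inner (T t y1) (T t x2)) has_integral
      inner (T 1 x1) (T 1 x2) - inner (T 0 x1) (T 0 x2)) {0..1}"
  proof (rule fundamental_theorem_of_calculus)
    fix t :: real assume t: "t \<in> {0..1}"
    have "((\<lambda>t. T t x1) has_vector_derivative T t y1) (at t within {0..1})"
      "((\<lambda>t. T t x2) has_vector_derivative T t y2) (at t within {0..1})"
      using t by (auto intro!: has_vector_derivative_within_subset[OF C0_derivative[OF T]] 1 2)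
    then show "((\<lambda>t. inner (T t x1) (T t x2)) has_vector_derivative
        inner (T t x1) (T t y2) + inner (T t y1) (T t x2)) (at t within {0..1})"
      by (rule bounded_bilinear.has_vector_derivative[OF bounded_bilinear_inner])
  qed simp
  then have "integral {0..1} (\<lambda>t. inner (T t x1) (T t y2) + inner (T t y1) (T t x2)) =
      inner (T 1 x1) (T 1 x2) - inner x1 x2"
    by (simp add: integral_unique C0_zero[OF T])
  moreover have "integral {0..1} (\<lambda>t. inner (T t x1) (T t y2) + inner (T t y1) (T t x2)) =
      energy x1 y2 + energy y1 x2"
    unfolding energy_def
    by (intro Henstock_Kurzweil_Integration.integral_add integrable_continuous_real inner_orbits_continuous)
  ultimately show ?thesis by simp
qed

text \<open>\<open>energy_generator\<close> says that \<open>A\<close> is skew up to the bounded form on its right-hand side.\<close>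

lemma energy_skew_perturbation:
  obtains Q where "bounded_clinear Q" "\<And>x y. energy (Q x) y = energy x (Q y)"
    "\<And>x1 y1 x2 y2. (x1, y1) \<in> generator T \<Longrightarrow> (x2, y2) \<in> generator T \<Longrightarrow>
      energy y1 x2 + energy x1 y2 = - 2 * energy (Q x1) x2"
proof -
  obtain m where m: "0 < m" "\<And>x. m * (norm x)\<^sup>2 \<le> energy x x" using energy_coercive by blast
  \<comment> \<open>Minus one half of the right-hand side of \<open>energy_generator\<close>; the
    half appears because \<open>A\<close> occurs there in both arguments.\<close>
  define g where "g x y = (inner x y - inner (T 1 x) (T 1 y)) / 2" for x y
  have T1: "bounded_linear (T 1)" by (rule C0_linear[OF T]) simp
  interpret T1: bounded_linear "T 1" by (rule T1)
  have "bounded_bilinear (\<lambda>x y. inner (T 1 x) (T 1 y))"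
    by (rule bounded_bilinear.comp[OF bounded_bilinear_inner T1 T1])
  from bounded_bilinear_half_diff[OF bounded_bilinear_inner this]
  have g: "bounded_bilinear g" by (simp add: g_def[abs_def])
  have gi: "g (scaleC \<i> x) (scaleC \<i> y) = g x y" for x y
    by (simp add: g_def bounded_clinearD(2)[OF C0_clinear[OF T]] inner_scaleC_i)
  obtain Q where Q: "bounded_clinear Q" "\<And>x y. energy (Q x) y = g x y"
    using form_operator[OF energy_bounded_bilinear energy_commute m energy_scaleC_i g gi] by blast
  have "energy (Q x) y = energy x (Q y)" for x y
    by (simp add: Q energy_commute[of x "Q y"]) (simp add: g_def inner_commute)
  moreover have "energy y1 x2 + energy x1 y2 = - 2 * energy (Q x1) x2"
    if "(x1, y1) \<in> generator T" "(x2, y2) \<in> generator T" for x1 y1 x2 y2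
    using energy_generator[OF that] by (simp add: Q g_def)
  ultimately show ?thesis using that Q(1) by blast
qed

lemma exists_isometric_perturbation:
  obtains Q ip V where "bounded_clinear Q" "equivalent_inner_product ip" "C0_semigroup V"
    "generator V = plus_bounded (generator T) Q"
    "\<And>t x. 0 \<le> t \<Longrightarrow> ip_norm ip (V t x) = ip_norm ip x"
proof -
  interpret energy: bounded_bilinear energy by (rule energy_bounded_bilinear)
  obtain m where m: "0 < m" "\<And>x. m * (norm x)\<^sup>2 \<le> energy x x" using energy_coercive by blast
  obtain Q where Q: "bounded_clinear Q" "\<And>x y. energy (Q x) y = energy x (Q y)"
    "\<And>x1 y1 x2 y2. (x1, y1) \<in> generator T \<Longrightarrow> (x2, y2) \<in> generator T \<Longrightarrow>
      energy y1 x2 + energy x1 y2 = - 2 * energy (Q x1) x2"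
    using energy_skew_perturbation by blast
  obtain V where V: "C0_semigroup V" "generator V = plus_bounded (generator T) Q"
    using bounded_perturbation[OF T Q(1)] by blast
  \<comment> \<open>A complex inner product that is linear in its first argument satisfies Im <x, y>
    = Re <x, iy>, so the real form determines it.\<close>
  define ip where "ip x y = Complex (energy x y) (energy x (scaleC \<i> y))" for x y
  have pos: "0 \<le> energy x x" for x
    using m(1) by (intro order_trans[OF _ m(2)]) simp
  have i_left: "energy (scaleC \<i> x) y = - energy x (scaleC \<i> y)" for x y
    using energy_scaleC_i[of x "scaleC \<i> y"] by (simp add: scaleC_i_i energy.minus_right)
  have "inner_product_on scaleC UNIV ip"
    unfolding inner_product_on_def
  proof (intro conjI ballI allI impI)
    show "ip (x + y) z = ip x z + ip y z" for x y z
      by (simp add: ip_def complex_eq_iff energy.add_left)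
    show "ip (scaleC c x) y = c * ip x y" for c x y
      by (subst scaleC_eq) (simp add: ip_def complex_eq_iff energy.add_left energy.scaleR_left i_left
          scaleC_i_i energy.minus_right)
    show "ip y x = cnj (ip x y)" for x y
      by (simp add: ip_def complex_eq_iff energy_commute[of y] i_left)
    show "0 < Re (ip x x)" if "x \<noteq> 0" for x
    proof -
      have "0 < m * (norm x)\<^sup>2" using m(1) that by simp
      then show ?thesis using m(2)[of x] by (simp add: ip_def)
    qed
  qed
  moreover have "\<exists>m>0. \<exists>M>0. \<forall>x. m * norm x \<le> ip_norm ip x \<and> ip_norm ip x \<le> M * norm x"
  proof -
    obtain K where K: "0 < K" "\<And>x y. norm (energy x y) \<le> norm x * norm y * K"
      using energy.pos_bounded by blast
    have "sqrt m * norm x \<le> ip_norm ip x" for x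
      using real_sqrt_le_mono[OF m(2)[of x]] by (simp add: ip_norm_def ip_def real_sqrt_mult)
    moreover have "ip_norm ip x \<le> sqrt K * norm x" for x
      using real_sqrt_le_mono[of "energy x x" "norm x * norm x * K"] K(2)[of x x]
      by (simp add: ip_norm_def ip_def real_sqrt_mult mult.commute)
    ultimately show ?thesis using K(1) m(1)
      by (intro exI[of _ "sqrt m"] exI[of _ "sqrt K"] conjI) auto
  qed
  ultimately have "equivalent_inner_product ip" by (simp add: equivalent_inner_product_def)
  moreover have "energy (V t x) (V t x) = energy x x" if t: "0 \<le> t" for t x
  proof (rule C0_generator_dense_induct[OF V(1), where P = "\<lambda>x. energy (V t x) (V t x) = energy x x"])
    have "continuous_on UNIV (V t)" by (rule linear_continuous_on[OF C0_linear[OF V(1) t]])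
    then show "closed {x. energy (V t x) (V t x) = energy x x}"
      by (intro closed_Collect_eq continuous_intros energy.continuous_on) auto
    fix x y assume xy: "(x, y) \<in> generator V"
    have "((\<lambda>t. energy (V t x) (V t x)) has_vector_derivative 0) (at t within {0..})" if t: "0 \<le> t" for t
    proof -
      obtain y' where y': "(V t x, y') \<in> generator T" "V t y = y' + Q (V t x)"
        using C0_generator_invariant[OF V(1) xy t] V(2) by (auto simp: plus_bounded_def)
      have "energy (V t x) (V t y) + energy (V t y) (V t x) = 0"
        using Q(3)[OF y'(1) y'(1)]
        by (simp add: y'(2) energy.add_left energy.add_right energy_commute[of "V t x"])
      then show ?thesis
        using energy.has_vector_derivative[OF C0_derivative[OF V(1) xy t] C0_derivative[OF V(1) xy t]]
        by simp
    qed
    from zero_vector_derivative_constant[OF this t]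
    show "energy (V t x) (V t x) = energy x x" by (simp add: C0_zero[OF V(1)])
  qed
  then have "ip_norm ip (V t x) = ip_norm ip x" if "0 \<le> t" for t x
    using that by (simp add: ip_norm_def ip_def)
  ultimately show ?thesis using that Q(1) V by blast
qed

lemma exists_left_inverse_semigroup:
  obtains L where "left_inverse_semigroup L T"
proof -
  interpret energy: bounded_bilinear energy by (rule energy_bounded_bilinear)
  obtain m where m: "0 < m" "\<And>x. m * (norm x)\<^sup>2 \<le> energy x x" using energy_coercive by blast
  obtain Q where Q: "bounded_clinear Q" "\<And>x y. energy (Q x) y = energy x (Q y)"
    "\<And>x1 y1 x2 y2. (x1, y1) \<in> generator T \<Longrightarrow> (x2, y2) \<in> generator T \<Longrightarrow>
      energy y1 x2 + energy x1 y2 = - 2 * energy (Q x1) x2"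
    using energy_skew_perturbation by blast
  \<comment> \<open>\<open>A + Q\<close> is skew for the energy, so formally the adjoint of
    \<open>A\<close> is \<open>- (A + 2 Q)\<close>. Perturbing by \<open>2 Q\<close> therefore
    produces the semigroup that undoes \<open>T\<close> under the form.\<close>
  have "bounded_clinear (\<lambda>x. 2 *\<^sub>R Q x)"
    by (intro bounded_clinearI bounded_linear_compose[OF bounded_linear_scaleR_right] bounded_clinearD(1)[OF Q(1)])
      (simp add: bounded_clinearD(2)[OF Q(1)] scaleC_scaleR)
  then obtain H where H: "C0_semigroup H" "generator H = plus_bounded (generator T) (\<lambda>x. 2 *\<^sub>R Q x)"
    using bounded_perturbation[OF T] by blast
  \<comment> \<open>The derivative involves both generators, so density is used twice, once in each
    argument.\<close>
  have dual: "energy (T t x) (H t z) = energy x z" if t: "0 \<le> t" for t x z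
  proof (rule C0_generator_dense_induct[OF T, where P = "\<lambda>x. energy (T t x) (H t z) = energy x z"])
    have cT: "continuous_on UNIV (T t)" and cH: "continuous_on UNIV (H t)"
      using linear_continuous_on C0_linear T H(1) t by blast+
    then show "closed {x. energy (T t x) (H t z) = energy x z}"
      by (intro closed_Collect_eq continuous_intros energy.continuous_on) auto
    fix x y assume xy: "(x, y) \<in> generator T"
    show "energy (T t x) (H t z) = energy x z"
    proof (rule C0_generator_dense_induct[OF H(1), where P = "\<lambda>z. energy (T t x) (H t z) = energy x z"])
      show "closed {z. energy (T t x) (H t z) = energy x z}"
        using cH by (intro closed_Collect_eq continuous_intros energy.continuous_on) auto
      fix z w assume zw: "(z, w) \<in> generator H"
      have "((\<lambda>t. energy (T t x) (H t z)) has_vector_derivative 0) (at t within {0..})" if t: "0 \<le> t" for t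
      proof -
        obtain w' where w': "(H t z, w') \<in> generator T" "H t w = w' + 2 *\<^sub>R Q (H t z)"
          using C0_generator_invariant[OF H(1) zw t] H(2) by (auto simp: plus_bounded_def)
        have "energy (T t x) (H t w) + energy (T t y) (H t z) = 0"
          using Q(3)[OF C0_generator_invariant[OF T xy t] w'(1)]
          by (simp add: w'(2) energy.add_right energy.scaleR_right Q(2))
        then show ?thesis
          using energy.has_vector_derivative[OF C0_derivative[OF T xy t] C0_derivative[OF H(1) zw t]]
          by simp
      qed
      from zero_vector_derivative_constant[OF this t]
      show "energy (T t x) (H t z) = energy x z" by (simp add: C0_zero[OF H(1)] C0_zero[OF T])
    qed
  qed
  have "\<exists>L. 0 \<le> t \<longrightarrow> bounded_clinear L \<and> (\<forall>x y. energy (L x) y = energy x (H t y))" for t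
  proof (cases "0 \<le> t")
    case True
    have "bounded_bilinear (\<lambda>x y. energy x (H t y))"
      by (rule bounded_bilinear.comp[OF energy_bounded_bilinear bounded_linear_ident C0_linear[OF H(1) True]])
    then show ?thesis
      using form_operator[OF energy_bounded_bilinear energy_commute m energy_scaleC_i, of "\<lambda>x y. energy x (H t y)"]
        bounded_clinearD(2)[OF C0_clinear[OF H(1) True]] energy_scaleC_i by metis
  qed auto
  then obtain L where L: "\<And>t. 0 \<le> t \<Longrightarrow> bounded_clinear (L t)"
    "\<And>t x y. 0 \<le> t \<Longrightarrow> energy (L t x) y = energy x (H t y)" by metis
  have eqI: "z = z'" if "\<And>y. energy z y = energy z' y" for z z'
  proof -
    have "m * (norm (z - z'))\<^sup>2 \<le> 0"
      using m(2)[of "z - z'"] that[of "z - z'"] by (simp add: energy.diff_left)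
    then show ?thesis using m(1) by (simp add: mult_le_0_iff)
  qed
  have LT: "L t (T t x) = x" if "0 \<le> t" for t x
    by (rule eqI) (simp add: L(2) that dual)
  have L0: "L 0 x = x" for x by (rule eqI) (simp add: L(2) C0_zero[OF H(1)])
  have Ladd: "L (s + t) x = L s (L t x)" if "0 \<le> s" "0 \<le> t" for s t x
    by (rule eqI) (use that C0_add[OF H(1), of t s] in \<open>simp add: L(2) add.commute\<close>)
  have Lbound: "\<exists>K>0. \<forall>t x. 0 \<le> t \<longrightarrow> t \<le> R \<longrightarrow> norm (L t x) \<le> K * norm x" for R
  proof -
    obtain K where K: "0 < K" "\<And>t x. 0 \<le> t \<Longrightarrow> t \<le> R \<Longrightarrow> norm (H t x) \<le> K * norm x"
      using C0_locally_bounded[OF H(1)] by blast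
    obtain B where B: "0 < B" "\<And>x y. norm (energy x y) \<le> norm x * norm y * B"
      using energy.pos_bounded by blast
    have "norm (L t x) \<le> (B * K / m) * norm x" if t: "0 \<le> t" "t \<le> R" for t x
    proof (cases "L t x = 0")
      case True
      then show ?thesis using B K m by simp
    next
      case False
      have "m * (norm (L t x))\<^sup>2 \<le> energy x (H t (L t x))"
        using m(2)[of "L t x"] t by (simp add: L(2))
      also have "\<dots> \<le> norm x * norm (H t (L t x)) * B" using B(2)[of x "H t (L t x)"] by simp
      also have "\<dots> \<le> norm x * (K * norm (L t x)) * B"
        using B by (intro mult_right_mono mult_left_mono K(2) t) auto
      finally have "norm (L t x) * (m * norm (L t x)) \<le> norm (L t x) * (norm x * K * B)"
        by (simp add: power2_eq_square mult_ac)
      then have "m * norm (L t x) \<le> norm x * K * B" using False by simp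
      then show ?thesis using m(1) by (simp add: field_simps)
    qed
    then show ?thesis using B K m by (intro exI[of _ "B * K / m"]) auto
  qed
  have "continuous_on {0..R} (\<lambda>t. L t x)" for R x
  proof -
    obtain K where K: "0 < K" "\<And>t x. 0 \<le> t \<Longrightarrow> t \<le> R \<Longrightarrow> norm (L t x) \<le> K * norm x"
      using Lbound[of R] by blast
    have *: "norm (L t x - L s x) \<le> K * (K * norm (T \<bar>t - s\<bar> x - x))" if "0 \<le> s" "s \<le> t" "t \<le> R" for s t
    proof -
      have s: "0 \<le> s" "0 \<le> t - s" using that by auto
      interpret Ls: bounded_linear "L s" by (rule bounded_clinearD(1)[OF L(1)[OF s(1)]])
      interpret Lts: bounded_linear "L (t - s)" by (rule bounded_clinearD(1)[OF L(1)[OF s(2)]])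
      have "L t x - L s x = L s (L (t - s) x - x)"
        using Ladd[OF s, of x] by (simp add: Ls.diff)
      also have "L (t - s) x - x = L (t - s) (x - T (t - s) x)" using LT[OF s(2), of x] by (simp add: Lts.diff)
      finally have "norm (L t x - L s x) \<le> K * norm (L (t - s) (x - T (t - s) x))"
        using that by (simp add: K(2))
      also have "\<dots> \<le> K * (K * norm (x - T (t - s) x))"
        using that K by (intro mult_left_mono K(2)) auto
      finally show ?thesis using that by (simp add: norm_minus_commute)
    qed
    show ?thesis
      unfolding continuous_on_def
    proof
      fix t assume t: "t \<in> {0..R}"
      have "((\<lambda>s. L s x - L t x) \<longlongrightarrow> 0) (at t within {0..R})"
      proof (rule Lim_null_comparison)
        show "\<forall>\<^sub>F s in at t within {0..R}. norm (L s x - L t x) \<le> K * (K * norm (T \<bar>s - t\<bar> x - x))"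
          unfolding eventually_at_filter
        proof (intro eventuallyI impI)
          fix s assume s: "s \<in> {0..R}"
          show "norm (L s x - L t x) \<le> K * (K * norm (T \<bar>s - t\<bar> x - x))"
          proof (cases "s \<le> t")
            case True
            then show ?thesis using *[of s t] s t by (simp add: norm_minus_commute abs_minus_commute)
          next
            case False
            then show ?thesis using *[of t s] s t by simp
          qed
        qed
        have "continuous_on UNIV (\<lambda>s. T \<bar>s - t\<bar> x)"
          by (intro C0_continuous_compose[OF T] continuous_intros) auto
        then have "((\<lambda>s. T \<bar>s - t\<bar> x) \<longlongrightarrow> T \<bar>t - t\<bar> x) (at t)"
          unfolding continuous_on_def by blast
        then have "((\<lambda>s. T \<bar>s - t\<bar> x) \<longlongrightarrow> T \<bar>t - t\<bar> x) (at t within {0..R})"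
          by (rule tendsto_within_subset) simp
        then have "((\<lambda>s. T \<bar>s - t\<bar> x) \<longlongrightarrow> x) (at t within {0..R})"
          by (simp add: C0_zero[OF T])
        then show "((\<lambda>s. K * (K * norm (T \<bar>s - t\<bar> x - x))) \<longlongrightarrow> 0) (at t within {0..R})"
          by (intro tendsto_mult_right_zero tendsto_norm_zero) (simp add: LIM_zero)
      qed
      then show "((\<lambda>s. L s x) \<longlongrightarrow> L t x) (at t within {0..R})" by (simp add: LIM_zero_cancel)
    qed
  qed
  then have "C0_semigroup L"
    unfolding C0_semigroup_def using L(1) L0 Ladd continuous_on_atLeast_of_Icc by blast
  then show ?thesis using that LT by (auto simp: left_inverse_semigroup_def)
qed

end

section \<open>Square summable sequences\<close>

typedef (overloaded) 'a l2 = "{f :: nat \<Rightarrow> 'a::complex_hilbert_space. summable (\<lambda>n. (norm (f n))\<^sup>2)}"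
  morphisms l2_nth l2_of
  by (rule exI[of _ "\<lambda>_. 0"]) simp

setup_lifting type_definition_l2

lemma l2_nth_summable: "summable (\<lambda>n. (norm (l2_nth f n))\<^sup>2)"
  using l2_nth[of f] by simp

lemma l2_eqI: "(\<And>n. l2_nth f n = l2_nth g n) \<Longrightarrow> f = g"
  by (auto simp: l2_nth_inject[symmetric])

lemma summable_norm_power2_add:
  fixes f g :: "nat \<Rightarrow> 'a::real_normed_vector"
  assumes "summable (\<lambda>n. (norm (f n))\<^sup>2)" "summable (\<lambda>n. (norm (g n))\<^sup>2)"
  shows "summable (\<lambda>n. (norm (f n + g n))\<^sup>2)"
proof (rule summable_comparison_test')
  show "summable (\<lambda>n. 2 * (norm (f n))\<^sup>2 + 2 * (norm (g n))\<^sup>2)"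
    by (intro summable_add summable_mult assms)
  fix n
  have "(norm (f n + g n))\<^sup>2 \<le> (norm (f n) + norm (g n))\<^sup>2"
    by (intro power_mono norm_triangle_ineq) simp
  also have "\<dots> \<le> 2 * (norm (f n))\<^sup>2 + 2 * (norm (g n))\<^sup>2"
    using sum_squares_bound[of "norm (f n)" "norm (g n)"] by (simp add: power2_sum)
  finally show "norm ((norm (f n + g n))\<^sup>2) \<le> 2 * (norm (f n))\<^sup>2 + 2 * (norm (g n))\<^sup>2" by simp
qed

instantiation l2 :: (complex_hilbert_space) real_vector
begin

lift_definition zero_l2 :: "'a l2" is "\<lambda>_. 0" by simp
lift_definition plus_l2 :: "'a l2 \<Rightarrow> 'a l2 \<Rightarrow> 'a l2" is "\<lambda>f g n. f n + g n"
  by (rule summable_norm_power2_add)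
lift_definition uminus_l2 :: "'a l2 \<Rightarrow> 'a l2" is "\<lambda>f n. - f n" by simp
lift_definition minus_l2 :: "'a l2 \<Rightarrow> 'a l2 \<Rightarrow> 'a l2" is "\<lambda>f g n. f n - g n"
  using summable_norm_power2_add[of _ "\<lambda>n. - g n" for g] by fastforce
lift_definition scaleR_l2 :: "real \<Rightarrow> 'a l2 \<Rightarrow> 'a l2" is "\<lambda>r f n. r *\<^sub>R f n"
  by (auto simp: power_mult_distrib intro: summable_mult)

instance
  by standard (transfer; simp add: algebra_simps fun_eq_iff)+

end

lemma l2_nth_simps [simp]:
  "l2_nth 0 n = 0" "l2_nth (f + g) n = l2_nth f n + l2_nth g n" "l2_nth (- f) n = - l2_nth f n"
  "l2_nth (f - g) n = l2_nth f n - l2_nth g n" "l2_nth (r *\<^sub>R f) n = r *\<^sub>R l2_nth f n"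
  by (transfer; simp)+

lemma summable_inner_l2: "summable (\<lambda>n. inner (l2_nth f n) (l2_nth g n))"
proof (rule summable_comparison_test')
  show "summable (\<lambda>n. (norm (l2_nth f n))\<^sup>2 + (norm (l2_nth g n))\<^sup>2)"
    by (intro summable_add l2_nth_summable)
  fix n
  have "\<bar>inner (l2_nth f n) (l2_nth g n)\<bar> \<le> norm (l2_nth f n) * norm (l2_nth g n)"
    by (rule Cauchy_Schwarz_ineq2)
  also have "\<dots> \<le> (norm (l2_nth f n))\<^sup>2 + (norm (l2_nth g n))\<^sup>2"
    using sum_squares_bound[of "norm (l2_nth f n)" "norm (l2_nth g n)"]
      mult_nonneg_nonneg[OF norm_ge_zero[of "l2_nth f n"] norm_ge_zero[of "l2_nth g n"]] by linarith
  finally show "norm (inner (l2_nth f n) (l2_nth g n)) \<le> (norm (l2_nth f n))\<^sup>2 + (norm (l2_nth g n))\<^sup>2"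
    by simp
qed

instantiation l2 :: (complex_hilbert_space) real_inner
begin

definition inner_l2 :: "'a l2 \<Rightarrow> 'a l2 \<Rightarrow> real" where
  "inner_l2 f g = (\<Sum>n. inner (l2_nth f n) (l2_nth g n))"
definition norm_l2 :: "'a l2 \<Rightarrow> real" where "norm_l2 f = sqrt (inner f f)"
definition dist_l2 :: "'a l2 \<Rightarrow> 'a l2 \<Rightarrow> real" where "dist_l2 f g = norm (f - g)"
definition sgn_l2 :: "'a l2 \<Rightarrow> 'a l2" where "sgn_l2 f = inverse (norm f) *\<^sub>R f"
definition uniformity_l2 :: "('a l2 \<times> 'a l2) filter" where
  "uniformity_l2 = (INF e\<in>{0<..}. principal {(x, y). dist x y < e})"
definition open_l2 :: "'a l2 set \<Rightarrow> bool" where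
  "open_l2 U = (\<forall>x\<in>U. eventually (\<lambda>(x', y). x' = x \<longrightarrow> y \<in> U) uniformity)"

instance
proof
  fix f g h :: "'a l2" and r :: real
  show "inner f g = inner g f" by (simp add: inner_l2_def inner_commute)
  show "inner (f + g) h = inner f h + inner g h"
    by (simp add: inner_l2_def inner_add_left suminf_add summable_inner_l2)
  show "inner (r *\<^sub>R f) g = r * inner f g"
    by (simp add: inner_l2_def suminf_mult summable_inner_l2)
  show "0 \<le> inner f f"
    unfolding inner_l2_def by (intro suminf_nonneg summable_inner_l2) simp
  show "inner f f = 0 \<longleftrightarrow> f = 0"
  proof
    assume "inner f f = 0"
    then have "\<forall>n. inner (l2_nth f n) (l2_nth f n) = 0"
      unfolding inner_l2_def using suminf_eq_zero_iff[OF summable_inner_l2[of f f]] by simp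
    then show "f = 0" by (intro l2_eqI) simp
  qed (simp add: inner_l2_def)
qed (rule dist_l2_def sgn_l2_def uniformity_l2_def open_l2_def norm_l2_def)+

end

lemma l2_norm_power2: "(norm f)\<^sup>2 = (\<Sum>n. (norm (l2_nth f n))\<^sup>2)"
  by (simp add: power2_norm_eq_inner inner_l2_def)

lemma l2_sum_le_norm: "finite A \<Longrightarrow> (\<Sum>n\<in>A. (norm (l2_nth f n))\<^sup>2) \<le> (norm f)\<^sup>2"
  unfolding l2_norm_power2 by (intro sum_le_suminf l2_nth_summable) auto

lemma l2_nth_norm_le: "norm (l2_nth f n) \<le> norm f"
proof (rule power2_le_imp_le)
  show "(norm (l2_nth f n))\<^sup>2 \<le> (norm f)\<^sup>2" using l2_sum_le_norm[of "{n}" f] by simp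
qed simp

text \<open>\<open>l2_of\<close> is meaningful only for square summable sequences. A uniform bound
  on partial sums provides membership and norm bound together.\<close>

lemma l2_of_bounded:
  assumes K: "0 \<le> K" and le: "\<And>N. (\<Sum>n<N. (norm (f n))\<^sup>2) \<le> K\<^sup>2"
  shows "l2_nth (l2_of f) = f" "norm (l2_of f) \<le> K"
proof -
  have "summable (\<lambda>n. (norm (f n))\<^sup>2)" by (rule summableI_nonneg_bounded[OF _ le]) simp
  then show nth: "l2_nth (l2_of f) = f" by (simp add: l2_of_inverse)
  have "(norm (l2_of f))\<^sup>2 \<le> K\<^sup>2"
    unfolding l2_norm_power2 nth by (rule suminf_le_const) (use le \<open>summable _\<close> in auto)
  then show "norm (l2_of f) \<le> K" using K by (rule power2_le_imp_le)
qed

instance l2 :: (complex_hilbert_space) complete_space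
proof
  fix X :: "nat \<Rightarrow> 'a l2" assume X: "Cauchy X"
  have "Cauchy (\<lambda>i. l2_nth (X i) n)" for n
  proof (rule metric_CauchyI)
    fix e :: real assume "0 < e"
    then obtain M where "\<And>i j. i \<ge> M \<Longrightarrow> j \<ge> M \<Longrightarrow> dist (X i) (X j) < e"
      using metric_CauchyD[OF X] by metis
    moreover have "dist (l2_nth (X i) n) (l2_nth (X j) n) \<le> dist (X i) (X j)" for i j
      using l2_nth_norm_le[of "X i - X j" n] by (simp add: dist_norm)
    ultimately show "\<exists>M. \<forall>i\<ge>M. \<forall>j\<ge>M. dist (l2_nth (X i) n) (l2_nth (X j) n) < e"
      by (meson le_less_trans)
  qed
  then have "\<exists>l. (\<lambda>i. l2_nth (X i) n) \<longlonglongrightarrow> l" for n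
    using Cauchy_convergent_iff convergent_def by blast
  then obtain l where l: "\<And>n. (\<lambda>i. l2_nth (X i) n) \<longlonglongrightarrow> l n" by metis
  \<comment> \<open>The Cauchy estimate for finite partial sums survives the passage
    \<open>j\<close> to infinity; it bounds all of them by \<open>e\<^sup>2\<close>, hence the whole
    difference.\<close>
  have close: "l2_nth (l2_of (\<lambda>n. l2_nth (X i) n - l n)) = (\<lambda>n. l2_nth (X i) n - l n) \<and>
      norm (l2_of (\<lambda>n. l2_nth (X i) n - l n)) \<le> e"
    if e: "0 < e" and M: "\<And>i j. i \<ge> M \<Longrightarrow> j \<ge> M \<Longrightarrow> dist (X i) (X j) < e" and i: "i \<ge> M" for i M and e :: real
  proof -
    have "(\<Sum>n<N. (norm (l2_nth (X i) n - l n))\<^sup>2) \<le> e\<^sup>2" for N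
    proof (rule LIMSEQ_le_const2)
      show "(\<lambda>j. \<Sum>n<N. (norm (l2_nth (X i) n - l2_nth (X j) n))\<^sup>2) \<longlonglongrightarrow> (\<Sum>n<N. (norm (l2_nth (X i) n - l n))\<^sup>2)"
        by (intro tendsto_intros l)
      have "(\<Sum>n<N. (norm (l2_nth (X i) n - l2_nth (X j) n))\<^sup>2) \<le> e\<^sup>2" if "j \<ge> M" for j
      proof -
        have "(norm (X i - X j))\<^sup>2 \<le> e\<^sup>2"
          using M[OF i that] by (intro power_mono) (auto simp: dist_norm)
        then show ?thesis using l2_sum_le_norm[of "{..<N}" "X i - X j"] by simp
      qed
      then show "\<exists>M. \<forall>j\<ge>M. (\<Sum>n<N. (norm (l2_nth (X i) n - l2_nth (X j) n))\<^sup>2) \<le> e\<^sup>2" by blast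
    qed
    then show ?thesis using l2_of_bounded[of e "\<lambda>n. l2_nth (X i) n - l n"] e by auto
  qed
  obtain M0 where M0: "\<And>i j. i \<ge> M0 \<Longrightarrow> j \<ge> M0 \<Longrightarrow> dist (X i) (X j) < 1"
    using metric_CauchyD[OF X, of 1] by auto
  \<comment> \<open>Square summability is so far known for the difference from \<open>l\<close>
    only, so the limit is reached from \<open>X M0\<close>.\<close>
  define L where "L = X M0 - l2_of (\<lambda>n. l2_nth (X M0) n - l n)"
  have L: "l2_nth L n = l n" for n
    using close[of 1 M0 M0] M0 by (simp add: L_def)
  have "X \<longlonglongrightarrow> L"
  proof (rule LIMSEQ_I)
    fix e :: real assume e: "0 < e"
    obtain M where M: "\<And>i j. i \<ge> M \<Longrightarrow> j \<ge> M \<Longrightarrow> dist (X i) (X j) < e / 2"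
      using metric_CauchyD[OF X, of "e / 2"] e by auto
    have "norm (X i - L) < e" if i: "i \<ge> M" for i
    proof -
      have c: "l2_nth (l2_of (\<lambda>n. l2_nth (X i) n - l n)) = (\<lambda>n. l2_nth (X i) n - l n) \<and>
          norm (l2_of (\<lambda>n. l2_nth (X i) n - l n)) \<le> e / 2"
        by (rule close[OF _ M i]) (use e in auto)
      then have "X i - L = l2_of (\<lambda>n. l2_nth (X i) n - l n)" by (intro l2_eqI) (simp add: L)
      then show ?thesis using c e by simp
    qed
    then show "\<exists>M. \<forall>i\<ge>M. norm (X i - L) < e" by blast
  qed
  then show "convergent X" by (auto simp: convergent_def)
qed

instantiation l2 :: (complex_hilbert_space) complex_hilbert_space
begin

lift_definition scaleC_l2 :: "complex \<Rightarrow> 'a l2 \<Rightarrow> 'a l2" is "\<lambda>c f n. scaleC c (f n)"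
proof -
  fix c :: complex and f :: "nat \<Rightarrow> 'a"
  assume f: "summable (\<lambda>n. (norm (f n))\<^sup>2)"
  have "summable (\<lambda>n. (norm (Re c *\<^sub>R f n + Im c *\<^sub>R scaleC \<i> (f n)))\<^sup>2)"
    using f by (intro summable_norm_power2_add)
      (auto simp: power_mult_distrib norm_scaleC_i intro: summable_mult)
  then show "summable (\<lambda>n. (norm (scaleC c (f n)))\<^sup>2)"
    by (simp add: scaleC_eq[symmetric])
qed

text \<open>The imaginary part is recovered from the real inner product, which avoids a second
  series.\<close>

definition cinner_l2 :: "'a l2 \<Rightarrow> 'a l2 \<Rightarrow> complex" where
  "cinner_l2 f g = Complex (inner f g) (inner f (scaleC \<i> g))"

instance
proof
  fix f g h :: "'a l2" and c d :: complex and r :: real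
  show add_right: "scaleC c (f + g) = scaleC c f + scaleC c g" for c and f g :: "'a l2"
    by transfer (simp add: scaleC_add_right)
  show add_left: "scaleC (c + d) f = scaleC c f + scaleC d f" for c d
    by transfer (simp add: scaleC_add_left)
  show mult: "scaleC c (scaleC d f) = scaleC (c * d) f" for c d and f :: "'a l2"
    by transfer (simp add: scaleC_scaleC)
  show of_real: "scaleC (complex_of_real r) f = r *\<^sub>R f" for r and f :: "'a l2"
    by transfer (simp add: scaleC_of_real)
  show "cinner (f + g) h = cinner f h + cinner g h"
    by (simp add: cinner_l2_def complex_eq_iff inner_add_left)
  have inner_i: "inner (scaleC \<i> f) (scaleC \<i> g) = inner f g" for f g :: "'a l2"
    unfolding inner_l2_def by transfer (simp add: inner_scaleC_i)
  have i_i: "scaleC \<i> (scaleC \<i> f) = - f" for f :: "'a l2"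
    using of_real[of "-1" f] by (simp add: mult)
  have i_left: "inner (scaleC \<i> f) g = - inner f (scaleC \<i> g)" for f g :: "'a l2"
    using inner_i[of f "scaleC \<i> g"] by (simp add: i_i)
  have eq: "scaleC c f = Re c *\<^sub>R f + Im c *\<^sub>R scaleC \<i> f" for c and f :: "'a l2"
    by transfer (metis scaleC_eq)
  show "cinner (scaleC c f) g = c * cinner f g"
    unfolding eq[of c] by (simp add: cinner_l2_def complex_eq_iff inner_add_left i_left i_i)
  show "cinner g f = cnj (cinner f g)"
    by (simp add: cinner_l2_def complex_eq_iff inner_commute[of g] i_left)
  show "Re (cinner f g) = inner f g" by (simp add: cinner_l2_def)
qed

end

lemma l2_nth_scaleC [simp]: "l2_nth (scaleC c f) n = scaleC c (l2_nth f n)"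
  by transfer simp

section \<open>Weighted shifts and Neumann series\<close>

definition l2_op :: "(nat \<Rightarrow> 'a \<Rightarrow> 'a) \<Rightarrow> (nat \<Rightarrow> nat) \<Rightarrow> 'a l2 \<Rightarrow> 'a::complex_hilbert_space l2" where
  "l2_op A \<sigma> f = l2_of (\<lambda>n. A n (l2_nth f (\<sigma> n)))"

text \<open>\<open>D\<close> collects the indices that matter, and \<open>\<sigma>\<close> has to be
  injective there only. This admits the right shift \<open>\<lambda>n. n - 1\<close>, which sends 0
  and 1 to the same index but has the zero operator at 0.\<close>

lemma l2_op:
  assumes A: "\<And>n. bounded_clinear (A n)" and K: "\<And>n x. norm (A n x) \<le> K * norm x" "0 \<le> K"
    and inj: "inj_on \<sigma> D" and D: "\<And>n x. n \<notin> D \<Longrightarrow> A n x = 0"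
  shows l2_nth_l2_op: "l2_nth (l2_op A \<sigma> f) n = A n (l2_nth f (\<sigma> n))"
    and norm_l2_op: "norm (l2_op A \<sigma> f) \<le> K * norm f"
    and bounded_clinear_l2_op: "bounded_clinear (l2_op A \<sigma>)"
proof -
  have le: "(\<Sum>n<N. (norm (A n (l2_nth f (\<sigma> n))))\<^sup>2) \<le> (K * norm f)\<^sup>2" for f N
  proof -
    have "(\<Sum>n<N. (norm (A n (l2_nth f (\<sigma> n))))\<^sup>2) = (\<Sum>n\<in>{..<N} \<inter> D. (norm (A n (l2_nth f (\<sigma> n))))\<^sup>2)"
      by (rule sum.mono_neutral_right) (auto simp: D)
    also have "\<dots> \<le> (\<Sum>n\<in>{..<N} \<inter> D. K\<^sup>2 * (norm (l2_nth f (\<sigma> n)))\<^sup>2)"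
      unfolding power_mult_distrib[symmetric] by (intro sum_mono power_mono K) auto
    also have "\<dots> = K\<^sup>2 * (\<Sum>n\<in>\<sigma> ` ({..<N} \<inter> D). (norm (l2_nth f n))\<^sup>2)"
      using inj by (subst sum.reindex) (auto simp: sum_distrib_left intro: inj_on_subset)
    also have "\<dots> \<le> K\<^sup>2 * (norm f)\<^sup>2"
      by (intro mult_left_mono l2_sum_le_norm) auto
    finally show ?thesis by (simp add: power_mult_distrib)
  qed
  have nth: "l2_nth (l2_op A \<sigma> f) n = A n (l2_nth f (\<sigma> n))" for f n
    unfolding l2_op_def by (subst l2_of_bounded(1)[OF _ le]) (use K in auto)
  have nrm: "norm (l2_op A \<sigma> f) \<le> K * norm f" for f
    unfolding l2_op_def by (rule l2_of_bounded(2)[OF _ le]) (use K in auto)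
  show "l2_nth (l2_op A \<sigma> f) n = A n (l2_nth f (\<sigma> n))" by (rule nth)
  show "norm (l2_op A \<sigma> f) \<le> K * norm f" by (rule nrm)
  show "bounded_clinear (l2_op A \<sigma>)"
  proof (rule bounded_clinearI)
    show "bounded_linear (l2_op A \<sigma>)"
      by (rule bounded_linear_intro[of _ K])
        (auto intro!: l2_eqI nrm[THEN order_trans] simp: nth linear_simps[OF bounded_clinearD(1)[OF A]] mult.commute)
    show "l2_op A \<sigma> (scaleC \<i> f) = scaleC \<i> (l2_op A \<sigma> f)" for f
      by (rule l2_eqI) (simp add: nth bounded_clinearD(2)[OF A])
  qed
qed

text \<open>The inverse of \<open>1 - G\<close> is taken from Banach's fixed point theorem for
  \<open>r = x + G r\<close>; uniqueness of the fixed point makes it linear.\<close>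

lemma Neumann_inverse:
  fixes G :: "'a::complex_hilbert_space \<Rightarrow> 'a"
  assumes G: "bounded_clinear G" and q: "0 \<le> q" "q < 1" "\<And>x. norm (G x) \<le> q * norm x"
  obtains R where "bounded_clinear R" "\<And>x. R x - G (R x) = x" "\<And>x. R (x - G x) = x"
    "\<And>x. norm (R x) \<le> norm x / (1 - q)"
proof -
  interpret G: bounded_linear G using G by (rule bounded_clinearD)
  have "\<exists>!r. x + G r = r" for x
    by (rule banach_fix_type[of q]) (use q in \<open>auto simp: dist_norm G.diff[symmetric]\<close>)
  then obtain R where R: "\<And>x. x + G (R x) = R x" by metis
  have uniq: "r = R x" if "x + G r = r" for x r
    using \<open>\<exists>!r. x + G r = r\<close> R that by blast
  have bound: "norm (R x) \<le> norm x / (1 - q)" for x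
  proof -
    have "norm (R x) \<le> norm x + q * norm (R x)"
      using norm_triangle_ineq[of x "G (R x)"] q(3)[of "R x"] by (simp add: R)
    then show ?thesis using q by (simp add: field_simps)
  qed
  have "bounded_clinear R"
  proof (rule bounded_clinearI)
    show "bounded_linear R"
    proof (rule bounded_linear_intro[of _ "1 / (1 - q)"])
      show "R (x + y) = R x + R y" for x y
        by (rule uniq[symmetric]) (metis G.add R add.assoc add.left_commute)
      show "R (r *\<^sub>R x) = r *\<^sub>R R x" for r x
        by (rule uniq[symmetric]) (metis G.scaleR R scaleR_add_right)
    qed (use bound in simp)
    show "R (scaleC \<i> x) = scaleC \<i> (R x)" for x
      by (rule uniq[symmetric]) (metis bounded_clinearD(2)[OF G] R scaleC_add_right)
  qed
  moreover have "R x - G (R x) = x" for x using R[of x] by (metis add_diff_cancel_right')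
  moreover have "R (x - G x) = x" for x by (rule uniq[symmetric]) simp
  ultimately show ?thesis using bound that by blast
qed

section \<open>Group extensions\<close>

text \<open>Representing \<open>inner x (E y)\<close> by the coercive form
  \<open>inner (E x) (E y)\<close> makes \<open>E (F x)\<close> the orthogonal projection of
  \<open>x\<close> onto the range of \<open>E\<close>. Pythagoras then gives both norm
  bounds.\<close>

lemma bounded_left_inverse:
  fixes E :: "'a::complex_hilbert_space \<Rightarrow> 'a"
  assumes E: "bounded_clinear E" and d: "0 < d" "\<And>x. d * norm x \<le> norm (E x)"
  obtains F where "bounded_clinear F" "\<And>x. F (E x) = x" "\<And>x. norm (F x) \<le> norm x / d"
    "\<And>x. norm (x - E (F x)) \<le> norm x"
proof -
  interpret E: bounded_linear E using E by (rule bounded_clinearD)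
  have bE: "bounded_bilinear (\<lambda>x y. inner (E x) (E y))" "bounded_bilinear (\<lambda>x y. inner x (E y))"
    using bounded_bilinear.comp[OF bounded_bilinear_inner E.bounded_linear_axioms E.bounded_linear_axioms]
      bounded_bilinear.comp[OF bounded_bilinear_inner bounded_linear_ident E.bounded_linear_axioms]
    by simp_all
  have low: "d\<^sup>2 * (norm x)\<^sup>2 \<le> inner (E x) (E x)" for x
    using d power_mono[OF d(2)[of x], of 2] by (simp add: power_mult_distrib power2_norm_eq_inner)
  obtain F where F: "bounded_clinear F" "\<And>x y. inner (E (F x)) (E y) = inner x (E y)"
    by (rule form_operator[OF bE(1) _ _ low _ bE(2)])
      (use d in \<open>auto simp: inner_commute bounded_clinearD(2)[OF E] inner_scaleC_i\<close>)
  have "F (E x) = x" for x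
  proof -
    have "inner (E (F (E x) - x)) (E y) = 0" for y
      by (simp add: E.diff inner_diff_left F(2))
    from this[of "F (E x) - x"] have "E (F (E x) - x) = 0" by simp
    then show ?thesis using d(2)[of "F (E x) - x"] d(1) by (simp add: mult_le_0_iff)
  qed
  moreover have sq: "(norm (E (F x)))\<^sup>2 + (norm (x - E (F x)))\<^sup>2 = (norm x)\<^sup>2" for x
    using F(2)[of x "F x"]
    by (simp add: power2_norm_eq_inner inner_diff_left inner_diff_right inner_commute[of "E (F x)" x])
  have "norm (E (F x)) \<le> norm x" "norm (x - E (F x)) \<le> norm x" for x
  proof -
    have "(norm (E (F x)))\<^sup>2 \<le> (norm x)\<^sup>2" "(norm (x - E (F x)))\<^sup>2 \<le> (norm x)\<^sup>2"
      using sq[of x] zero_le_power2[of "norm (E (F x))"] zero_le_power2[of "norm (x - E (F x))"]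
      by linarith+
    then show "norm (E (F x)) \<le> norm x" "norm (x - E (F x)) \<le> norm x"
      by (auto elim: power2_le_imp_le)
  qed
  moreover from this(1) have "norm (F x) \<le> norm x / d" for x
    using d(1) order_trans[OF d(2)[of "F x"], of "norm x"] by (simp add: field_simps)
  ultimately show ?thesis using that F(1) by blast
qed

section \<open>The semigroup acting on sequences, and the embedding at index 0\<close>

definition l2_map :: "('a \<Rightarrow> 'a) \<Rightarrow> 'a l2 \<Rightarrow> 'a::complex_hilbert_space l2" where
  "l2_map A = l2_op (\<lambda>_. A) id"

lemma l2_map:
  assumes A: "bounded_clinear A"
  shows l2_nth_l2_map: "l2_nth (l2_map A f) n = A (l2_nth f n)"
    and norm_l2_map: "norm (l2_map A f) \<le> onorm A * norm f"
    and bounded_clinear_l2_map: "bounded_clinear (l2_map A)"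
proof -
  note * = l2_op[of "\<lambda>_. A" "onorm A" id UNIV, OF A onorm[OF bounded_clinearD(1)[OF A]]
      onorm_pos_le[OF bounded_clinearD(1)[OF A]]]
  show "l2_nth (l2_map A f) n = A (l2_nth f n)" "norm (l2_map A f) \<le> onorm A * norm f"
    "bounded_clinear (l2_map A)"
    unfolding l2_map_def using * by auto
qed

text \<open>Continuity of each entry becomes continuity in norm by domination: the terms of the
  squared distance stay below \<open>(2 * K)\<^sup>2 * (norm (l2_nth f n))\<^sup>2\<close>, which is
  summable.\<close>

lemma C0_semigroup_l2_map:
  fixes T :: "real \<Rightarrow> 'a::complex_hilbert_space \<Rightarrow> 'a"
  assumes T: "C0_semigroup T"
  shows "C0_semigroup (\<lambda>t. l2_map (T t))"
  unfolding C0_semigroup_def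
proof (intro conjI allI impI)
  note nth = l2_nth_l2_map[OF C0_clinear[OF T]]
  show "bounded_clinear (l2_map (T t))" if "0 \<le> t" for t
    by (rule bounded_clinear_l2_map[OF C0_clinear[OF T that]])
  show "l2_map (T 0) f = f" for f
    by (rule l2_eqI) (simp add: nth C0_zero[OF T])
  show "l2_map (T (s + t)) f = l2_map (T s) (l2_map (T t) f)" if "0 \<le> s" "0 \<le> t" for s t f
    by (rule l2_eqI) (simp add: nth that C0_add[OF T])
  fix f :: "'a l2"
  have "continuous_on {0..R} (\<lambda>t. l2_map (T t) f)" for R
    unfolding continuous_on_def
  proof
    fix t assume t: "t \<in> {0..R}"
    obtain K where K: "0 < K" "\<And>t x. 0 \<le> t \<Longrightarrow> t \<le> R \<Longrightarrow> norm (T t x) \<le> K * norm x"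
      using C0_locally_bounded[OF T] by blast
    have eq: "(norm (l2_map (T s) f - l2_map (T t) f))\<^sup>2 =
        (\<Sum>n. (norm (T s (l2_nth f n) - T t (l2_nth f n)))\<^sup>2)" if "s \<in> {0..R}" for s
      using that t by (simp add: l2_norm_power2 nth)
    have "uniform_limit {0..R} (\<lambda>N s. \<Sum>n<N. (norm (T s (l2_nth f n) - T t (l2_nth f n)))\<^sup>2)
        (\<lambda>s. \<Sum>n. (norm (T s (l2_nth f n) - T t (l2_nth f n)))\<^sup>2) sequentially"
    proof (rule Weierstrass_m_test)
      fix n s assume s: "s \<in> {0..R}"
      have "norm (T s (l2_nth f n) - T t (l2_nth f n)) \<le> norm (T s (l2_nth f n)) + norm (T t (l2_nth f n))"
        by (rule norm_triangle_ineq4)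
      also have "\<dots> \<le> 2 * K * norm (l2_nth f n)"
        using K(2)[of s "l2_nth f n"] K(2)[of t "l2_nth f n"] s t by simp
      finally have "(norm (T s (l2_nth f n) - T t (l2_nth f n)))\<^sup>2 \<le> (2 * K * norm (l2_nth f n))\<^sup>2"
        by (intro power_mono) auto
      then show "norm ((norm (T s (l2_nth f n) - T t (l2_nth f n)))\<^sup>2) \<le> (2 * K)\<^sup>2 * (norm (l2_nth f n))\<^sup>2"
        by (simp add: power_mult_distrib)
    qed (intro summable_mult l2_nth_summable)
    then have "continuous_on {0..R} (\<lambda>s. \<Sum>n. (norm (T s (l2_nth f n) - T t (l2_nth f n)))\<^sup>2)"
      by (rule uniform_limit_theorem[rotated])
        (auto intro!: always_eventually continuous_intros continuous_on_subset[OF C0_continuous[OF T]])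
    then have "((\<lambda>s. \<Sum>n. (norm (T s (l2_nth f n) - T t (l2_nth f n)))\<^sup>2) \<longlongrightarrow>
        (\<Sum>n. (norm (T t (l2_nth f n) - T t (l2_nth f n)))\<^sup>2)) (at t within {0..R})"
      unfolding continuous_on_def using t by blast
    then have "((\<lambda>s. \<Sum>n. (norm (T s (l2_nth f n) - T t (l2_nth f n)))\<^sup>2) \<longlongrightarrow> 0) (at t within {0..R})"
      by simp
    then have "((\<lambda>s. (norm (l2_map (T s) f - l2_map (T t) f))\<^sup>2) \<longlongrightarrow> 0) (at t within {0..R})"
      by (rule Lim_transform_eventually) (simp add: eventually_at_filter eq)
    from tendsto_real_sqrt[OF this]
    have "((\<lambda>s. l2_map (T s) f - l2_map (T t) f) \<longlongrightarrow> 0) (at t within {0..R})"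
      by (simp add: tendsto_norm_zero_iff)
    then show "((\<lambda>s. l2_map (T s) f) \<longlongrightarrow> l2_map (T t) f) (at t within {0..R})"
      by (simp add: LIM_zero_cancel)
  qed
  then show "continuous_on {0..} (\<lambda>t. l2_map (T t) f)"
    by (rule continuous_on_atLeast_of_Icc)
qed

definition l2_single :: "'a \<Rightarrow> 'a::complex_hilbert_space l2" where
  "l2_single x = l2_of (\<lambda>n. if n = 0 then x else 0)"

lemma l2_nth_single: "l2_nth (l2_single x) n = (if n = 0 then x else 0)"
  and norm_l2_single: "norm (l2_single x) = norm x"
proof -
  have le: "(\<Sum>n<N. (norm (if n = 0 then x else 0))\<^sup>2) \<le> (norm x)\<^sup>2" for N :: nat
  proof -
    have "(\<Sum>n<N. (norm (if n = 0 then x else 0))\<^sup>2) = (\<Sum>n<N. if n = 0 then (norm x)\<^sup>2 else 0)"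
      by (rule sum.cong) auto
    also have "\<dots> \<le> (norm x)\<^sup>2" by (subst sum.delta) auto
    finally show ?thesis .
  qed
  show nth: "l2_nth (l2_single x) n = (if n = 0 then x else 0)" for n
    unfolding l2_single_def by (subst l2_of_bounded(1)[OF norm_ge_zero le]) simp
  have "norm (l2_single x) \<le> norm x"
    unfolding l2_single_def by (rule l2_of_bounded(2)[OF norm_ge_zero le])
  then show "norm (l2_single x) = norm x"
    using l2_nth_norm_le[of "l2_single x" 0] by (simp add: nth)
qed

section \<open>The projection along the relations\<close>

text \<open>As \<open>F\<close> inverts \<open>T \<tau>\<close>, every relation has the form
  \<open>(1 - G) g\<close> with \<open>g = l2_map (T \<tau>) h\<close>, and such \<open>g\<close>
  form the kernel of \<open>D\<close>. Hence \<open>D\<close> after the inverse \<open>R\<close> of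
  \<open>1 - G\<close> kills exactly the relations. On the range of \<open>D\<close>,
  \<open>F\<close> vanishes at positive indices, so \<open>G\<close> is 0 and both factors act as
  the identity. The norm is at most 1 times \<open>1 / (1 - q)\<close>.\<close>

lemma dilation_projection:
  fixes T :: "real \<Rightarrow> 'a::complex_hilbert_space \<Rightarrow> 'a"
  assumes T: "C0_semigroup T" and \<tau>: "0 < \<tau>" and \<beta>: "0 < \<beta>" and q: "0 \<le> q" "q < 1"
    and F: "bounded_clinear F" and FT: "\<And>x. F (T \<tau> x) = x"
    and Fq: "\<And>x. norm (F x) \<le> q * \<beta> * norm x"
    and proj: "\<And>x. norm (x - T \<tau> (F x)) \<le> norm x"
  obtains P U where
    "bounded_clinear P" "\<And>f. norm (P f) \<le> norm f / (1 - q)" "\<And>f. P (P f) = P f"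
    "\<And>x. P (l2_single x) = l2_single x"
    "bounded_clinear U" "\<And>f. norm (U f) \<le> \<beta> * norm f"
    "\<And>s f. 0 \<le> s \<Longrightarrow> U (l2_map (T s) f) = l2_map (T s) (U f)"
    "\<And>s f. 0 \<le> s \<Longrightarrow> P (l2_map (T s) (P f)) = P (l2_map (T s) f)"
    "\<And>f. P (U (P f)) = P (U f)" "\<And>f. P (U (l2_map (T \<tau>) f)) = P f"
proof -
  interpret F: bounded_linear F using F by (rule bounded_clinearD)
  interpret T\<tau>: bounded_linear "T \<tau>" by (rule C0_linear[OF T]) (use \<tau> in simp)
  note Tnth = l2_nth_l2_map[OF C0_clinear[OF T]]
  define B :: "'a l2 \<Rightarrow> 'a l2" where "B = l2_op (\<lambda>_ x. (1 / \<beta>) *\<^sub>R x) Suc"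
  define G :: "'a l2 \<Rightarrow> 'a l2" where "G = l2_op (\<lambda>_ x. (1 / \<beta>) *\<^sub>R F x) Suc"
  define U :: "'a l2 \<Rightarrow> 'a l2" where "U = l2_op (\<lambda>n x. if n = 0 then 0 else \<beta> *\<^sub>R x) (\<lambda>n. n - 1)"
  define D :: "'a l2 \<Rightarrow> 'a l2" where "D = l2_op (\<lambda>n x. if n = 0 then x else x - T \<tau> (F x)) id"
  have clin_scaleR: "bounded_clinear (\<lambda>x. r *\<^sub>R h x)" if "bounded_clinear h" for r and h :: "'a \<Rightarrow> 'a"
    using that by (auto simp: bounded_clinear_def scaleC_scaleR intro: bounded_linear_compose[OF bounded_linear_scaleR_right])
  have clin0: "bounded_clinear (\<lambda>x. 0 :: 'a)" by (simp add: bounded_clinear_def)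
  have B: "bounded_clinear B" "l2_nth (B f) n = (1 / \<beta>) *\<^sub>R l2_nth f (Suc n)" for f n
    unfolding B_def
    using l2_op[of "\<lambda>_ x. (1 / \<beta>) *\<^sub>R x" "1 / \<beta>" Suc UNIV] \<beta> clin_scaleR[OF bounded_clinear_id] by auto
  have G: "bounded_clinear G" "l2_nth (G f) n = (1 / \<beta>) *\<^sub>R F (l2_nth f (Suc n))" "norm (G f) \<le> q * norm f" for f n
    unfolding G_def
    using l2_op[of "\<lambda>_ x. (1 / \<beta>) *\<^sub>R F x" q Suc UNIV] \<beta> clin_scaleR[OF F] Fq q
    by (auto simp: field_simps)
  have U: "bounded_clinear U" "l2_nth (U f) n = (if n = 0 then 0 else \<beta> *\<^sub>R l2_nth f (n - 1))"
    "norm (U f) \<le> \<beta> * norm f" for f n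
  proof -
    have 1: "bounded_clinear (\<lambda>x :: 'a. if n = 0 then 0 else \<beta> *\<^sub>R x)" for n :: nat
      using clin_scaleR[OF bounded_clinear_id] clin0 by (cases "n = 0") auto
    have 2: "norm (if n = 0 then 0 else \<beta> *\<^sub>R x) \<le> \<beta> * norm x" for n :: nat and x :: 'a
      using \<beta> by auto
    have 3: "inj_on (\<lambda>n. n - 1) {1::nat..}" by (auto simp: inj_on_def)
    note * = l2_op[of "\<lambda>n x :: 'a. if n = 0 then 0 else \<beta> *\<^sub>R x" \<beta> "\<lambda>n. n - 1" "{1..}", OF 1 2 less_imp_le[OF \<beta>] 3]
    show "bounded_clinear U" "l2_nth (U f) n = (if n = 0 then 0 else \<beta> *\<^sub>R l2_nth f (n - 1))"
      "norm (U f) \<le> \<beta> * norm f"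
      unfolding U_def by (rule *; simp)+
  qed
  have D: "bounded_clinear D" "l2_nth (D f) n = (if n = 0 then l2_nth f 0 else l2_nth f n - T \<tau> (F (l2_nth f n)))"
    "norm (D f) \<le> norm f" for f n
  proof -
    have TF: "bounded_clinear (\<lambda>x. T \<tau> (F x))"
      using bounded_clinear_compose[OF C0_clinear[OF T] F] \<tau> by simp
    then have "bounded_clinear (\<lambda>x. x - T \<tau> (F x))"
      by (auto simp: bounded_clinear_def scaleC_diff_right intro: bounded_linear_sub bounded_linear_ident)
    then have 1: "bounded_clinear (\<lambda>x. if n = 0 then x else x - T \<tau> (F x))" for n :: nat
      using bounded_clinear_id by (cases "n = 0") auto
    have 2: "norm (if n = 0 then x else x - T \<tau> (F x)) \<le> 1 * norm x" for n :: nat and x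
      using proj by auto
    note * = l2_op[of "\<lambda>n x. if n = 0 then x else x - T \<tau> (F x)" 1 id UNIV, OF 1 2]
    show "bounded_clinear D" "norm (D f) \<le> norm f"
      "l2_nth (D f) n = (if n = 0 then l2_nth f 0 else l2_nth f n - T \<tau> (F (l2_nth f n)))"
      unfolding D_def using * by auto
  qed
  obtain R where R: "bounded_clinear R" "\<And>x. R x - G (R x) = x" "\<And>x. R (x - G x) = x"
    "\<And>x. norm (R x) \<le> norm x / (1 - q)"
    using Neumann_inverse[OF G(1) q G(3)] by blast
  define P where "P f = D (R f)" for f
  interpret B: bounded_linear B using B(1) by (rule bounded_clinearD)
  interpret U: bounded_linear U using U(1) by (rule bounded_clinearD)
  have P: "bounded_clinear P" unfolding P_def[abs_def] by (rule bounded_clinear_compose[OF D(1) R(1)])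
  interpret P: bounded_linear P using P by (rule bounded_clinearD)
  have FD: "F (x - T \<tau> (F x)) = 0" for x by (simp add: F.diff FT)
  have P_fix: "P f = f" if "\<And>n. F (l2_nth f (Suc n)) = 0" for f
  proof -
    have "G f = 0" by (rule l2_eqI) (simp add: G(2) that)
    then have "R f = f" using R(3)[of f] by simp
    show ?thesis unfolding P_def \<open>R f = f\<close>
    proof (rule l2_eqI)
      show "l2_nth (D f) n = l2_nth f n" for n
        by (cases n) (simp_all add: D(2) that T\<tau>.zero)
    qed
  qed
  have PP: "P (P f) = P f" for f
    by (rule P_fix) (simp add: P_def D(2) FD)
  have P_norm: "norm (P f) \<le> norm f / (1 - q)" for f
    unfolding P_def by (rule order_trans[OF D(3) R(4)])
  \<comment> \<open>the relations divided out by \<open>P\<close>\<close>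
  have kernel: "P f = 0 \<longleftrightarrow> (\<exists>h. l2_nth h 0 = 0 \<and> f = l2_map (T \<tau>) h - B h)" for f
  proof
    assume Pf: "P f = 0"
    \<comment> \<open>\<open>D (R f) = 0\<close> puts every entry of \<open>R f\<close> into the
      range of \<open>T \<tau>\<close>, so \<open>F\<close> recovers a preimage.\<close>
    define h where "h = l2_map F (R f)"
    have D0: "l2_nth (D (R f)) n = 0" for n using Pf by (simp add: P_def)
    have R0: "l2_nth (R f) 0 = 0" using D0[of 0] by (simp add: D(2))
    have Rn: "T \<tau> (F (l2_nth (R f) n)) = l2_nth (R f) n" for n
      using D0[of n] R0 by (cases "n = 0") (auto simp: D(2) T\<tau>.zero F.zero)
    have "f = l2_map (T \<tau>) h - B h"
    proof (rule l2_eqI)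
      fix n
      have "l2_nth f n = l2_nth (R f - G (R f)) n" by (simp only: R(2))
      then show "l2_nth f n = l2_nth (l2_map (T \<tau>) h - B h) n"
        using \<tau> by (simp add: G(2) Tnth B(2) h_def l2_nth_l2_map[OF F] Rn)
    qed
    moreover have "l2_nth h 0 = 0" by (simp add: h_def l2_nth_l2_map[OF F] R0 F.zero)
    ultimately show "\<exists>h. l2_nth h 0 = 0 \<and> f = l2_map (T \<tau>) h - B h" by blast
  next
    assume "\<exists>h. l2_nth h 0 = 0 \<and> f = l2_map (T \<tau>) h - B h"
    then obtain h where h: "l2_nth h 0 = 0" "f = l2_map (T \<tau>) h - B h" by blast
    have "f = l2_map (T \<tau>) h - G (l2_map (T \<tau>) h)"
      unfolding h(2) using \<tau> by (intro l2_eqI) (simp add: B(2) G(2) Tnth FT)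
    then have "R f = l2_map (T \<tau>) h" using R(3) by simp
    then show "P f = 0"
      unfolding P_def using \<tau> h(1) by (intro l2_eqI) (simp add: D(2) Tnth FT T\<tau>.zero)
  qed
  have kernel_I: "P f = 0" if "l2_nth h 0 = 0" "f = l2_map (T \<tau>) h - B h" for f h
    using kernel[THEN iffD2] that by blast
  have UT: "U (l2_map (T s) f) = l2_map (T s) (U f)" if "0 \<le> s" for s f
  proof (rule l2_eqI)
    interpret Ts: bounded_linear "T s" by (rule C0_linear[OF T that])
    show "l2_nth (U (l2_map (T s) f)) n = l2_nth (l2_map (T s) (U f)) n" for n
      by (simp add: U(2) Tnth[OF that] Ts.zero Ts.scaleR)
  qed
  have ker_T: "P (l2_map (T s) f) = 0" if s: "0 \<le> s" and f: "P f = 0" for s f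
  proof -
    obtain h where h: "l2_nth h 0 = 0" "f = l2_map (T \<tau>) h - B h" using kernel[THEN iffD1, OF f] by blast
    interpret Ts: bounded_linear "T s" by (rule C0_linear[OF T s])
    have "l2_map (T s) f = l2_map (T \<tau>) (l2_map (T s) h) - B (l2_map (T s) h)"
      unfolding h(2) using \<tau> s
      by (intro l2_eqI) (simp add: Tnth B(2) Ts.diff Ts.scaleR C0_commute[OF T, of s \<tau>])
    moreover have "l2_nth (l2_map (T s) h) 0 = 0" by (simp add: Tnth[OF s] h(1) Ts.zero)
    ultimately show ?thesis by (intro kernel_I)
  qed
  have BU: "B (U h) = h" for h
    using \<beta> by (intro l2_eqI) (simp add: B(2) U(2))
  have UB: "U (B h) = h" if "l2_nth h 0 = 0" for h
    using \<beta> that by (intro l2_eqI) (auto simp: B(2) U(2))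
  have U0: "l2_nth (U h) 0 = 0" for h by (simp add: U(2))
  \<comment> \<open>Modulo the relations \<open>U\<close> inverts \<open>T \<tau>\<close>: the error
    is the relation belonging to \<open>U f\<close>, whose entry 0 vanishes.\<close>
  have UT_id: "P (U (l2_map (T \<tau>) f) - f) = 0" for f
  proof -
    have "U (l2_map (T \<tau>) f) - f = l2_map (T \<tau>) (U f) - B (U f)"
      using \<tau> by (simp only: UT BU less_imp_le)
    then show ?thesis by (intro kernel_I[OF U0])
  qed
  \<comment> \<open>On sequences with entry 0 equal to 0 the shifts \<open>U\<close> and
    \<open>B\<close> invert each other, so \<open>U\<close> sends the relation of \<open>h\<close>
    to that of \<open>U h\<close>.\<close>
  have ker_U: "P (U f) = 0" if Pf: "P f = 0" for f
  proof -
    obtain h where h: "l2_nth h 0 = 0" "f = l2_map (T \<tau>) h - B h" using kernel[THEN iffD1, OF Pf] by blast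
    have "U f = l2_map (T \<tau>) (U h) - B (U h)"
      unfolding h(2) U.diff BU UB[OF h(1)] using \<tau> by (simp add: UT)
    then show ?thesis by (intro kernel_I[OF U0])
  qed
  \<comment> \<open>\<open>f - P f\<close> lies in the kernel of \<open>P\<close>, which is
    invariant; this is how an operator descends to the quotient.\<close>
  have PT: "P (l2_map (T s) (P f)) = P (l2_map (T s) f)" if s: "0 \<le> s" for s f
  proof -
    interpret Ts: bounded_linear "l2_map (T s)"
      by (rule bounded_clinearD(1)[OF bounded_clinear_l2_map[OF C0_clinear[OF T s]]])
    show ?thesis using ker_T[OF s, of "f - P f"] by (simp add: P.diff Ts.diff PP)
  qed
  have PU: "P (U (P f)) = P (U f)" for f
    using ker_U[of "f - P f"] by (simp add: P.diff U.diff PP)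
  have single: "P (l2_single x) = l2_single x" for x
    by (rule P_fix) (simp add: l2_nth_single F.zero)
  have PUT: "P (U (l2_map (T \<tau>) f)) = P f" for f
    using UT_id[of f] by (simp add: P.diff)
  show ?thesis by (rule that[OF P P_norm PP single U(1) U(3) UT PT PU PUT])
qed

lemma ip_norm_cinner: "ip_norm cinner x = norm x" for x :: "'a::complex_hilbert_space"
  by (simp add: ip_norm_def Re_cinner norm_eq_sqrt_inner)

lemma vector_space_scaleC: "vector_space (scaleC :: complex \<Rightarrow> 'a::complex_hilbert_space \<Rightarrow> 'a)"
proof
  show "scaleC 1 x = x" for x :: 'a using scaleC_of_real[of 1 x] by simp
qed (auto simp: scaleC_add_right scaleC_add_left scaleC_scaleC)

section \<open>From the projection to a group\<close>

text \<open>Negative times are reached by going forward to \<open>t + n * \<tau>\<close> and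
  applying the backward step \<open>U\<close> \<open>n\<close> times. The formula for every
  admissible \<open>n\<close> is exported: \<open>n = 0\<close> serves the estimate at positive
  times, a rounded \<open>n\<close> the one at negative times.\<close>

lemma C0_group_extension_of_projection:
  fixes T :: "real \<Rightarrow> 'a::complex_hilbert_space \<Rightarrow> 'a"
    and W :: "real \<Rightarrow> 'h::complex_hilbert_space \<Rightarrow> 'h"
  assumes W: "C0_semigroup W" and \<tau>: "0 < \<tau>"
    and P: "bounded_clinear P" "\<And>f. P (P f) = P f"
    and U: "bounded_clinear U"
    and UW: "\<And>s f. 0 \<le> s \<Longrightarrow> U (W s f) = W s (U f)"
    and PW: "\<And>s f. 0 \<le> s \<Longrightarrow> P (W s (P f)) = P (W s f)"
    and PU: "\<And>f. P (U (P f)) = P (U f)" and PUW: "\<And>f. P (U (W \<tau> f)) = P f"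
    and J: "\<And>x y. J (x + y) = J x + J y" "\<And>c x. J (scaleC c x) = scaleC c (J x)"
      "\<And>x. norm (J x) = norm x" "\<And>x. P (J x) = J x"
    and WJ: "\<And>t x. 0 \<le> t \<Longrightarrow> W t (J x) = J (T t x)"
  obtains S where "C0_group_extension T scaleC {y. P y = y} cinner J S"
    "\<And>n t y. 0 \<le> t + real n * \<tau> \<Longrightarrow> S t y = P ((U ^^ n) (W (t + real n * \<tau>) y))"
proof -
  interpret P: bounded_linear P using P(1) by (rule bounded_clinearD)
  note Pc = bounded_clinearD(2)[OF P(1)]
  define Y where "Y = {y. P y = y}"
  have Un: "bounded_clinear (U ^^ n)" for n
    by (induction n) (auto simp: bounded_clinear_id id_def comp_def intro: bounded_clinear_compose[OF U])
  have UnW: "(U ^^ n) (W s f) = W s ((U ^^ n) f)" if "0 \<le> s" for n s f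
    by (induction n) (auto simp: UW that)
  have PUn: "P ((U ^^ n) (P f)) = P ((U ^^ n) f)" for n f
    by (induction n arbitrary: f) (simp_all add: P(2), metis PU)
  define R where "R n t y = P ((U ^^ n) (W (t + real n * \<tau>) y))" for n t y
  \<comment> \<open>One more forward step and one more backward step cancel under \<open>P\<close>,
    so the choice of \<open>n\<close> is immaterial.\<close>
  have R_Suc: "R (Suc n) t y = R n t y" if t: "0 \<le> t + real n * \<tau>" for n t y
  proof -
    have "W (t + real (Suc n) * \<tau>) y = W \<tau> (W (t + real n * \<tau>) y)"
      using C0_add[OF W less_imp_le[OF \<tau>] t, of y] by (simp add: algebra_simps)
    then have "R (Suc n) t y = P ((U ^^ n) (U (W \<tau> (W (t + real n * \<tau>) y))))"
      by (simp add: R_def funpow_swap1)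
    also have "\<dots> = P ((U ^^ n) (P (U (W \<tau> (W (t + real n * \<tau>) y)))))" by (simp only: PUn)
    also have "\<dots> = R n t y" by (simp only: PUW PUn R_def)
    finally show ?thesis .
  qed
  have R_le: "R (n + k) t y = R n t y" if t: "0 \<le> t + real n * \<tau>" for n k t y
  proof (induction k)
    case (Suc k)
    have "0 \<le> t + real (n + k) * \<tau>" using t \<tau> by (simp add: distrib_right flip: add.assoc)
    then show ?case using R_Suc[of t "n + k"] Suc by simp
  qed simp
  define N where "N t = nat \<lceil>\<bar>t\<bar> / \<tau>\<rceil>" for t
  have N: "0 \<le> t + real (N t) * \<tau>" for t
  proof -
    have "\<bar>t\<bar> / \<tau> \<le> real (N t)" unfolding N_def by (rule real_nat_ceiling_ge)
    then have "\<bar>t\<bar> \<le> real (N t) * \<tau>" using \<tau> by (simp add: pos_divide_le_eq)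
    then show ?thesis by linarith
  qed
  define S where "S t = R (N t) t" for t
  have SR: "S t y = R n t y" if "0 \<le> t + real n * \<tau>" for n t y
    unfolding S_def using R_le[OF that, of "N t"] R_le[OF N, of t n] by (simp add: add.commute)
  have R_clin: "bounded_clinear (R n t)" if "0 \<le> t + real n * \<tau>" for n t
    unfolding R_def by (intro bounded_clinear_compose[OF P(1)] bounded_clinear_compose[OF Un] C0_clinear[OF W that])
  have S_clin: "bounded_clinear (S t)" for t unfolding S_def by (rule R_clin[OF N])
  have S_Y: "S t y \<in> Y" for t y by (simp add: S_def R_def Y_def P(2))
  have S_add: "S (s + t) y = S s (S t y)" for s t y
  proof -
    let ?n = "N s" and ?m = "N t"
    have n: "0 \<le> s + real ?n * \<tau>" "0 \<le> t + real ?m * \<tau>" by (rule N)+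
    have "S s (S t y) = P ((U ^^ ?n) (W (s + real ?n * \<tau>) (P ((U ^^ ?m) (W (t + real ?m * \<tau>) y)))))"
      by (simp add: S_def R_def)
    also have "\<dots> = P ((U ^^ ?n) (P (W (s + real ?n * \<tau>) ((U ^^ ?m) (W (t + real ?m * \<tau>) y)))))"
      using PUn[of ?n "W (s + real ?n * \<tau>) (P ((U ^^ ?m) (W (t + real ?m * \<tau>) y)))"] PW[OF n(1)]
      by (metis (no_types))
    also have "\<dots> = P ((U ^^ (?n + ?m)) (W (s + real ?n * \<tau>) (W (t + real ?m * \<tau>) y)))"
      by (simp only: PUn UnW[OF n(1), symmetric] funpow_add comp_apply)
    also have "W (s + real ?n * \<tau>) (W (t + real ?m * \<tau>) y) = W (s + t + real (?n + ?m) * \<tau>) y"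
      using C0_add[OF W n, of y] by (simp add: algebra_simps)
    also have "P ((U ^^ (?n + ?m)) (W (s + t + real (?n + ?m) * \<tau>) y)) = S (s + t) y"
      using n by (subst SR[of "s + t" "?n + ?m"]) (auto simp: R_def algebra_simps)
    finally show ?thesis by simp
  qed
  have S_0: "S 0 y = y" if "y \<in> Y" for y
    using SR[of 0 0 y] that by (simp add: R_def C0_zero[OF W] Y_def)
  have S_cont: "((\<lambda>s. S s y) \<longlongrightarrow> S t y) (at t)" for t y
  proof -
    \<comment> \<open>Large enough for all \<open>s \<ge> t - 1\<close>: continuity at
      \<open>t\<close> needs one \<open>n\<close> on a whole neighbourhood.\<close>
    define n where "n = N (\<bar>t\<bar> + 1)"
    have n: "0 \<le> s + real n * \<tau>" if "s \<in> {t - 1..}" for s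
    proof -
      have "(\<bar>t\<bar> + 1) / \<tau> \<le> real n"
        using real_nat_ceiling_ge[of "\<bar>\<bar>t\<bar> + 1\<bar> / \<tau>"] by (simp add: n_def N_def)
      then have "\<bar>t\<bar> + 1 \<le> real n * \<tau>" using \<tau> by (simp add: pos_divide_le_eq)
      then show ?thesis using that by auto
    qed
    have "continuous_on {t - 1..} (\<lambda>s. R n s y)"
      unfolding R_def
      by (intro P.continuous_on bounded_linear.continuous_on[OF bounded_clinearD(1)[OF Un]]
          C0_continuous_compose[OF W] continuous_intros) (rule n)
    then have "continuous_on {t - 1..} (\<lambda>s. S s y)"
      by (rule continuous_on_eq) (simp add: SR[OF n])
    then have "((\<lambda>s. S s y) \<longlongrightarrow> S t y) (at t within {t - 1..})"
      by (auto simp: continuous_on_def)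
    moreover have "at t within {t - 1..} = at t" by (rule at_within_nhd[of _ "{t - 1<..}"]) auto
    ultimately show ?thesis by simp
  qed
  have SJ: "S t (J x) = J (T t x)" if "0 \<le> t" for t x
    using SR[of t 0 "J x"] that by (simp add: R_def WJ J(4))
  interpret vs: vector_space "scaleC :: complex \<Rightarrow> 'h \<Rightarrow> 'h" by (rule vector_space_scaleC)
  have closed: "closed Y"
    unfolding Y_def by (intro closed_Collect_eq P.continuous_on continuous_intros)
  have hilbert: "hilbert_space_on scaleC Y cinner"
    unfolding hilbert_space_on_def
  proof (intro conjI allI impI)
    show "vector_space (scaleC :: complex \<Rightarrow> 'h \<Rightarrow> 'h)" by (rule vector_space_scaleC)
    show "vs.subspace Y" by (auto simp: vs.subspace_def Y_def P.add P.zero Pc)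
    show "inner_product_on scaleC Y cinner"
      unfolding inner_product_on_def
      using cinner_add_left cinner_scaleC_left cinner_commute by (auto simp: Re_cinner)
    fix u :: "nat \<Rightarrow> 'h"
    assume u: "range u \<subseteq> Y" and "\<forall>e>0. \<exists>N. \<forall>m\<ge>N. \<forall>n\<ge>N. ip_norm cinner (u m - u n) < e"
    then have "Cauchy u" by (simp add: ip_norm_cinner Cauchy_def dist_norm)
    then obtain y where y: "u \<longlonglongrightarrow> y" using Cauchy_convergent_iff convergent_def by blast
    moreover have "y \<in> Y" using closed_sequentially[OF closed _ y] u by blast
    ultimately show "\<exists>y\<in>Y. (\<lambda>n. ip_norm cinner (u n - y)) \<longlonglongrightarrow> 0"
      by (intro bexI[of _ y]) (auto simp: ip_norm_cinner intro: tendsto_norm_zero LIM_zero)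
  qed
  have "isometric_embedding scaleC Y cinner J"
    unfolding isometric_embedding_def by (auto simp: J Y_def ip_norm_cinner)
  moreover have "C0_group_on scaleC Y cinner S"
    unfolding C0_group_on_def
  proof (intro conjI allI ballI)
    fix t
    interpret St: bounded_linear "S t" by (rule bounded_clinearD(1)[OF S_clin])
    obtain K where "\<And>y. norm (S t y) \<le> norm y * K" using St.bounded by blast
    then show "bounded_operator_on scaleC Y cinner (S t)"
      unfolding bounded_operator_on_def
      by (intro conjI exI[of _ K])
        (auto simp: S_Y ip_norm_cinner St.add bounded_clinearD(2)[OF S_clin] mult.commute)
    show "((\<lambda>s. ip_norm cinner (S s y - S t y)) \<longlongrightarrow> 0) (at t)" for y
      unfolding ip_norm_cinner using S_cont[where y = y] by (intro tendsto_norm_zero LIM_zero)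
  qed (auto simp: S_0 S_add)
  ultimately have "C0_group_extension T scaleC Y cinner J S"
    using hilbert SJ by (simp add: C0_group_extension_def)
  then show ?thesis using that SR unfolding Y_def R_def by blast
qed

section \<open>Moving the extension into the prescribed type\<close>

text \<open>The group is constructed on sequences, but the carrier must lie in
  \<open>extension_space\<close>. An injective linear map carries everything over when the inner
  product is pulled back along its inverse, and operator norms do not change.\<close>

lemma C0_group_extension_transport:
  fixes \<Phi> :: "'b::ab_group_add \<Rightarrow> 'c::ab_group_add"
  assumes ext: "C0_group_extension T smul Y ip J S" and smul': "vector_space smul'"
    and add: "\<And>x y. \<Phi> (x + y) = \<Phi> x + \<Phi> y" and scale: "\<And>a x. \<Phi> (smul a x) = smul' a (\<Phi> x)"
    and inj: "inj \<Phi>"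
  defines "ip' \<equiv> \<lambda>u v. ip (inv \<Phi> u) (inv \<Phi> v)"
  shows "C0_group_extension T smul' (\<Phi> ` Y) ip' (\<lambda>x. \<Phi> (J x)) (\<lambda>t u. \<Phi> (S t (inv \<Phi> u)))"
    and "op_norm_on (\<Phi> ` Y) ip' (\<lambda>u. \<Phi> (f (inv \<Phi> u))) = op_norm_on Y ip f"
proof -
  have inv [simp]: "inv \<Phi> (\<Phi> x) = x" for x using inj by simp
  have diff: "\<Phi> x - \<Phi> y = \<Phi> (x - y)" for x y using add[of "x - y" y] by simp
  have zero: "\<Phi> 0 = 0" using diff[of 0 0] by simp
  have ip' [simp]: "ip' (\<Phi> x) (\<Phi> y) = ip x y" for x y by (simp add: ip'_def)
  have nrm [simp]: "ip_norm ip' (\<Phi> x) = ip_norm ip x" for x by (simp add: ip_norm_def)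
  interpret vs: vector_space smul using ext by (simp add: C0_group_extension_def hilbert_space_on_def)
  interpret vs': vector_space smul' by (rule smul')
  have Y: "vs.subspace Y" "inner_product_on smul Y ip"
    and complete: "\<And>u :: nat \<Rightarrow> 'b. range u \<subseteq> Y \<Longrightarrow> (\<forall>e>0. \<exists>N. \<forall>m\<ge>N. \<forall>n\<ge>N. ip_norm ip (u m - u n) < e) \<Longrightarrow>
        \<exists>y\<in>Y. (\<lambda>n. ip_norm ip (u n - y)) \<longlonglongrightarrow> 0"
    and J: "isometric_embedding smul Y ip J" and S: "C0_group_on smul Y ip S"
    and SJ: "\<And>t x. 0 \<le> t \<Longrightarrow> S t (J x) = J (T t x)"
    using ext unfolding C0_group_extension_def hilbert_space_on_def by blast+
  note * = Y(2)[unfolded inner_product_on_def]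
  have ip: "\<And>x y z. x \<in> Y \<Longrightarrow> y \<in> Y \<Longrightarrow> z \<in> Y \<Longrightarrow> ip (x + y) z = ip x z + ip y z"
    "\<And>a x y. x \<in> Y \<Longrightarrow> y \<in> Y \<Longrightarrow> ip (smul a x) y = a * ip x y"
    "\<And>x y. x \<in> Y \<Longrightarrow> y \<in> Y \<Longrightarrow> ip y x = cnj (ip x y)" "\<And>x. x \<in> Y \<Longrightarrow> x \<noteq> 0 \<Longrightarrow> 0 < Re (ip x x)"
    using *[THEN conjunct1] *[THEN conjunct2, THEN conjunct1]
      *[THEN conjunct2, THEN conjunct2, THEN conjunct1]
      *[THEN conjunct2, THEN conjunct2, THEN conjunct2] by fast+
  have "hilbert_space_on smul' (\<Phi> ` Y) ip'"
    unfolding hilbert_space_on_def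
  proof (intro conjI allI impI)
    show "vs'.subspace (\<Phi> ` Y)"
    proof (rule vs'.subspaceI)
      show "0 \<in> \<Phi> ` Y" using vs.subspace_0[OF Y(1)] zero by force
      show "x + y \<in> \<Phi> ` Y" if "x \<in> \<Phi> ` Y" "y \<in> \<Phi> ` Y" for x y
        using that vs.subspace_add[OF Y(1)] by (auto simp flip: add)
      show "smul' a x \<in> \<Phi> ` Y" if "x \<in> \<Phi> ` Y" for a x
        using that vs.subspace_scale[OF Y(1)] by (auto simp flip: scale)
    qed
    show "inner_product_on smul' (\<Phi> ` Y) ip'"
      unfolding inner_product_on_def
    proof (intro conjI ballI allI impI; elim imageE; hypsubst)
      show "ip' (\<Phi> x + \<Phi> y) (\<Phi> z) = ip' (\<Phi> x) (\<Phi> z) + ip' (\<Phi> y) (\<Phi> z)"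
        if "x \<in> Y" "y \<in> Y" "z \<in> Y" for x y z
        using that by (simp add: ip(1) flip: add)
      show "ip' (smul' a (\<Phi> x)) (\<Phi> y) = a * ip' (\<Phi> x) (\<Phi> y)" if "x \<in> Y" "y \<in> Y" for a x y
        using that by (simp add: ip(2) flip: scale)
      show "ip' (\<Phi> y) (\<Phi> x) = cnj (ip' (\<Phi> x) (\<Phi> y))" if "x \<in> Y" "y \<in> Y" for x y
        unfolding ip' by (rule ip(3)[OF that])
      show "0 < Re (ip' (\<Phi> x) (\<Phi> x))" if "x \<in> Y" "\<Phi> x \<noteq> 0" for x
        unfolding ip' using that zero by (intro ip(4)) auto
    qed
    fix u :: "nat \<Rightarrow> 'c"
    assume u: "range u \<subseteq> \<Phi> ` Y" and C: "\<forall>e>0. \<exists>N. \<forall>m\<ge>N. \<forall>n\<ge>N. ip_norm ip' (u m - u n) < e"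
    have "\<exists>v. v \<in> Y \<and> u n = \<Phi> v" for n using u by blast
    then obtain v where v: "\<And>n. v n \<in> Y" "\<And>n. u n = \<Phi> (v n)" by metis
    have "\<exists>y\<in>Y. (\<lambda>n. ip_norm ip (v n - y)) \<longlonglongrightarrow> 0"
      using v C by (intro complete) (auto simp: diff)
    then show "\<exists>y\<in>\<Phi> ` Y. (\<lambda>n. ip_norm ip' (u n - y)) \<longlonglongrightarrow> 0"
      by (auto simp: v(2) diff)
  qed (rule smul')
  moreover have "isometric_embedding smul' (\<Phi> ` Y) ip' (\<lambda>x. \<Phi> (J x))"
    using J by (auto simp: isometric_embedding_def add scale)
  moreover have "C0_group_on smul' (\<Phi> ` Y) ip' (\<lambda>t u. \<Phi> (S t (inv \<Phi> u)))"
    unfolding C0_group_on_def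
  proof (intro conjI allI ballI; (elim imageE; hypsubst)?)
    fix t
    have St: "S t ` Y \<subseteq> Y" "\<And>x y. x \<in> Y \<Longrightarrow> y \<in> Y \<Longrightarrow> S t (x + y) = S t x + S t y"
      "\<And>a x. x \<in> Y \<Longrightarrow> S t (smul a x) = smul a (S t x)"
      "\<exists>K. \<forall>x\<in>Y. ip_norm ip (S t x) \<le> K * ip_norm ip x"
      using S unfolding C0_group_on_def bounded_operator_on_def by blast+
    show "bounded_operator_on smul' (\<Phi> ` Y) ip' (\<lambda>u. \<Phi> (S t (inv \<Phi> u)))"
      unfolding bounded_operator_on_def
    proof (intro conjI allI ballI; (elim imageE; hypsubst)?)
      show "(\<lambda>u. \<Phi> (S t (inv \<Phi> u))) ` \<Phi> ` Y \<subseteq> \<Phi> ` Y" using St(1) by auto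
      show "\<Phi> (S t (inv \<Phi> (\<Phi> x + \<Phi> y))) = \<Phi> (S t (inv \<Phi> (\<Phi> x))) + \<Phi> (S t (inv \<Phi> (\<Phi> y)))"
        if "x \<in> Y" "y \<in> Y" for x y
        using that by (simp add: St(2) flip: add)
      show "\<Phi> (S t (inv \<Phi> (smul' a (\<Phi> x)))) = smul' a (\<Phi> (S t (inv \<Phi> (\<Phi> x))))" if "x \<in> Y" for a x
        using that by (simp add: St(3) flip: scale)
      show "\<exists>K. \<forall>u\<in>\<Phi> ` Y. ip_norm ip' (\<Phi> (S t (inv \<Phi> u))) \<le> K * ip_norm ip' u"
        using St(4) by simp
    qed
    show "((\<lambda>s. ip_norm ip' (\<Phi> (S s (inv \<Phi> (\<Phi> y))) - \<Phi> (S t (inv \<Phi> (\<Phi> y))))) \<longlongrightarrow> 0) (at t)"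
      if "y \<in> Y" for y
      using S that by (simp add: C0_group_on_def diff)
    show "\<Phi> (S (s + t) (inv \<Phi> (\<Phi> y))) = \<Phi> (S s (inv \<Phi> (\<Phi> (S t (inv \<Phi> (\<Phi> y))))))" if "y \<in> Y" for s y
      using S that by (simp add: C0_group_on_def)
  next
    show "\<Phi> (S 0 (inv \<Phi> (\<Phi> y))) = \<Phi> y" if "y \<in> Y" for y
      using S that by (simp add: C0_group_on_def)
  qed
  ultimately show "C0_group_extension T smul' (\<Phi> ` Y) ip' (\<lambda>x. \<Phi> (J x)) (\<lambda>t u. \<Phi> (S t (inv \<Phi> u)))"
    using SJ by (simp add: C0_group_extension_def)
  show "op_norm_on (\<Phi> ` Y) ip' (\<lambda>u. \<Phi> (f (inv \<Phi> u))) = op_norm_on Y ip f"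
    by (simp add: op_norm_on_def image_image)
qed

text \<open>
  The type \<open>'a extension_space\<close> contains the sequences with entries in \<open>'a\<close>: the entry \<open>n\<close> is
  stored as the functional it represents, at the times \<open>t = n\<close>.
\<close>

definition l2_embed :: "'a::complex_hilbert_space l2 \<Rightarrow> 'a extension_space" where
  "l2_embed f = (\<lambda>(t, a). if t \<in> \<nat> then cinner (l2_nth f (nat \<lfloor>t\<rfloor>)) a else 0)"

lemma l2_embed_add: "l2_embed (f + g) = l2_embed f + l2_embed g"
  by (auto simp: l2_embed_def fun_eq_iff cinner_add_left)

lemma l2_embed_scaleC: "l2_embed (scaleC c f) = (\<lambda>p. c * l2_embed f p)"
  by (auto simp: l2_embed_def fun_eq_iff cinner_scaleC_left)

lemma inj_l2_embed: "inj l2_embed"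
proof (rule injI, rule l2_eqI)
  fix f g :: "'a l2" and n assume eq: "l2_embed f = l2_embed g"
  have "cinner (l2_nth f n) a = cinner (l2_nth g n) a" for a
    using fun_cong[OF eq, of "(real n, a)"] by (simp add: l2_embed_def)
  then have "inner (l2_nth f n - l2_nth g n) (l2_nth f n - l2_nth g n) = 0"
    by (metis Re_cinner inner_diff_left right_minus_eq)
  then show "l2_nth f n = l2_nth g n" by simp
qed

lemma vector_space_fun_mult: "vector_space (\<lambda>c (f :: 'i \<Rightarrow> complex) p. c * f p)"
  by standard (auto simp: fun_eq_iff algebra_simps)

lemma op_norm_on_le:
  fixes f :: "'h::complex_hilbert_space \<Rightarrow> 'h"
  assumes "0 \<in> Y" "0 \<le> K" "\<And>y. y \<in> Y \<Longrightarrow> norm (f y) \<le> K * norm y"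
  shows "op_norm_on Y cinner f \<le> K"
  unfolding op_norm_on_def ip_norm_cinner
proof (rule cSUP_least)
  fix y assume y: "y \<in> Y"
  show "norm (f y) / norm y \<le> K"
    using assms(2) assms(3)[OF y] by (cases "y = 0") (auto simp: pos_divide_le_eq)
qed (use assms in auto)

section \<open>Choice of constants\<close>

theorem quantitative_group_extension:
  fixes T :: "real \<Rightarrow> 'a::complex_hilbert_space \<Rightarrow> 'a"
  assumes T: "C0_semigroup T" and c: "0 < c"
    and lb: "\<And>x t. 0 < t \<Longrightarrow> c * exp (- \<alpha> * t) * norm x \<le> norm (T t x)" and \<omega>: "\<alpha> < \<omega>"
  obtains smul ip J S and Y :: "'a extension_space set" and M where
    "C0_group_extension T smul Y ip J S"
    "\<And>t. 0 < t \<Longrightarrow> op_norm_on Y ip (S t) \<le> sqrt 2 * onorm (T t)"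
    "\<And>t. 0 < t \<Longrightarrow> op_norm_on Y ip (S (- t)) \<le> M * exp (\<omega> * t)"
proof -
  \<comment> \<open>The largest \<open>q\<close> for which
    \<open>1 / (1 - q) \<le> sqrt 2\<close>.\<close>
  define \<rho> where "\<rho> = 1 - 1 / sqrt 2"
  have \<rho>: "0 < \<rho>" "\<rho> < 1" by (simp_all add: \<rho>_def)
  \<comment> \<open>Solves \<open>1 \<le> c * \<rho> * exp ((\<omega> - \<alpha>) * \<tau>)\<close>,
    which says \<open>q \<le> \<rho>\<close>. The logarithm may be negative, so the maximum with 1
    secures a positive step.\<close>
  define \<tau> where "\<tau> = max 1 (ln (1 / (c * \<rho>)) / (\<omega> - \<alpha>))"
  have \<tau>: "0 < \<tau>" by (simp add: \<tau>_def)
  define \<beta> where "\<beta> = exp (\<omega> * \<tau>)"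
  define d where "d = c * exp (- \<alpha> * \<tau>)"
  \<comment> \<open>\<open>1 / d\<close> bounds the left inverse of \<open>T \<tau>\<close>, and the
    left shift in \<open>G\<close> brings the weight \<open>1 / \<beta>\<close>.\<close>
  define q where "q = 1 / (d * \<beta>)"
  have \<beta>: "0 < \<beta>" and d: "0 < d" using c by (simp_all add: \<beta>_def d_def)
  have q: "0 \<le> q" "q \<le> \<rho>"
  proof -
    show "0 \<le> q" using \<beta> d by (simp add: q_def)
    have "ln (1 / (c * \<rho>)) \<le> (\<omega> - \<alpha>) * \<tau>"
    proof -
      have "ln (1 / (c * \<rho>)) / (\<omega> - \<alpha>) \<le> \<tau>" by (simp add: \<tau>_def)
      then show ?thesis using \<omega> by (simp add: pos_divide_le_eq mult.commute)
    qed
    then have "exp (ln (1 / (c * \<rho>))) \<le> exp ((\<omega> - \<alpha>) * \<tau>)" by simp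
    then have "1 / (c * \<rho>) \<le> exp ((\<omega> - \<alpha>) * \<tau>)" using c \<rho> by simp
    then have "1 \<le> c * exp ((\<omega> - \<alpha>) * \<tau>) * \<rho>"
      using c \<rho> by (simp add: pos_divide_le_eq mult_ac)
    also have "c * exp ((\<omega> - \<alpha>) * \<tau>) = d * \<beta>"
      by (simp add: d_def \<beta>_def left_diff_distrib mult_exp_exp)
    finally show "q \<le> \<rho>" using d \<beta> by (simp add: q_def pos_divide_le_eq mult.commute)
  qed
  have T\<tau>: "bounded_clinear (T \<tau>)" by (rule C0_clinear[OF T]) (use \<tau> in simp)
  obtain F where F: "bounded_clinear F" "\<And>x. F (T \<tau> x) = x" "\<And>x. norm (F x) \<le> norm x / d"
    "\<And>x. norm (x - T \<tau> (F x)) \<le> norm x"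
    using bounded_left_inverse[OF T\<tau> d] lb[OF \<tau>] unfolding d_def by blast
  have Fq: "norm (F x) \<le> q * \<beta> * norm x" for x
    using F(3)[of x] \<beta> by (simp add: q_def)
  have q1: "q < 1" using q \<rho> by simp
  obtain P U where P: "bounded_clinear P" "\<And>f. norm (P f) \<le> norm f / (1 - q)" "\<And>f. P (P f) = P f"
      "\<And>x. P (l2_single x) = l2_single x"
    and U: "bounded_clinear U" "\<And>f. norm (U f) \<le> \<beta> * norm f"
      "\<And>s f. 0 \<le> s \<Longrightarrow> U (l2_map (T s) f) = l2_map (T s) (U f)"
    and PT: "\<And>s f. 0 \<le> s \<Longrightarrow> P (l2_map (T s) (P f)) = P (l2_map (T s) f)"
    and PU: "\<And>f. P (U (P f)) = P (U f)" and PUT: "\<And>f. P (U (l2_map (T \<tau>) f)) = P f"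
    using dilation_projection[OF T \<tau> \<beta> q(1) q1 F(1,2) Fq F(4)] by blast
  have single: "l2_single (x + y) = l2_single x + l2_single y" "l2_single (scaleC a x) = scaleC a (l2_single x)"
    for x y :: 'a and a
    by (rule l2_eqI; simp add: l2_nth_single)+
  have T_single: "l2_map (T t) (l2_single x) = l2_single (T t x)" if "0 \<le> t" for t x
    by (rule l2_eqI) (simp add: l2_nth_single l2_nth_l2_map[OF C0_clinear[OF T that]]
        linear_simps[OF C0_linear[OF T that]])
  obtain S where S: "C0_group_extension T scaleC {y. P y = y} cinner l2_single S"
    "\<And>n t y. 0 \<le> t + real n * \<tau> \<Longrightarrow> S t y = P ((U ^^ n) (l2_map (T (t + real n * \<tau>)) y))"
    by (rule C0_group_extension_of_projection[where J = l2_single and T = T,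
          OF C0_semigroup_l2_map[OF T] \<tau> P(1,3) U(1,3) PT PU PUT single norm_l2_single P(4) T_single])
      (assumption+, rule that, assumption+)
  have P2: "norm (P f) \<le> sqrt 2 * norm f" for f
  proof -
    have "1 / sqrt 2 \<le> 1 - q" using q by (simp add: \<rho>_def)
    then have "norm f / (1 - q) \<le> norm f / (1 / sqrt 2)" using q1 by (intro divide_left_mono) auto
    then show ?thesis using P(2)[of f] by (simp add: mult.commute)
  qed
  have P0: "0 \<in> {y. P y = y}" using P(1) by (simp add: linear_simps bounded_clinearD)
  have Un: "norm ((U ^^ n) f) \<le> \<beta> ^ n * norm f" for n f
  proof (induction n)
    case (Suc n)
    have "norm ((U ^^ Suc n) f) \<le> \<beta> * norm ((U ^^ n) f)" using U(2) by simp
    also have "\<dots> \<le> \<beta> * (\<beta> ^ n * norm f)" using \<beta> Suc by simp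
    finally show ?case by (simp add: mult_ac)
  qed simp
  have pos: "op_norm_on {y. P y = y} cinner (S t) \<le> sqrt 2 * onorm (T t)" if t: "0 < t" for t
  proof (rule op_norm_on_le[OF P0])
    have Tt: "bounded_clinear (T t)" using C0_clinear[OF T] t by simp
    show "0 \<le> sqrt 2 * onorm (T t)" using onorm_pos_le[OF bounded_clinearD(1)[OF Tt]] by simp
    fix y
    have "norm (S t y) \<le> sqrt 2 * norm (l2_map (T t) y)" using S(2)[of t 0 y] P2 t by simp
    also have "\<dots> \<le> sqrt 2 * (onorm (T t) * norm y)" using norm_l2_map[OF Tt, of y] by simp
    finally show "norm (S t y) \<le> sqrt 2 * onorm (T t) * norm y" by (simp add: mult_ac)
  qed
  obtain K where K: "0 < K" "\<And>t x. 0 \<le> t \<Longrightarrow> t \<le> \<tau> \<Longrightarrow> norm (T t x) \<le> K * norm x"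
    using C0_locally_bounded[OF T] by blast
  \<comment> \<open>The factors come from \<open>P\<close>, from \<open>T\<close> at the remaining
    time in \<open>{0..\<tau>}\<close>, and from rounding \<open>t\<close> up to a multiple of
    \<open>\<tau>\<close>; the absolute value covers both signs of \<open>\<omega>\<close>.\<close>
  define M where "M = sqrt 2 * K * exp (\<bar>\<omega>\<bar> * \<tau>)"
  have neg: "op_norm_on {y. P y = y} cinner (S (- t)) \<le> M * exp (\<omega> * t)" if t: "0 < t" for t
  proof (rule op_norm_on_le[OF P0])
    show "0 \<le> M * exp (\<omega> * t)" using K by (simp add: M_def)
    fix y
    define n where "n = nat \<lceil>t / \<tau>\<rceil>"
    have "t / \<tau> \<le> real n" "real n \<le> t / \<tau> + 1" using t \<tau> by (auto simp: n_def)
    then have n: "t \<le> real n * \<tau>" "real n * \<tau> \<le> t + \<tau>" using \<tau> by (auto simp: field_simps)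
    let ?r = "- t + real n * \<tau>"
    have r: "0 \<le> ?r" "?r \<le> \<tau>" using n by auto
    have "onorm (T ?r) \<le> K" by (rule onorm_bound) (use K(1) K(2)[OF r] in auto)
    then have Ty: "norm (l2_map (T ?r) y) \<le> K * norm y"
      using norm_l2_map[OF C0_clinear[OF T r(1)], of y] by (meson mult_right_mono norm_ge_zero order_trans)
    have "\<omega> * (real n * \<tau> - t) \<le> \<bar>\<omega>\<bar> * \<tau>" using r by (intro mult_mono) auto
    then have "\<beta> ^ n \<le> exp (\<bar>\<omega>\<bar> * \<tau>) * exp (\<omega> * t)"
      by (simp add: \<beta>_def mult_exp_exp algebra_simps flip: exp_of_nat_mult)
    then have b: "\<beta> ^ n * (K * norm y) \<le> exp (\<bar>\<omega>\<bar> * \<tau>) * exp (\<omega> * t) * (K * norm y)"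
      using K by (intro mult_right_mono) auto
    have "norm (S (- t) y) \<le> sqrt 2 * norm ((U ^^ n) (l2_map (T ?r) y))"
      using S(2)[OF r(1)] P2 by simp
    also have "\<dots> \<le> sqrt 2 * (\<beta> ^ n * norm (l2_map (T ?r) y))" using Un by simp
    also have "\<dots> \<le> sqrt 2 * (\<beta> ^ n * (K * norm y))" using Ty \<beta> by simp
    also have "\<dots> \<le> sqrt 2 * (exp (\<bar>\<omega>\<bar> * \<tau>) * exp (\<omega> * t) * (K * norm y))" using b by simp
    finally show "norm (S (- t) y) \<le> M * exp (\<omega> * t) * norm y" by (simp add: M_def mult_ac)
  qed
  note tr = C0_group_extension_transport[OF S(1) vector_space_fun_mult l2_embed_add l2_embed_scaleC inj_l2_embed]
  show ?thesis
    by (rule that[OF tr(1), of M]) (simp_all only: tr(2) pos neg)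
qed

theorem theorem7p3:
  fixes T :: "real \<Rightarrow> 'a::complex_hilbert_space \<Rightarrow> 'a"
    and A :: "('a \<times> 'a) set"
  assumes "C0_semigroup T"
    and "A = generator T"
  shows
    "(satisfies_lower_bounds T \<longleftrightarrow> (\<exists>L. left_inverse_semigroup L T)) \<and>
     (satisfies_lower_bounds T \<longleftrightarrow>
        (\<exists>smul (Y :: 'a extension_space set) ip J S. C0_group_extension T smul Y ip J S)) \<and>
     (satisfies_lower_bounds T \<longleftrightarrow>
        (\<exists>Q ip V. bounded_clinear Q \<and> equivalent_inner_product ip \<and>
           C0_semigroup V \<and> generator V = plus_bounded A Q \<and>
           (\<forall>t\<ge>0. \<forall>x. ip_norm ip (V t x) = ip_norm ip x))) \<and>
     (\<forall>smul (Y :: 'b::ab_group_add set) ip J S.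
        C0_group_extension T smul Y ip J S \<longrightarrow> satisfies_lower_bounds T) \<and>
     (\<forall>c \<alpha> \<omega> :: real.
        c > 0 \<longrightarrow> (\<forall>x. \<forall>t>0. norm (T t x) \<ge> c * exp (- \<alpha> * t) * norm x) \<longrightarrow> \<omega> > \<alpha> \<longrightarrow>
        (\<exists>smul (Y :: 'a extension_space set) ip J S.
           C0_group_extension T smul Y ip J S \<and>
           (\<forall>t>0. op_norm_on Y ip (S t) \<le> sqrt 2 * onorm (T t)) \<and>
           (\<exists>M. \<forall>t>0. op_norm_on Y ip (S (- t)) \<le> M * exp (\<omega> * t))))"
proof (intro conjI)
  note T = assms(1) and A = assms(2)
  have quant: "\<exists>smul (Y :: 'a extension_space set) ip J S.
           C0_group_extension T smul Y ip J S \<and>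
           (\<forall>t>0. op_norm_on Y ip (S t) \<le> sqrt 2 * onorm (T t)) \<and>
           (\<exists>M. \<forall>t>0. op_norm_on Y ip (S (- t)) \<le> M * exp (\<omega> * t))"
    if "c > 0" "\<forall>x. \<forall>t>0. norm (T t x) \<ge> c * exp (- \<alpha> * t) * norm x" "\<omega> > \<alpha>" for c \<alpha> \<omega>
    by (rule quantitative_group_extension[OF T that(1) _ that(3)]) (use that(2) in blast)+
  then show "\<forall>c \<alpha> \<omega> :: real.
        c > 0 \<longrightarrow> (\<forall>x. \<forall>t>0. norm (T t x) \<ge> c * exp (- \<alpha> * t) * norm x) \<longrightarrow> \<omega> > \<alpha> \<longrightarrow>
        (\<exists>smul (Y :: 'a extension_space set) ip J S.
           C0_group_extension T smul Y ip J S \<and>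
           (\<forall>t>0. op_norm_on Y ip (S t) \<le> sqrt 2 * onorm (T t)) \<and>
           (\<exists>M. \<forall>t>0. op_norm_on Y ip (S (- t)) \<le> M * exp (\<omega> * t)))"
    by blast
  show "\<forall>smul (Y :: 'b set) ip J S. C0_group_extension T smul Y ip J S \<longrightarrow> satisfies_lower_bounds T"
    using C0_group_extension_lower_bounds by blast
  show "satisfies_lower_bounds T \<longleftrightarrow> (\<exists>L. left_inverse_semigroup L T)"
    using exists_left_inverse_semigroup[OF T] left_inverse_lower_bounds by blast
  show "satisfies_lower_bounds T \<longleftrightarrow>
      (\<exists>smul (Y :: 'a extension_space set) ip J S. C0_group_extension T smul Y ip J S)"
  proof
    assume "satisfies_lower_bounds T"
    then obtain c \<alpha> where lb: "0 < c" "\<And>t x. 0 \<le> t \<Longrightarrow> c * exp (- \<alpha> * t) * norm x \<le> norm (T t x)"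
      using exponential_lower_bound[OF T] by blast
    have "\<forall>x. \<forall>t>0. c * exp (- \<alpha> * t) * norm x \<le> norm (T t x)" using lb(2) by simp
    \<comment> \<open>Any rate above \<open>\<alpha>\<close> would do; here it is
      \<open>\<alpha> + 1\<close>.\<close>
    from quant[OF lb(1) this less_add_one]
    show "\<exists>smul (Y :: 'a extension_space set) ip J S. C0_group_extension T smul Y ip J S"
      by (elim exE conjE) (intro exI)
  qed (use C0_group_extension_lower_bounds in blast)
  show "satisfies_lower_bounds T \<longleftrightarrow>
        (\<exists>Q ip V. bounded_clinear Q \<and> equivalent_inner_product ip \<and>
           C0_semigroup V \<and> generator V = plus_bounded A Q \<and>
           (\<forall>t\<ge>0. \<forall>x. ip_norm ip (V t x) = ip_norm ip x))"
  proof
    assume "satisfies_lower_bounds T"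
    from exists_isometric_perturbation[OF T this]
    show "\<exists>Q ip V. bounded_clinear Q \<and> equivalent_inner_product ip \<and>
           C0_semigroup V \<and> generator V = plus_bounded A Q \<and>
           (\<forall>t\<ge>0. \<forall>x. ip_norm ip (V t x) = ip_norm ip x)"
      unfolding A by metis
  next
    assume "\<exists>Q ip V. bounded_clinear Q \<and> equivalent_inner_product ip \<and>
           C0_semigroup V \<and> generator V = plus_bounded A Q \<and>
           (\<forall>t\<ge>0. \<forall>x. ip_norm ip (V t x) = ip_norm ip x)"
    then obtain Q ip V where "bounded_clinear Q" "equivalent_inner_product ip" "C0_semigroup V"
      "generator V = plus_bounded (generator T) Q"
      "\<And>t x. 0 \<le> t \<Longrightarrow> ip_norm ip (V t x) = ip_norm ip x"
      unfolding A by auto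
    then show "satisfies_lower_bounds T" by (rule isometric_perturbation_lower_bounds[OF T])
  qed
qed

end
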